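(* Let $F\colon S^1\times\mathbb{R}^2\to\mathbb{R}^2$ be smooth, let $C>0$, and let $X$ be the space of $C^1$ solutions $u\colon\mathbb{R}\times S^1\to\mathbb{R}^2$ of the non-linear Cauchy-Riemann equations $u_s-J\bigl(u_t-F(t,u)\bigr)=0$ with $|u(s,t)|\le C$ for all $(s,t)$, with the topology of uniform convergence on compact sets and with the translation flow $\phi^\sigma$. Let $t_0\in S^1$ be arbitrary and let $\pi_{t_0}\colon X\to\mathbb{R}^2$, $\pi_{t_0}(u)=u(0,t_0)$. Then for every $u\in X$ the projection $\pi_{t_0}\colon\omega(u)\to\pi_{t_0}\omega(u)$ is a homeomorphism onto its image.
   Context: $S^1=\mathbb{R}/\mathbb{Z}$, and $J=\begin{pmatrix}0&-1\\1&0\end{pmatrix}$. The variables are $s\in\mathbb{R}$, $t\in S^1$. The flow on $X$ is $(\phi^\sigma(u))(s,t)=u(s+\sigma,t)$, $\sigma\in\mathbb{R}$. Convergence in $X$ is uniform convergence on compact subsets of $\mathbb{R}\times S^1$ (compact-open topology). For $u\in X$, $\omega(u)=\{w\in X:\phi^{\sigma_n}(u)\to w\text{ in }X\text{ for some }\sigma_n\to\infty\}$, with the subspace topology from $X$; $\pi_{t_0}\omega(u)$ has the subspace topology from $\mathbb{R}^2$. *)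

theory Defs
  imports "HOL-Analysis.Analysis"
begin

text \<open>
  The circle \<open>\<real>/\<int>\<close> is handled through its universal cover: a map on \<open>\<real> \<times> S\<^sup>1\<close> is a map on
  \<open>\<real> \<times> \<real>\<close> of period \<open>1\<close> in the second variable, and likewise a map on \<open>S\<^sup>1 \<times> \<real>\<^sup>2\<close> is a map on
  \<open>\<real> \<times> \<real>\<^sup>2\<close> of period \<open>1\<close> in the first. Every compact subset of \<open>\<real> \<times> S\<^sup>1\<close> is the image of a
  compact subset of \<open>\<real> \<times> \<real>\<close>, so for such maps uniform convergence on compact sets means the
  same upstairs and downstairs.
\<close>

text \<open>
  For finite-dimensional \<open>'a\<close>, continuity of every directional derivative is continuity of the
  derivative in operator norm, so this is the usual class \<open>C\<^sup>k\<close>.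
\<close>

primrec Ck :: "nat \<Rightarrow> ('a::euclidean_space \<Rightarrow> 'b::real_normed_vector) \<Rightarrow> bool" where
  "Ck 0 f \<longleftrightarrow> continuous_on UNIV f"
| "Ck (Suc k) f \<longleftrightarrow>
     (\<forall>x. f differentiable (at x)) \<and> (\<forall>v. Ck k (\<lambda>x. frechet_derivative f (at x) v))"

definition smooth :: "('a::euclidean_space \<Rightarrow> 'b::real_normed_vector) \<Rightarrow> bool" where
  "smooth f \<longleftrightarrow> (\<forall>k. Ck k f)"

definition J :: "real^2^2" where
  "J = vector [vector [0, -1], vector [1, 0]]"

definition solutions :: "(real \<times> (real^2) \<Rightarrow> real^2) \<Rightarrow> real \<Rightarrow> (real \<times> real \<Rightarrow> real^2) set" where
  "solutions F C = {u.
     Ck 1 u \<and>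
     (\<forall>s t. u (s, t + 1) = u (s, t)) \<and>
     (\<forall>s t. vector_derivative (\<lambda>x. u (x, t)) (at s)
            - J *v (vector_derivative (\<lambda>y. u (s, y)) (at t) - F (t, u (s, t))) = 0) \<and>
     (\<forall>s t. norm (u (s, t)) \<le> C)}"

text \<open>
  The topology of uniform convergence on compact sets, on all functions; it restricts to the
  compact-open topology on the continuous ones.
\<close>

definition compact_conv_topology :: "('a::topological_space \<Rightarrow> 'b::metric_space) topology" where
  "compact_conv_topology = topology (\<lambda>U. \<forall>f\<in>U. \<exists>K e. compact K \<and> 0 < e \<and>
     {g. \<forall>x\<in>K. dist (g x) (f x) < e} \<subseteq> U)"

lemma openin_compact_conv:
  "openin (compact_conv_topology :: ('a::topological_space \<Rightarrow> 'b::metric_space) topology) U \<longleftrightarrow>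
     (\<forall>f\<in>U. \<exists>K e. compact K \<and> 0 < e \<and> {g. \<forall>x\<in>K. dist (g x) (f x) < e} \<subseteq> U)"
proof -
  let ?P = "\<lambda>U :: ('a \<Rightarrow> 'b) set. \<forall>f\<in>U. \<exists>K e. compact K \<and> 0 < e \<and>
              {g. \<forall>x\<in>K. dist (g x) (f x) < e} \<subseteq> U"
  have "istopology ?P"
    unfolding istopology_def
  proof (intro conjI allI impI)
    fix S T assume S: "?P S" and T: "?P T"
    show "?P (S \<inter> T)"
    proof
      fix f assume f: "f \<in> S \<inter> T"
      from bspec[OF S IntD1[OF f]] obtain K e where K: "compact K" "0 < e"
        "{g. \<forall>x\<in>K. dist (g x) (f x) < e} \<subseteq> S"
        by (elim exE conjE)
      from bspec[OF T IntD2[OF f]] obtain L d where L: "compact L" "0 < d"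
        "{g. \<forall>x\<in>L. dist (g x) (f x) < d} \<subseteq> T"
        by (elim exE conjE)
      have "{g. \<forall>x\<in>K \<union> L. dist (g x) (f x) < min e d} \<subseteq> S \<inter> T"
      proof
        fix g assume g: "g \<in> {g. \<forall>x\<in>K \<union> L. dist (g x) (f x) < min e d}"
        have "g \<in> S" by (rule subsetD[OF K(3)]) (use g in simp)
        moreover have "g \<in> T" by (rule subsetD[OF L(3)]) (use g in simp)
        ultimately show "g \<in> S \<inter> T" by (rule IntI)
      qed
      moreover have "compact (K \<union> L)" "0 < min e d"
        using K(1,2) L(1,2) by (simp_all add: compact_Un)
      ultimately show "\<exists>K e. compact K \<and> 0 < e \<and> {g. \<forall>x\<in>K. dist (g x) (f x) < e} \<subseteq> S \<inter> T"
        by (intro exI conjI)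
    qed
  next
    fix \<K> assume A: "\<forall>S\<in>\<K>. ?P S"
    show "?P (\<Union>\<K>)"
    proof
      fix f assume "f \<in> \<Union>\<K>"
      then obtain S where S: "S \<in> \<K>" "f \<in> S" by (rule UnionE)
      from bspec[OF bspec[OF A S(1)] S(2)] obtain K e where K: "compact K" "0 < e"
        "{g. \<forall>x\<in>K. dist (g x) (f x) < e} \<subseteq> S"
        by (elim exE conjE)
      have "{g. \<forall>x\<in>K. dist (g x) (f x) < e} \<subseteq> \<Union>\<K>"
        by (rule subset_trans[OF K(3) Union_upper[OF S(1)]])
      with K(1,2) show "\<exists>K e. compact K \<and> 0 < e \<and> {g. \<forall>x\<in>K. dist (g x) (f x) < e} \<subseteq> \<Union>\<K>"
        by (intro exI conjI)
    qed
  qed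
  then show ?thesis
    unfolding compact_conv_topology_def by (simp add: topology_inverse')
qed

lemma topspace_compact_conv [simp]:
  "topspace (compact_conv_topology :: ('a::topological_space \<Rightarrow> 'b::metric_space) topology) = UNIV"
proof -
  have "openin (compact_conv_topology :: ('a \<Rightarrow> 'b) topology) UNIV"
    unfolding openin_compact_conv by (intro ballI exI[of _ "{}"] exI[of _ 1]) simp
  then show ?thesis
    using openin_subset by blast
qed

lemma limitin_compact_conv:
  fixes f :: "'c \<Rightarrow> 'a::topological_space \<Rightarrow> 'b::metric_space"
  shows "limitin compact_conv_topology f l F \<longleftrightarrow> (\<forall>K. compact K \<longrightarrow> uniform_limit K f l F)"
proof
  assume lim: "limitin compact_conv_topology f l F"
  show "\<forall>K. compact K \<longrightarrow> uniform_limit K f l F"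
  proof (intro allI impI uniform_limitI)
    fix K :: "'a set" and e :: real
    assume K: "compact K" and e: "0 < e"
    define V where "V = {g. \<exists>d<e. \<forall>x\<in>K. dist (g x) (l x) \<le> d}"
    have "openin compact_conv_topology V"
      unfolding openin_compact_conv
    proof
      fix g assume "g \<in> V"
      then obtain d where d: "d < e" "\<And>x. x \<in> K \<Longrightarrow> dist (g x) (l x) \<le> d"
        by (auto simp: V_def)
      have "h \<in> V" if h: "\<forall>x\<in>K. dist (h x) (g x) < (e - d) / 2" for h
      proof -
        have "dist (h x) (l x) \<le> (e + d) / 2" if "x \<in> K" for x
          using dist_triangle[of "h x" "l x" "g x"] d(2)[OF that] bspec[OF h that]
          by (simp add: field_simps)
        moreover have "(e + d) / 2 < e" using d by simp
        ultimately show ?thesis unfolding V_def by blast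
      qed
      then show "\<exists>K e. compact K \<and> 0 < e \<and> {h. \<forall>x\<in>K. dist (h x) (g x) < e} \<subseteq> V"
        using K d(1) by (intro exI[of _ K] exI[of _ "(e - d) / 2"]) auto
    qed
    moreover have "l \<in> V" using e by (auto simp: V_def)
    ultimately have "\<forall>\<^sub>F n in F. f n \<in> V" using lim by (auto simp: limitin_def)
    then show "\<forall>\<^sub>F n in F. \<forall>x\<in>K. dist (f n x) (l x) < e"
      by eventually_elim (force simp: V_def)
  qed
next
  assume unif: "\<forall>K. compact K \<longrightarrow> uniform_limit K f l F"
  show "limitin compact_conv_topology f l F"
    unfolding limitin_def
  proof (intro conjI allI impI)
    fix U assume U: "openin compact_conv_topology U \<and> l \<in> U"
    from bspec[OF conjunct1[OF U, unfolded openin_compact_conv] conjunct2[OF U]]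
    obtain K e where K: "compact K" "0 < e" "{g. \<forall>x\<in>K. dist (g x) (l x) < e} \<subseteq> U"
      by (elim exE conjE)
    have "\<forall>\<^sub>F n in F. \<forall>x\<in>K. dist (f n x) (l x) < e"
      by (rule uniform_limitD[OF unif[rule_format, OF K(1)] K(2)])
    then show "\<forall>\<^sub>F n in F. f n \<in> U"
      by eventually_elim (rule subsetD[OF K(3)], simp)
  qed simp
qed

definition solution_space :: "(real \<times> (real^2) \<Rightarrow> real^2) \<Rightarrow> real \<Rightarrow> (real \<times> real \<Rightarrow> real^2) topology" where
  "solution_space F C = subtopology compact_conv_topology (solutions F C)"

definition flow :: "real \<Rightarrow> (real \<times> real \<Rightarrow> real^2) \<Rightarrow> real \<times> real \<Rightarrow> real^2" where
  "flow \<sigma> u = (\<lambda>(s, t). u (s + \<sigma>, t))"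

definition omega_limit ::
  "(real \<times> (real^2) \<Rightarrow> real^2) \<Rightarrow> real \<Rightarrow> (real \<times> real \<Rightarrow> real^2) \<Rightarrow> (real \<times> real \<Rightarrow> real^2) set" where
  "omega_limit F C u = {w \<in> solutions F C.
     \<exists>\<sigma> :: nat \<Rightarrow> real. filterlim \<sigma> at_top sequentially \<and>
       limitin (solution_space F C) (\<lambda>n. flow (\<sigma> n) u) w sequentially}"

definition proj :: "real \<Rightarrow> (real \<times> real \<Rightarrow> real^2) \<Rightarrow> real^2" where
  "proj t\<^sub>0 u = u (0, t\<^sub>0)"

end

theory Submission
  imports Defs "HOL-Complex_Analysis.Complex_Analysis"
begin

text \<open>
  Under the identification \<open>(x, y) \<mapsto> x - i y\<close> a solution becomes a function \<open>U\<close> of \<open>z = s + i t\<close>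
  with \<open>U\<^sub>x + i U\<^sub>y = G(z, U)\<close>. The difference \<open>D\<close> of two solutions satisfies
  \<open>\<bar>D\<^sub>x + i D\<^sub>y\<bar> \<le> L \<bar>D\<bar>\<close>, hence \<open>D = e\<^sup>\<phi> h\<close> locally with \<open>\<phi>\<close> continuous and \<open>h\<close> holomorphic. By the
  argument principle the winding number \<open>W(s)\<close> of \<open>t \<mapsto> D(s + i t)\<close> is nondecreasing in \<open>s\<close> and
  increases strictly across every zero of \<open>D\<close>.

  Suppose that \<open>w\<^sub>1 \<noteq> w\<^sub>2\<close> in \<open>\<omega>(u)\<close> meet at \<open>s = 0\<close>, so that \<open>W(w\<^sub>1, w\<^sub>2)\<close> jumps from \<open>k\<^sub>1\<close> to
  \<open>k\<^sub>2 > k\<^sub>1\<close> there, and let \<open>u(\<sigma>\<^sub>n + \<cdot>) \<rightarrow> w\<^sub>1\<close> and \<open>u(\<tau>\<^sub>n + \<cdot>) \<rightarrow> w\<^sub>2\<close>. If \<open>w\<^sub>2\<close> is periodic, then \<open>u\<close> and a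
  suitable translate of \<open>w\<^sub>2\<close> repeat this jump infinitely often, against monotonicity. Otherwise
  \<open>w\<^sub>2\<close> never meets its own translates, and \<open>W(w\<^sub>2, w\<^sub>2(\<cdot> + \<delta>))\<close> has one value \<open>\<kappa>\<close> for all \<open>\<delta> \<noteq> 0\<close>.
  Following the pair \<open>(u(\<sigma>\<^sub>n), u(\<tau>\<^sub>m))\<close> forwards gives \<open>k\<^sub>2 \<le> \<kappa>\<close>. Following it backwards, from a return
  near \<open>w\<^sub>1\<close> to an earlier return near \<open>w\<^sub>2\<close>, gives \<open>W(w\<^sub>2, p) \<le> k\<^sub>1\<close> for a limit \<open>p \<noteq> w\<^sub>2\<close> of backward
  translates of \<open>w\<^sub>2\<close>, whereas \<open>W(w\<^sub>2, p) = \<kappa>\<close>. Hence the projection is injective on \<open>\<omega>(u)\<close>.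

  Compactness of \<open>\<omega>(u)\<close> comes from a Hoelder estimate with exponent \<open>3/4\<close> for functions that are
  bounded together with their Cauchy-Riemann operator. Applied to \<open>U(\<cdot> + h) - U\<close> it bounds second
  differences by \<open>\<bar>h\<bar>\<^bsup>3/2\<^esup>\<close>, which is enough to pass to the limit in the derivatives.
\<close>

section \<open>Partial derivatives and integrals over squares\<close>

text \<open>The delicate point is to get a backward limit \<open>p\<close> different from
  \<open>w2\<close>, since one given limit may well equal \<open>w2\<close>. But the jump of the
  winding number is stable: it survives when \<open>w1\<close> is replaced by a translate
  \<open>shift r w1\<close> with small r > 0, and this replaces \<open>p\<close> by
  \<open>shift (- r) p\<close>. If both limits were \<open>w2\<close>, it would have period r, which
  the periodic case excludes. Winding numbers are compared only on circles where the pair has no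
  common value; such circles are dense, and on them the winding number is stable under locally
  uniform limits. Any exponent \<alpha> strictly between 1/2 and 1 would do in place of 3/4: an
  increment h of the argument changes the Cauchy kernel by at most |h|^\<alpha> times singularities
  of order 1 + \<alpha>, integrable in the plane as \<alpha> < 1, and second differences of order 2
  \<alpha> > 1 make dyadic difference quotients converge geometrically. The quotient of D_x + i D_y
  by D is bounded but may be discontinuous at zeros of D, so \<phi> is a uniform limit of solutions
  for regularised densities. It is merely continuous, but e^\<phi> along a closed loop still does
  not wind.\<close>

definition has_partials ::
  "(complex \<Rightarrow> complex) \<Rightarrow> (complex \<Rightarrow> complex) \<Rightarrow> (complex \<Rightarrow> complex) \<Rightarrow> bool" where
  "has_partials g gx gy \<longleftrightarrow> continuous_on UNIV gx \<and> continuous_on UNIV gy \<and>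
     (\<forall>z. (g has_derivative (\<lambda>h. of_real (Re h) * gx z + of_real (Im h) * gy z)) (at z))"

lemma has_partialsI:
  assumes "continuous_on UNIV gx" "continuous_on UNIV gy"
    and "\<And>z. (g has_derivative (\<lambda>h. of_real (Re h) * gx z + of_real (Im h) * gy z)) (at z)"
  shows "has_partials g gx gy"
  using assms by (simp add: has_partials_def)

lemma has_partials_derivative:
  "has_partials g gx gy \<Longrightarrow> (g has_derivative (\<lambda>h. of_real (Re h) * gx z + of_real (Im h) * gy z)) (at z within S)"
  by (simp add: has_partials_def has_derivative_at_withinI)

lemma has_partials_continuous_x: "has_partials g gx gy \<Longrightarrow> continuous_on S gx"
  and has_partials_continuous_y: "has_partials g gx gy \<Longrightarrow> continuous_on S gy"
  by (auto simp: has_partials_def intro: continuous_on_subset)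

lemma has_partials_continuous: "has_partials g gx gy \<Longrightarrow> continuous_on S g"
  by (meson differentiable_def differentiable_imp_continuous_within continuous_on_eq_continuous_within has_partials_derivative)

lemma has_derivative_Complex [derivative_intros]:
  assumes "(f has_derivative f') F" "(g has_derivative g') F"
  shows "((\<lambda>x. Complex (f x) (g x)) has_derivative (\<lambda>h. Complex (f' h) (g' h))) F"
  unfolding Complex_eq
  using assms by (auto intro!: derivative_eq_intros)

lemma has_partials_vector_derivative_x:
  assumes "has_partials g gx gy"
  shows "((\<lambda>x. g (Complex x y)) has_vector_derivative gx (Complex x y)) (at x within S)"
proof -
  have "((\<lambda>x. Complex x y) has_derivative (\<lambda>h. Complex h 0)) (at x within S)"
    by (auto intro!: derivative_eq_intros)
  from has_derivative_in_compose[OF this has_partials_derivative[OF assms]]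
  show ?thesis by (simp add: has_vector_derivative_def o_def scaleR_conv_of_real)
qed

lemma has_partials_vector_derivative_y:
  assumes "has_partials g gx gy"
  shows "((\<lambda>y. g (Complex x y)) has_vector_derivative gy (Complex x y)) (at y within S)"
proof -
  have "((\<lambda>y. Complex x y) has_derivative (\<lambda>h. Complex 0 h)) (at y within S)"
    by (auto intro!: derivative_eq_intros)
  from has_derivative_in_compose[OF this has_partials_derivative[OF assms]]
  show ?thesis by (simp add: has_vector_derivative_def o_def scaleR_conv_of_real)
qed

lemma has_partials_mult:
  assumes f: "has_partials f fx fy" and g: "has_partials g gx gy"
  shows "has_partials (\<lambda>z. f z * g z) (\<lambda>z. f z * gx z + fx z * g z) (\<lambda>z. f z * gy z + fy z * g z)"
proof (rule has_partialsI)
  note c = has_partials_continuous[OF f] has_partials_continuous[OF g]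
    has_partials_continuous_x[OF f] has_partials_continuous_x[OF g]
    has_partials_continuous_y[OF f] has_partials_continuous_y[OF g]
  show "continuous_on UNIV (\<lambda>z. f z * gx z + fx z * g z)" "continuous_on UNIV (\<lambda>z. f z * gy z + fy z * g z)"
    by (intro continuous_intros c)+
  show "((\<lambda>z. f z * g z) has_derivative
     (\<lambda>h. of_real (Re h) * (f z * gx z + fx z * g z) + of_real (Im h) * (f z * gy z + fy z * g z))) (at z)" for z
    by (rule has_derivative_eq_rhs[OF has_derivative_mult[OF has_partials_derivative[OF f] has_partials_derivative[OF g]]])
      (simp add: algebra_simps)
qed

lemma has_partials_diff:
  assumes f: "has_partials f fx fy" and g: "has_partials g gx gy"
  shows "has_partials (\<lambda>z. f z - g z) (\<lambda>z. fx z - gx z) (\<lambda>z. fy z - gy z)"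
proof (rule has_partialsI)
  note c = has_partials_continuous_x[OF f] has_partials_continuous_x[OF g]
    has_partials_continuous_y[OF f] has_partials_continuous_y[OF g]
  show "continuous_on UNIV (\<lambda>z. fx z - gx z)" "continuous_on UNIV (\<lambda>z. fy z - gy z)"
    by (intro continuous_intros c)+
  show "((\<lambda>z. f z - g z) has_derivative
     (\<lambda>h. of_real (Re h) * (fx z - gx z) + of_real (Im h) * (fy z - gy z))) (at z)" for z
    by (rule has_derivative_eq_rhs[OF has_derivative_diff[OF has_partials_derivative[OF f] has_partials_derivative[OF g]]])
      (simp add: algebra_simps)
qed

lemma has_partials_const: "has_partials (\<lambda>z. c) (\<lambda>z. 0) (\<lambda>z. 0)"
  by (rule has_partialsI) auto

lemma has_partials_shift:
  assumes g: "has_partials g gx gy"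
  shows "has_partials (\<lambda>z. g (z + c)) (\<lambda>z. gx (z + c)) (\<lambda>z. gy (z + c))"
proof (rule has_partialsI)
  show "continuous_on UNIV (\<lambda>z. gx (z + c))" "continuous_on UNIV (\<lambda>z. gy (z + c))"
    by (auto intro!: continuous_on_compose2[OF has_partials_continuous_x[OF g, of UNIV]]
        continuous_on_compose2[OF has_partials_continuous_y[OF g, of UNIV]] continuous_intros)
  have "((\<lambda>z. z + c) has_derivative (\<lambda>h. h)) (at z)" for z
    by (auto intro!: derivative_eq_intros)
  from has_derivative_compose[OF this has_partials_derivative[OF g]]
  show "((\<lambda>z. g (z + c)) has_derivative
     (\<lambda>h. of_real (Re h) * gx (z + c) + of_real (Im h) * gy (z + c))) (at z)" for z .
qed

lemma has_partials_exp:
  assumes f: "has_partials f fx fy"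
  shows "has_partials (\<lambda>z. exp (f z)) (\<lambda>z. exp (f z) * fx z) (\<lambda>z. exp (f z) * fy z)"
proof (rule has_partialsI)
  note c = has_partials_continuous[OF f] has_partials_continuous_x[OF f] has_partials_continuous_y[OF f]
  show "continuous_on UNIV (\<lambda>z. exp (f z) * fx z)" "continuous_on UNIV (\<lambda>z. exp (f z) * fy z)"
    by (intro continuous_intros c)+
  have "(exp has_derivative (\<lambda>h. exp (f z) * h)) (at (f z))" for z
    using DERIV_exp[of "f z"] by (simp add: has_field_derivative_def)
  from has_derivative_compose[OF has_partials_derivative[OF f] this]
  show "((\<lambda>z. exp (f z)) has_derivative
     (\<lambda>h. of_real (Re h) * (exp (f z) * fx z) + of_real (Im h) * (exp (f z) * fy z))) (at z)" for z
    by (simp add: algebra_simps)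
qed

section \<open>Integration over squares\<close>

definition sq :: "real \<Rightarrow> complex set" where
  "sq R = {z. \<bar>Re z\<bar> \<le> R \<and> \<bar>Im z\<bar> \<le> R}"

lemma sq_eq_cbox: "sq R = cbox (Complex (-R) (-R)) (Complex R R)"
  by (auto simp: sq_def in_cbox_complex_iff abs_le_iff)

lemma compact_sq [simp]: "compact (sq R)" and convex_sq [simp]: "convex (sq R)"
  by (auto simp: sq_eq_cbox)

lemma Complex_in_sq: "Complex x y \<in> sq R \<longleftrightarrow> x \<in> {-R..R} \<and> y \<in> {-R..R}"
  by (auto simp: sq_def)

text \<open>Fubini and the fundamental theorem of calculus act on boxes in
  \<open>real \<times> real\<close>, so the square is parametrised by real and imaginary
  part.\<close>

definition qint :: "real \<Rightarrow> (complex \<Rightarrow> 'a::euclidean_space) \<Rightarrow> 'a" where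
  "qint R f = integral (cbox (-R,-R) (R,R)) (\<lambda>p. f (Complex (fst p) (snd p)))"

lemma continuous_on_Complex_pair:
  "continuous_on (sq R) f \<Longrightarrow> continuous_on (cbox (-R,-R) (R,R)) (\<lambda>p. f (Complex (fst p) (snd p)))"
  by (rule continuous_on_compose2[of "sq R" f]) (auto simp: Complex_eq sq_def intro!: continuous_intros)

lemma qint_integrable:
  "continuous_on (sq R) f \<Longrightarrow> (\<lambda>p. f (Complex (fst p) (snd p))) integrable_on cbox (-R,-R) (R,R)"
  for f :: "complex \<Rightarrow> 'a::euclidean_space"
  by (intro integrable_continuous continuous_on_Complex_pair)

lemma qint_norm_le:
  assumes "continuous_on (sq R) f" "continuous_on (sq R) g" "\<And>z. z \<in> sq R \<Longrightarrow> norm (f z) \<le> g z"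
  shows "norm (qint R f) \<le> qint R g"
  unfolding qint_def
  by (rule integral_norm_bound_integral) (use assms in \<open>auto intro: qint_integrable simp: Complex_in_sq\<close>)

lemma qint_mono:
  fixes f g :: "complex \<Rightarrow> real"
  assumes "continuous_on (sq R) f" "continuous_on (sq R) g" "\<And>z. z \<in> sq R \<Longrightarrow> f z \<le> g z"
  shows "qint R f \<le> qint R g"
  unfolding qint_def
  by (rule integral_le) (use assms in \<open>auto intro: qint_integrable simp: Complex_in_sq\<close>)

lemma qint_add: "continuous_on (sq R) f \<Longrightarrow> continuous_on (sq R) g \<Longrightarrow>
   qint R (\<lambda>z. f z + g z) = qint R f + qint R g"
  unfolding qint_def by (intro integral_add qint_integrable)

lemma qint_diff: "continuous_on (sq R) f \<Longrightarrow> continuous_on (sq R) g \<Longrightarrow>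
   qint R (\<lambda>z. f z - g z) = qint R f - qint R g"
  unfolding qint_def by (intro integral_diff qint_integrable)

lemma qint_cmult: "qint R (\<lambda>z. c * f z) = c * qint R f" for f :: "complex \<Rightarrow> complex"
  unfolding qint_def by simp

lemma qint_cmult_real: "qint R (\<lambda>z. c * f z) = c * qint R f" for f :: "complex \<Rightarrow> real"
  unfolding qint_def by simp

lemma qint_of_real: "continuous_on (sq R) f \<Longrightarrow> qint R (\<lambda>z. of_real (f z) :: complex) = of_real (qint R f)"
  unfolding qint_def
  using integral_linear[OF qint_integrable bounded_linear_of_real, of R f] by (simp add: o_def)

lemma qint_cong: "(\<And>z. z \<in> sq R \<Longrightarrow> f z = g z) \<Longrightarrow> qint R f = qint R g"
  unfolding qint_def by (rule integral_cong) (auto simp: Complex_in_sq)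

lemma qint_const: "R \<ge> 0 \<Longrightarrow> qint R (\<lambda>z. c) = 4 * R\<^sup>2 * c" for c :: real
  by (simp add: qint_def content_Pair power2_eq_square)

lemma qint_iterate:
  assumes "continuous_on (sq R) f"
  shows "qint R f = integral {-R..R} (\<lambda>x. integral {-R..R} (\<lambda>y. f (Complex x y)))"
  unfolding qint_def
  using integral_prod_continuous[OF continuous_on_Complex_pair[OF assms]] by simp

lemma qint_iterate_swap:
  assumes "continuous_on (sq R) f"
  shows "qint R f = integral {-R..R} (\<lambda>y. integral {-R..R} (\<lambda>x. f (Complex x y)))"
  unfolding qint_def
  using integral_prod_continuous[OF continuous_on_Complex_pair[OF assms]]
    integral_swap_continuous[of "-R" "-R" R R "\<lambda>x y. f (Complex x y)"]
    continuous_on_Complex_pair[OF assms]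
  by (simp add: case_prod_beta')

lemma qint_product:
  fixes f g :: "real \<Rightarrow> real"
  assumes "continuous_on {-R..R} f" "continuous_on {-R..R} g"
  shows "qint R (\<lambda>z. f (Re z) * g (Im z)) = integral {-R..R} f * integral {-R..R} g"
proof -
  have "continuous_on (sq R) (\<lambda>z. f (Re z) * g (Im z))"
    by (intro continuous_intros continuous_on_compose2[OF assms(1)] continuous_on_compose2[OF assms(2)])
      (auto simp: sq_def)
  then show ?thesis by (simp add: qint_iterate)
qed

section \<open>The regularised Cauchy kernel\<close>

text \<open>\<open>cker e\<close> is the Cauchy kernel \<open>1 / w\<close> smoothed at the origin, so that no singular integral occurs;
  \<open>pker e\<close> is its image under \<open>\<partial>\<^sub>x + i \<partial>\<^sub>y\<close> and, up to a constant, an approximate identity as \<open>e \<rightarrow> 0\<close>.\<close>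

definition cker :: "real \<Rightarrow> complex \<Rightarrow> complex" where
  "cker e w = cnj w / of_real (e\<^sup>2 + (cmod w)\<^sup>2)"

definition pker :: "real \<Rightarrow> complex \<Rightarrow> real" where
  "pker e w = 2 * e\<^sup>2 / (e\<^sup>2 + (cmod w)\<^sup>2)\<^sup>2"

definition cker_x :: "real \<Rightarrow> complex \<Rightarrow> complex" where
  "cker_x e w = 1 / of_real (e\<^sup>2 + (cmod w)\<^sup>2) - of_real (2 * Re w) * cnj w / (of_real (e\<^sup>2 + (cmod w)\<^sup>2))\<^sup>2"

definition cker_y :: "real \<Rightarrow> complex \<Rightarrow> complex" where
  "cker_y e w = - \<i> / of_real (e\<^sup>2 + (cmod w)\<^sup>2) - of_real (2 * Im w) * cnj w / (of_real (e\<^sup>2 + (cmod w)\<^sup>2))\<^sup>2"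

lemma cker_denom_pos: "e > 0 \<Longrightarrow> 0 < e\<^sup>2 + (cmod w)\<^sup>2"
  by (simp add: add_pos_nonneg)

lemma cker_denom_nonzero: "e > 0 \<Longrightarrow> complex_of_real (e\<^sup>2 + (cmod w)\<^sup>2) \<noteq> 0"
  using cker_denom_pos[of e w] by (simp only: of_real_eq_0_iff) simp

lemma has_partials_cker:
  assumes e: "e > 0"
  shows "has_partials (cker e) (cker_x e) (cker_y e)"
proof (rule has_partialsI)
  show "continuous_on UNIV (cker_x e)" "continuous_on UNIV (cker_y e)"
    unfolding cker_x_def cker_y_def
    using e by (auto intro!: continuous_intros simp: add_nonneg_eq_0_iff simp flip: of_real_add of_real_power)
  show "(cker e has_derivative (\<lambda>h. of_real (Re h) * cker_x e z + of_real (Im h) * cker_y e z)) (at z)" for z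
  proof -
    have q: "((\<lambda>w. complex_of_real (e\<^sup>2 + ((Re w)\<^sup>2 + (Im w)\<^sup>2))) has_derivative
       (\<lambda>h. of_real (2 * Re z * Re h + 2 * Im z * Im h))) (at z)"
      by (auto intro!: derivative_eq_intros simp: algebra_simps)
    have c: "(cnj has_derivative cnj) (at z)"
      by (auto intro!: derivative_eq_intros)
    have nz: "complex_of_real (e\<^sup>2 + ((Re z)\<^sup>2 + (Im z)\<^sup>2)) \<noteq> 0"
      using cker_denom_nonzero[OF e, of z] by (simp only: cmod_power2 not_False_eq_True)
    have "((\<lambda>w. cnj w / complex_of_real (e\<^sup>2 + ((Re w)\<^sup>2 + (Im w)\<^sup>2))) has_derivative
      (\<lambda>h. (cnj h * complex_of_real (e\<^sup>2 + ((Re z)\<^sup>2 + (Im z)\<^sup>2)) -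
          cnj z * of_real (2 * Re z * Re h + 2 * Im z * Im h)) /
        (complex_of_real (e\<^sup>2 + ((Re z)\<^sup>2 + (Im z)\<^sup>2)) * complex_of_real (e\<^sup>2 + ((Re z)\<^sup>2 + (Im z)\<^sup>2)))))
      (at z)"
      by (rule has_derivative_divide'[OF c q nz])
    moreover have "cker e = (\<lambda>w. cnj w / complex_of_real (e\<^sup>2 + ((Re w)\<^sup>2 + (Im w)\<^sup>2)))"
      by (simp add: fun_eq_iff cker_def cmod_power2)
    moreover have "(cnj h * Q - cnj z * of_real (2 * Re z * Re h + 2 * Im z * Im h)) / (Q * Q) =
          of_real (Re h) * (1 / Q - of_real (2 * Re z) * cnj z / Q\<^sup>2) +
          of_real (Im h) * (- \<i> / Q - of_real (2 * Im z) * cnj z / Q\<^sup>2)" if "Q \<noteq> 0" for Q h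
    proof -
      have h: "cnj h = of_real (Re h) - \<i> * of_real (Im h)" by (simp add: complex_eq_iff)
      show ?thesis
        using that unfolding h by (simp add: field_simps power2_eq_square)
    qed
    ultimately show ?thesis
      using nz unfolding cker_x_def cker_y_def cmod_power2 by simp
  qed
qed

lemma cker_dbar:
  assumes "e > 0"
  shows "cker_x e w + \<i> * cker_y e w = of_real (pker e w)"
proof -
  define Q where "Q = complex_of_real (e\<^sup>2 + (cmod w)\<^sup>2)"
  have Q: "Q \<noteq> 0" using cker_denom_nonzero[OF assms] by (simp add: Q_def)
  have *: "of_real (2 * Re w) * cnj w + \<i> * (of_real (2 * Im w) * cnj w) = 2 * of_real ((cmod w)\<^sup>2)"
    using cmod_power2[of w] by (simp add: complex_eq_iff power2_eq_square)
  have "cker_x e w + \<i> * cker_y e w =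
      2 / Q - (of_real (2 * Re w) * cnj w + \<i> * (of_real (2 * Im w) * cnj w)) / Q\<^sup>2"
    unfolding cker_x_def cker_y_def Q_def[symmetric] by (simp add: algebra_simps diff_divide_distrib add_divide_distrib)
  also have "\<dots> = (2 * Q - 2 * of_real ((cmod w)\<^sup>2)) / Q\<^sup>2"
    unfolding * using Q by (simp add: field_simps power2_eq_square)
  also have "2 * Q - 2 * of_real ((cmod w)\<^sup>2) = of_real (2 * e\<^sup>2)"
    by (simp add: Q_def)
  finally show ?thesis by (simp add: pker_def Q_def)
qed

lemma pker_nonneg [simp]: "0 \<le> pker e w"
  by (simp add: pker_def)

lemma continuous_on_pker [continuous_intros]:
  "e > 0 \<Longrightarrow> continuous_on S f \<Longrightarrow> continuous_on S (\<lambda>x. pker e (f x))"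
  unfolding pker_def
  by (intro continuous_intros) (use cker_denom_pos[of e] in \<open>auto simp: less_imp_neq[THEN not_sym]\<close>)

lemma continuous_on_cker [continuous_intros]:
  "e > 0 \<Longrightarrow> continuous_on S f \<Longrightarrow> continuous_on S (\<lambda>x. cker e (f x))"
  by (rule continuous_on_compose2[OF has_partials_continuous[OF has_partials_cker, of e UNIV]]) auto

text \<open>Over the common denominator the numerator is e^2 cnj (a - b) + cnj a cnj b (b - a).
  Cauchy-Schwarz for the vectors (e, |a|) and (e, |b|) bounds it by |a - b| times the two square
  roots. For e = 0 this would be the identity |1/a - 1/b| = |a - b| / (|a| |b|).\<close>

lemma cker_diff_le:
  assumes e: "e > 0"
  shows "cmod (cker e a - cker e b) \<le> cmod (a - b) / (sqrt (e\<^sup>2 + (cmod a)\<^sup>2) * sqrt (e\<^sup>2 + (cmod b)\<^sup>2))"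
proof -
  define p q where "p = e\<^sup>2 + (cmod a)\<^sup>2" and "q = e\<^sup>2 + (cmod b)\<^sup>2"
  have pq: "p > 0" "q > 0" using cker_denom_pos[OF e] by (auto simp: p_def q_def)
  have "cker e a - cker e b = (cnj a * of_real q - cnj b * of_real p) / (of_real p * of_real q)"
    using pq unfolding cker_def p_def[symmetric] q_def[symmetric] by (simp add: field_simps)
  also have "cnj a * of_real q - cnj b * of_real p = of_real (e\<^sup>2) * cnj (a - b) + cnj a * cnj b * (b - a)"
    by (simp add: p_def q_def complex_norm_square algebra_simps del: of_real_power)
  finally have eq: "cker e a - cker e b = (of_real (e\<^sup>2) * cnj (a - b) + cnj a * cnj b * (b - a)) / (of_real p * of_real q)" .
  have "cmod (of_real (e\<^sup>2) * cnj (a - b) + cnj a * cnj b * (b - a)) \<le> e\<^sup>2 * cmod (a - b) + cmod a * cmod b * cmod (a - b)"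
    by (rule order_trans[OF norm_triangle_ineq]) (simp add: norm_mult norm_minus_commute norm_power flip: complex_cnj_diff)
  also have "\<dots> = cmod (a - b) * (e\<^sup>2 + cmod a * cmod b)" by (simp add: algebra_simps)
  also have "\<dots> \<le> cmod (a - b) * (sqrt p * sqrt q)"
  proof (rule mult_left_mono)
    have "(e\<^sup>2 + cmod a * cmod b)\<^sup>2 \<le> p * q"
    proof -
      have "0 \<le> e\<^sup>2 * (cmod a - cmod b)\<^sup>2" by simp
      then show ?thesis by (simp add: p_def q_def power2_eq_square algebra_simps)
    qed
    then have "e\<^sup>2 + cmod a * cmod b \<le> sqrt (p * q)"
      by (rule real_le_rsqrt)
    then show "e\<^sup>2 + cmod a * cmod b \<le> sqrt p * sqrt q" by (simp add: real_sqrt_mult)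
  qed simp
  finally have n: "cmod (of_real (e\<^sup>2) * cnj (a - b) + cnj a * cnj b * (b - a)) \<le> cmod (a - b) * (sqrt p * sqrt q)" .
  have "cmod (cker e a - cker e b) \<le> cmod (a - b) * (sqrt p * sqrt q) / (p * q)"
    unfolding eq using n pq by (simp add: norm_divide norm_mult divide_right_mono)
  also have "\<dots> = cmod (a - b) / (sqrt p * sqrt q)"
  proof -
    have "p * q = (sqrt p * sqrt q) * (sqrt p * sqrt q)"
      using pq by (simp only: mult_ac real_sqrt_mult_self)
    then show ?thesis using pq by (simp add: divide_simps)
  qed
  finally show ?thesis by (simp add: p_def q_def)
qed

text \<open>Only d^(3/4) is kept. The leftover d^(1/4) is at most twice the fourth root of the
  larger denominator and is absorbed there, which leaves one singularity of order 7/4, below the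
  critical order 2 of the plane.\<close>

lemma powr_quarter_quotient_le:
  fixes A B d :: real
  assumes "0 < A" "0 < B" "0 \<le> d" "d \<le> A + B"
  shows "d / (A * B) \<le> 2 * d powr (3/4) * (A powr (-7/4) + B powr (-7/4))"
proof -
  have main: "d powr (1/4) / (A * B) \<le> 2 * A powr (-7/4)" if "0 < A" "A \<le> B" "d \<le> A + B" for A B
  proof -
    have "d powr (1/4) \<le> (2 * B) powr (1/4)"
      using that assms by (intro powr_mono2) auto
    also have "\<dots> = 2 powr (1/4) * B powr (1/4)" using that by (simp add: powr_mult)
    also have "\<dots> \<le> 2 * B powr (1/4)"
    proof -
      have "2 powr (1/4) \<le> (2::real) powr 1" by (intro powr_mono) auto
      then show ?thesis by (intro mult_right_mono) auto
    qed
    finally have "d powr (1/4) / (A * B) \<le> 2 * B powr (1/4) / (A * B)"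
      using that by (intro divide_right_mono) auto
    also have "\<dots> = 2 * (B powr (-3/4)) * A powr (-1)"
    proof -
      have B: "B powr (-3/4) = B powr (1/4) / B" using that powr_diff[of B "1/4" 1] by simp
      show ?thesis using that unfolding B by (simp add: powr_neg_one)
    qed
    also have "\<dots> \<le> 2 * (A powr (-3/4)) * A powr (-1)"
      using that by (intro mult_right_mono mult_left_mono powr_mono2') auto
    also have "\<dots> = 2 * A powr (-7/4)" using powr_add[of A "-3/4" "-1"] by simp
    finally show ?thesis .
  qed
  have "d powr (1/4) / (A * B) \<le> 2 * (A powr (-7/4) + B powr (-7/4))"
  proof (cases "A \<le> B")
    case True
    then show ?thesis using main[of A B] assms by (smt (verit) powr_ge_zero)
  next
    case False
    then show ?thesis using main[of B A] assms by (smt (verit) powr_ge_zero mult.commute)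
  qed
  then have "d powr (3/4) * (d powr (1/4) / (A * B)) \<le> d powr (3/4) * (2 * (A powr (-7/4) + B powr (-7/4)))"
    by (rule mult_left_mono) simp
  moreover have "d powr (3/4) * d powr (1/4) = d" using assms by (simp flip: powr_add)
  ultimately show ?thesis by (simp add: algebra_simps)
qed

lemma cker_holder:
  assumes e: "e > 0"
  shows "cmod (cker e a - cker e b) \<le> 2 * cmod (a - b) powr (3/4) *
    ((e\<^sup>2 + (cmod a)\<^sup>2) powr (-7/8) + (e\<^sup>2 + (cmod b)\<^sup>2) powr (-7/8))"
proof -
  have s: "sqrt (e\<^sup>2 + (cmod w)\<^sup>2) powr (-7/4) = (e\<^sup>2 + (cmod w)\<^sup>2) powr (-7/8)" for w
    by (simp add: powr_half_sqrt[symmetric] powr_powr)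
  have l: "cmod w \<le> sqrt (e\<^sup>2 + (cmod w)\<^sup>2)" for w
    by (rule real_le_rsqrt) simp
  have p: "0 < sqrt (e\<^sup>2 + (cmod w)\<^sup>2)" for w
    using cker_denom_pos[OF e] by simp
  have "cmod (a - b) \<le> sqrt (e\<^sup>2 + (cmod a)\<^sup>2) + sqrt (e\<^sup>2 + (cmod b)\<^sup>2)"
    using norm_triangle_ineq4[of a b] l[of a] l[of b] by linarith
  from order_trans[OF cker_diff_le[OF e, of a b] powr_quarter_quotient_le[OF p p norm_ge_zero this]]
  show ?thesis unfolding s .
qed

text \<open>The function \<open>\<psi>\<close> is almost an antiderivative: its derivative is the
  integrand minus at most 7/8 of it, so the integrand is at most 8 \<open>\<psi>'\<close>. Since
  |\<open>\<psi>\<close>| is at most the 1/16-th power of the denominator, the bound is uniform as e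
  tends to 0.\<close>

lemma integral_powr_shift_le:
  fixes a e R :: real
  assumes e: "0 < e" "e \<le> 1" and a: "\<bar>a\<bar> \<le> R"
  shows "integral {-R..R} (\<lambda>x. (e\<^sup>2 + (x - a)\<^sup>2) powr (-7/16)) \<le> 16 * (1 + 4 * R\<^sup>2)"
proof -
  define \<psi> where "\<psi> = (\<lambda>x. (x - a) * (e\<^sup>2 + (x - a)\<^sup>2) powr (-7/16))"
  define \<psi>' where "\<psi>' = (\<lambda>x. (e\<^sup>2 + (x - a)\<^sup>2) powr (-7/16) -
      (7/8) * (x - a)\<^sup>2 * (e\<^sup>2 + (x - a)\<^sup>2) powr (-7/16 - 1))"
  have R: "R \<ge> 0" using a by simp
  have q: "0 < e\<^sup>2 + (x - a)\<^sup>2" for x using e by (simp add: add_pos_nonneg)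
  have der: "(\<psi> has_real_derivative \<psi>' x) (at x within S)" for x S
    unfolding \<psi>_def \<psi>'_def
    by (rule derivative_eq_intros refl q | simp)+ (simp add: power2_eq_square algebra_simps)
  have int: "(\<psi>' has_integral (\<psi> R - \<psi> (-R))) {-R..R}"
    by (rule fundamental_theorem_of_calculus)
      (use R der in \<open>auto simp: has_real_derivative_iff_has_vector_derivative\<close>)
  have "(e\<^sup>2 + (x - a)\<^sup>2) powr (-7/16) \<le> 8 * \<psi>' x" for x
  proof -
    have "(x - a)\<^sup>2 * (e\<^sup>2 + (x - a)\<^sup>2) powr (-7/16 - 1) \<le> (e\<^sup>2 + (x - a)\<^sup>2) * (e\<^sup>2 + (x - a)\<^sup>2) powr (-7/16 - 1)"
      by (intro mult_right_mono) auto
    also have "\<dots> = (e\<^sup>2 + (x - a)\<^sup>2) powr (-7/16)"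
      using q[of x] powr_add[of "e\<^sup>2 + (x - a)\<^sup>2" 1 "-7/16 - 1"] by simp
    finally show ?thesis by (simp add: \<psi>'_def)
  qed
  moreover have "(\<lambda>x. (e\<^sup>2 + (x - a)\<^sup>2) powr (-7/16)) integrable_on {-R..R}"
    by (rule integrable_continuous_interval) (use q in \<open>auto intro!: continuous_intros simp: less_imp_neq[THEN not_sym]\<close>)
  ultimately have "integral {-R..R} (\<lambda>x. (e\<^sup>2 + (x - a)\<^sup>2) powr (-7/16)) \<le> integral {-R..R} (\<lambda>x. 8 * \<psi>' x)"
    using int by (intro integral_le) (auto intro: has_integral_integrable)
  also have "\<dots> = 8 * (\<psi> R - \<psi> (-R))"
    using int by (simp add: integral_unique)
  also have "\<dots> \<le> 8 * ((1 + 4 * R\<^sup>2) + (1 + 4 * R\<^sup>2))"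
  proof -
    have "\<bar>\<psi> x\<bar> \<le> 1 + 4 * R\<^sup>2" if "\<bar>x\<bar> \<le> R" for x
    proof -
      let ?q = "e\<^sup>2 + (x - a)\<^sup>2"
      have "\<bar>x - a\<bar> \<le> sqrt ?q" by (rule real_le_rsqrt) simp
      then have "\<bar>\<psi> x\<bar> \<le> sqrt ?q * ?q powr (-7/16)"
        unfolding \<psi>_def by (simp add: abs_mult mult_right_mono)
      also have "\<dots> = ?q powr (1/16)"
        using q[of x] by (simp add: powr_half_sqrt[symmetric] powr_add[symmetric])
      also have "\<dots> \<le> (1 + 4 * R\<^sup>2) powr (1/16)"
      proof (rule powr_mono2)
        have "e\<^sup>2 \<le> 1" using e by (simp add: power_le_one)
        moreover have "(x - a)\<^sup>2 \<le> (2 * R)\<^sup>2"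
          by (rule abs_le_square_iff[THEN iffD1]) (use that a in auto)
        ultimately show "?q \<le> 1 + 4 * R\<^sup>2" by (simp add: power_mult_distrib)
      qed auto
      also have "\<dots> \<le> (1 + 4 * R\<^sup>2) powr 1" by (intro powr_mono) auto
      finally show ?thesis by (simp add: abs_of_pos add_pos_nonneg)
    qed
    from this[of R] this[of "-R"] show ?thesis using R by (simp add: abs_le_iff)
  qed
  finally show ?thesis by simp
qed

text \<open>The square of e^2 + x^2 + y^2 dominates (e^2 + x^2)(e^2 + y^2), so the planar
  singularity of order 7/4 splits into two one-dimensional ones of order 7/8, each still
  integrable.\<close>

lemma powr_denom_product_le:
  assumes "e > 0"
  shows "(e\<^sup>2 + (cmod w)\<^sup>2) powr (-7/8) \<le> (e\<^sup>2 + (Re w)\<^sup>2) powr (-7/16) * (e\<^sup>2 + (Im w)\<^sup>2) powr (-7/16)"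
proof -
  have p: "0 < e\<^sup>2 + (Re w)\<^sup>2" "0 < e\<^sup>2 + (Im w)\<^sup>2" "0 < e\<^sup>2 + (cmod w)\<^sup>2"
    using assms by (auto simp: add_pos_nonneg)
  have "(e\<^sup>2 + (cmod w)\<^sup>2) powr (-7/8) = ((e\<^sup>2 + (cmod w)\<^sup>2)\<^sup>2) powr (-7/16)"
    using p(3) by (simp add: powr_powr flip: powr_numeral)
  also have "\<dots> \<le> ((e\<^sup>2 + (Re w)\<^sup>2) * (e\<^sup>2 + (Im w)\<^sup>2)) powr (-7/16)"
  proof (rule powr_mono2')
    have "0 \<le> e\<^sup>2 * (Re w)\<^sup>2 + e\<^sup>2 * (Im w)\<^sup>2 + (Re w)\<^sup>2 * (Im w)\<^sup>2 + ((Re w)\<^sup>2)\<^sup>2 + ((Im w)\<^sup>2)\<^sup>2"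
      by (intro add_nonneg_nonneg) auto
    then show "(e\<^sup>2 + (Re w)\<^sup>2) * (e\<^sup>2 + (Im w)\<^sup>2) \<le> (e\<^sup>2 + (cmod w)\<^sup>2)\<^sup>2"
      unfolding cmod_power2 by (simp add: power2_eq_square algebra_simps)
  qed (use p in auto)
  finally show ?thesis using p by (simp add: powr_mult)
qed

lemma qint_powr_le:
  assumes e: "0 < e" "e \<le> 1" and z: "z \<in> sq R"
  shows "qint R (\<lambda>w. (e\<^sup>2 + (cmod (w - z))\<^sup>2) powr (-7/8)) \<le> (16 * (1 + 4 * R\<^sup>2))\<^sup>2"
proof -
  let ?f = "\<lambda>a x. (e\<^sup>2 + (x - a)\<^sup>2) powr (-7/16)"
  have cf: "continuous_on S (?f a)" for a S
    using e by (auto intro!: continuous_intros simp: add_nonneg_eq_0_iff)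
  have "qint R (\<lambda>w. (e\<^sup>2 + (cmod (w - z))\<^sup>2) powr (-7/8)) \<le> qint R (\<lambda>w. ?f (Re z) (Re w) * ?f (Im z) (Im w))"
  proof (rule qint_mono)
    show "continuous_on (sq R) (\<lambda>w. (e\<^sup>2 + (cmod (w - z))\<^sup>2) powr (-7/8))"
      using e by (auto intro!: continuous_intros simp: add_nonneg_eq_0_iff)
    show "continuous_on (sq R) (\<lambda>w. ?f (Re z) (Re w) * ?f (Im z) (Im w))"
      using e by (auto intro!: continuous_intros simp: add_nonneg_eq_0_iff)
    show "(e\<^sup>2 + (cmod (w - z))\<^sup>2) powr (-7/8) \<le> ?f (Re z) (Re w) * ?f (Im z) (Im w)" for w
      using powr_denom_product_le[OF e(1), of "w - z"] by simp
  qed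
  also have "\<dots> = integral {-R..R} (?f (Re z)) * integral {-R..R} (?f (Im z))"
    by (rule qint_product) (rule cf)+
  also have "\<dots> \<le> (16 * (1 + 4 * R\<^sup>2)) * (16 * (1 + 4 * R\<^sup>2))"
  proof (rule mult_mono)
    show "integral {-R..R} (?f (Re z)) \<le> 16 * (1 + 4 * R\<^sup>2)"
      by (rule integral_powr_shift_le[OF e]) (use z in \<open>simp add: sq_def\<close>)
    show "integral {-R..R} (?f (Im z)) \<le> 16 * (1 + 4 * R\<^sup>2)"
      by (rule integral_powr_shift_le[OF e]) (use z in \<open>simp add: sq_def\<close>)
    show "0 \<le> integral {-R..R} (?f (Im z))"
      by (rule integral_nonneg) (intro integrable_continuous_interval cf, simp)
  qed (simp add: add_nonneg_nonneg)
  finally show ?thesis by (simp add: power2_eq_square)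
qed

text \<open>The 4 is the factor 2 of \<open>cker_holder\<close> times the two points at which the
  singular integral is bounded by \<open>qint_powr_le\<close>.\<close>

definition pot_const :: "real \<Rightarrow> real" where
  "pot_const R = 4 * (16 * (1 + 4 * R\<^sup>2))\<^sup>2"

lemma pot_const_pos: "pot_const R > 0"
proof -
  have "0 < 1 + 4 * R\<^sup>2" by (simp add: add_pos_nonneg)
  then show ?thesis by (simp add: pot_const_def)
qed

text \<open>The bound of \<open>cker_holder\<close> is integrated against the density. That e does
  not enter the constant is the point: it gives equicontinuity while the smoothing is
  removed.\<close>

lemma potential_holder:
  assumes e: "0 < e" "e \<le> 1" and z: "z \<in> sq R" "z' \<in> sq R"
    and a: "continuous_on (sq R) a" "\<And>w. w \<in> sq R \<Longrightarrow> cmod (a w) \<le> M"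
  shows "cmod (qint R (\<lambda>w. a w * cker e (w - z)) - qint R (\<lambda>w. a w * cker e (w - z'))) \<le>
    M * pot_const R * cmod (z - z') powr (3/4)"
proof -
  let ?g = "\<lambda>z w. (e\<^sup>2 + (cmod (w - z))\<^sup>2) powr (-7/8)"
  let ?d = "cmod (z - z') powr (3/4)"
  have cg: "continuous_on S (?g z)" for z S
    using e by (auto intro!: continuous_intros simp: add_nonneg_eq_0_iff)
  have ck: "continuous_on S (\<lambda>w. cker e (w - z))" for S z
    by (intro continuous_intros e)
  have M: "0 \<le> M" using a(2)[OF z(1)] norm_ge_zero order_trans by blast
  have "cmod (qint R (\<lambda>w. a w * cker e (w - z)) - qint R (\<lambda>w. a w * cker e (w - z'))) =
      cmod (qint R (\<lambda>w. a w * cker e (w - z) - a w * cker e (w - z')))"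
    by (subst qint_diff) (intro continuous_on_mult a ck refl)+
  also have "\<dots> \<le> qint R (\<lambda>w. (M * (2 * ?d)) * (?g z w + ?g z' w))"
  proof (rule qint_norm_le)
    fix w assume w: "w \<in> sq R"
    have "cmod (a w * cker e (w - z) - a w * cker e (w - z')) = cmod (a w) * cmod (cker e (w - z) - cker e (w - z'))"
      by (simp add: norm_mult flip: right_diff_distrib)
    also have "\<dots> \<le> M * (2 * ?d * (?g z w + ?g z' w))"
    proof (rule mult_mono)
      show "cmod (cker e (w - z) - cker e (w - z')) \<le> 2 * ?d * (?g z w + ?g z' w)"
        using cker_holder[OF e(1), of "w - z" "w - z'"] by (simp add: norm_minus_commute)
    qed (use a w M in auto)
    finally show "cmod (a w * cker e (w - z) - a w * cker e (w - z')) \<le> (M * (2 * ?d)) * (?g z w + ?g z' w)"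
      by (simp add: algebra_simps)
  next
    show "continuous_on (sq R) (\<lambda>w. a w * cker e (w - z) - a w * cker e (w - z'))"
      by (intro continuous_on_diff continuous_on_mult a ck)
    show "continuous_on (sq R) (\<lambda>w. (M * (2 * ?d)) * (?g z w + ?g z' w))"
      by (intro continuous_on_mult continuous_on_add continuous_on_const cg)
  qed
  also have "\<dots> = (M * (2 * ?d)) * (qint R (?g z) + qint R (?g z'))"
    using qint_cmult_real[of R "M * (2 * ?d)" "\<lambda>w. ?g z w + ?g z' w"]
      qint_add[OF cg[of "sq R" z] cg[of "sq R" z']] by (rule trans[OF _ arg_cong])
  also have "\<dots> \<le> (M * (2 * ?d)) * ((16 * (1 + 4 * R\<^sup>2))\<^sup>2 + (16 * (1 + 4 * R\<^sup>2))\<^sup>2)"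
    by (rule mult_left_mono[OF add_mono[OF qint_powr_le[OF e z(1)] qint_powr_le[OF e z(2)]]]) (use M in simp)
  finally show ?thesis unfolding pot_const_def by (simp only: mult_ac mult_2[symmetric])
qed

section \<open>Hoelder estimate from a bound on the Cauchy-Riemann operator\<close>

text \<open>Each partial derivative is integrated first in its own variable, which leaves only
  boundary values.\<close>

lemma qint_dbar_eq_zero:
  assumes H: "has_partials H Hx Hy"
    and bd: "\<And>z. z \<in> sq R \<Longrightarrow> \<bar>Re z\<bar> = R \<or> \<bar>Im z\<bar> = R \<Longrightarrow> H z = 0"
    and R: "R \<ge> 0"
  shows "qint R (\<lambda>z. Hx z + \<i> * Hy z) = 0"
proof -
  note c = has_partials_continuous_x[OF H] has_partials_continuous_y[OF H]
  have x: "integral {-R..R} (\<lambda>x. Hx (Complex x y)) = 0" if "y \<in> {-R..R}" for y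
  proof -
    have "((\<lambda>x. Hx (Complex x y)) has_integral (H (Complex R y) - H (Complex (-R) y))) {-R..R}"
      using R by (intro fundamental_theorem_of_calculus has_partials_vector_derivative_x[OF H]) auto
    moreover have "H (Complex R y) = 0" "H (Complex (-R) y) = 0"
      using R that by (auto intro!: bd simp: sq_def)
    ultimately show ?thesis by (simp add: integral_unique)
  qed
  have y: "integral {-R..R} (\<lambda>y. Hy (Complex x y)) = 0" if "x \<in> {-R..R}" for x
  proof -
    have "((\<lambda>y. Hy (Complex x y)) has_integral (H (Complex x R) - H (Complex x (-R)))) {-R..R}"
      using R by (intro fundamental_theorem_of_calculus has_partials_vector_derivative_y[OF H]) auto
    moreover have "H (Complex x R) = 0" "H (Complex x (-R)) = 0"
      using R that by (auto intro!: bd simp: sq_def)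
    ultimately show ?thesis by (simp add: integral_unique)
  qed
  have "qint R Hx = integral {-R..R} (\<lambda>y. 0)"
    unfolding qint_iterate_swap[OF c(1)] by (rule integral_cong) (rule x)
  moreover have "qint R Hy = integral {-R..R} (\<lambda>x. 0)"
    unfolding qint_iterate[OF c(2)] by (rule integral_cong) (rule y)
  moreover have "qint R (\<lambda>z. Hx z + \<i> * Hy z) = qint R Hx + \<i> * qint R Hy"
    by (subst qint_add) (intro continuous_intros c | simp add: qint_cmult)+
  ultimately show ?thesis by simp
qed

text \<open>Product rule for G times the translated kernel: the product vanishes on the boundary,
  and the Cauchy-Riemann operator sends the kernel to \<open>pker\<close>.\<close>

lemma cauchy_pompeiu_regularized:
  assumes G: "has_partials G Gx Gy"
    and bd: "\<And>z. z \<in> sq R \<Longrightarrow> \<bar>Re z\<bar> = R \<or> \<bar>Im z\<bar> = R \<Longrightarrow> G z = 0"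
    and R: "R \<ge> 0" and e: "e > 0"
  shows "qint R (\<lambda>w. (Gx w + \<i> * Gy w) * cker e (w - z)) = - qint R (\<lambda>w. G w * of_real (pker e (w - z)))"
proof -
  note k = has_partials_shift[OF has_partials_cker[OF e], of "- z"]
  have "qint R (\<lambda>w. (G w * cker_x e (w + - z) + Gx w * cker e (w + - z)) +
      \<i> * (G w * cker_y e (w + - z) + Gy w * cker e (w + - z))) = 0"
    by (rule qint_dbar_eq_zero[OF has_partials_mult[OF G k] _ R]) (simp add: bd)
  moreover have "(G w * cker_x e (w + - z) + Gx w * cker e (w + - z)) +
      \<i> * (G w * cker_y e (w + - z) + Gy w * cker e (w + - z)) =
      (Gx w + \<i> * Gy w) * cker e (w - z) + G w * of_real (pker e (w - z))" for w
    using cker_dbar[OF e, of "w - z", symmetric] by (simp add: algebra_simps)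
  moreover have "qint R (\<lambda>w. (Gx w + \<i> * Gy w) * cker e (w - z) + G w * of_real (pker e (w - z))) =
      qint R (\<lambda>w. (Gx w + \<i> * Gy w) * cker e (w - z)) + qint R (\<lambda>w. G w * of_real (pker e (w - z)))"
    by (rule qint_add; intro continuous_intros e has_partials_continuous_x[OF G]
        has_partials_continuous_y[OF G] has_partials_continuous[OF G])
  ultimately show ?thesis by (simp add: add_eq_0_iff2)
qed

section \<open>The smoothed kernel as an approximate identity\<close>

definition pmass :: "real \<Rightarrow> real" where
  "pmass e = qint 1 (pker e)"

text \<open>The mass is left unnormalised; it will be divided out, so what matters is its distance
  from 0. On the square of half-side e the kernel is at least 2 / (9 e^2), which already contributes
  8/9.\<close>

lemma pmass_ge:
  assumes e: "0 < e" "e \<le> 1"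
  shows "1/2 \<le> pmass e"
proof -
  let ?f = "\<lambda>p::real \<times> real. pker e (Complex (fst p) (snd p))"
  let ?B = "cbox (-e,-e) (e,e) :: (real \<times> real) set"
  have cont: "continuous_on S ?f" for S
    using e by (auto intro!: continuous_intros simp: Complex_eq)
  have i1: "?f integrable_on ?B" and i2: "?f integrable_on cbox (-1,-1) (1,1)"
    by (rule integrable_continuous[OF cont])+
  have "integral ?B (\<lambda>p. 2 / (9 * e\<^sup>2)) \<le> integral ?B ?f"
  proof (rule integral_le)
    fix p :: "real \<times> real" assume "p \<in> ?B"
    then have "(fst p)\<^sup>2 \<le> e\<^sup>2" "(snd p)\<^sup>2 \<le> e\<^sup>2"
      by (auto simp: cbox_Pair_eq abs_le_square_iff[symmetric])
    then have "(e\<^sup>2 + ((fst p)\<^sup>2 + (snd p)\<^sup>2))\<^sup>2 \<le> (3 * e\<^sup>2)\<^sup>2"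
      by (intro power_mono) auto
    then have "2 * e\<^sup>2 / (3 * e\<^sup>2)\<^sup>2 \<le> ?f p"
      unfolding pker_def cmod_power2 using e
      by (intro divide_left_mono mult_pos_pos zero_less_power) (auto simp: add_pos_nonneg)
    then show "2 / (9 * e\<^sup>2) \<le> ?f p"
      using e by (simp add: power2_eq_square divide_simps)
  qed (use i1 in auto)
  moreover have "integral ?B (\<lambda>p. 2 / (9 * e\<^sup>2)) = 8 / 9"
    using e by (simp add: content_Pair power2_eq_square)
  moreover have "integral ?B ?f \<le> integral (cbox (-1,-1) (1,1)) ?f"
    by (rule integral_subset_le) (use e i1 i2 in \<open>auto simp: cbox_Pair_eq\<close>)
  ultimately show ?thesis by (simp add: pmass_def qint_def)
qed

lemma integral_poisson_le:
  fixes a e R :: real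
  assumes e: "0 < e" and R: "R \<ge> 0"
  shows "integral {-R..R} (\<lambda>x. e / (e\<^sup>2 + (x - a)\<^sup>2)) \<le> 4"
proof -
  have "((\<lambda>x. arctan ((x - a) / e)) has_real_derivative e / (e\<^sup>2 + (x - a)\<^sup>2)) (at x within S)" for x S
  proof -
    have "e * (e * (1 + ((x - a) / e)\<^sup>2)) = e\<^sup>2 + (x - a)\<^sup>2"
      using e by (simp add: power2_eq_square field_simps)
    then have "1 / (e * (1 + ((x - a) / e)\<^sup>2)) = e / (e\<^sup>2 + (x - a)\<^sup>2)"
      using e by (metis mult_divide_mult_cancel_left_if mult.right_neutral less_irrefl)
    then show ?thesis
      using e by (auto intro!: derivative_eq_intros simp: divide_simps)
  qed
  then have "((\<lambda>x. e / (e\<^sup>2 + (x - a)\<^sup>2)) has_integral (arctan ((R - a) / e) - arctan ((-R - a) / e))) {-R..R}"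
    using R by (intro fundamental_theorem_of_calculus) (auto simp: has_real_derivative_iff_has_vector_derivative)
  then have "integral {-R..R} (\<lambda>x. e / (e\<^sup>2 + (x - a)\<^sup>2)) = arctan ((R - a) / e) - arctan ((-R - a) / e)"
    by (rule integral_unique)
  also have "\<dots> \<le> 4"
    using arctan_ubound[of "(R - a) / e"] arctan_lbound[of "(-R - a) / e"] pi_less_4 by linarith
  finally show ?thesis .
qed

text \<open>The kernel is at most twice a product of one-dimensional Poisson kernels, each of
  integral at most \<pi> < 4; hence 2 * 4 * 4.\<close>

lemma qint_pker_le:
  assumes e: "0 < e" and R: "R \<ge> 0"
  shows "qint R (\<lambda>w. pker e (w - z)) \<le> 32"
proof -
  let ?f = "\<lambda>a x. e / (e\<^sup>2 + (x - a)\<^sup>2)"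
  have q: "0 < e\<^sup>2 + t\<^sup>2" for t :: real using e by (simp add: add_pos_nonneg)
  have cf: "continuous_on S (?f a)" for a S
    using q by (auto intro!: continuous_intros simp: less_imp_neq[THEN not_sym])
  have cf2: "continuous_on S (\<lambda>w. ?f (Re z) (Re w) * ?f (Im z) (Im w))" for S
    using q by (auto intro!: continuous_intros simp: less_imp_neq[THEN not_sym])
  have "qint R (\<lambda>w. pker e (w - z)) \<le> qint R (\<lambda>w. 2 * (?f (Re z) (Re w) * ?f (Im z) (Im w)))"
  proof (rule qint_mono)
    show "continuous_on (sq R) (\<lambda>w. pker e (w - z))"
      by (intro continuous_intros e)
    show "continuous_on (sq R) (\<lambda>w. 2 * (?f (Re z) (Re w) * ?f (Im z) (Im w)))"
      by (intro continuous_on_mult continuous_on_const cf2)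
    fix w
    define x y where "x = Re w - Re z" and "y = Im w - Im z"
    have "0 \<le> e\<^sup>2 * x\<^sup>2 + e\<^sup>2 * y\<^sup>2 + x\<^sup>2 * y\<^sup>2 + (x\<^sup>2)\<^sup>2 + (y\<^sup>2)\<^sup>2"
      by (intro add_nonneg_nonneg) auto
    then have "(e\<^sup>2 + x\<^sup>2) * (e\<^sup>2 + y\<^sup>2) \<le> (e\<^sup>2 + (x\<^sup>2 + y\<^sup>2))\<^sup>2"
      by (simp add: power2_eq_square algebra_simps)
    then have "2 * e\<^sup>2 / (e\<^sup>2 + (x\<^sup>2 + y\<^sup>2))\<^sup>2 \<le> 2 * e\<^sup>2 / ((e\<^sup>2 + x\<^sup>2) * (e\<^sup>2 + y\<^sup>2))"
      using e q by (intro divide_left_mono mult_pos_pos zero_less_power) (auto simp: add_pos_nonneg)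
    also have "\<dots> = 2 * (e / (e\<^sup>2 + x\<^sup>2) * (e / (e\<^sup>2 + y\<^sup>2)))"
      by (simp add: power2_eq_square)
    finally show "pker e (w - z) \<le> 2 * (?f (Re z) (Re w) * ?f (Im z) (Im w))"
      unfolding pker_def cmod_power2 x_def y_def by simp
  qed
  also have "\<dots> = 2 * (integral {-R..R} (?f (Re z)) * integral {-R..R} (?f (Im z)))"
    using qint_cmult_real[of R 2 "\<lambda>w. ?f (Re z) (Re w) * ?f (Im z) (Im w)"]
      qint_product[OF cf[of "{-R..R}" "Re z"] cf[of "{-R..R}" "Im z"]] by (rule trans[OF _ arg_cong])
  also have "\<dots> \<le> 2 * (4 * 4)"
  proof (rule mult_left_mono[OF mult_mono])
    show "0 \<le> integral {-R..R} (?f (Im z))"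
      by (rule integral_nonneg) (use e in \<open>auto intro: integrable_continuous_interval cf\<close>)
  qed (auto intro: integral_poisson_le[OF e R])
  finally show ?thesis by simp
qed

text \<open>The translate of \<open>sq 1\<close> centred at z lies in \<open>sq R\<close> and
  carries exactly the mass \<open>pmass e\<close>. On the rest the kernel is at most 2 e^2, over an
  area of at most 4 R^2.\<close>

lemma qint_pker_minus_pmass:
  assumes e: "0 < e" and z: "z \<in> sq (R - 1)"
  shows "\<bar>qint R (\<lambda>w. pker e (w - z)) - pmass e\<bar> \<le> 8 * e\<^sup>2 * R\<^sup>2"
proof -
  let ?c = "(Re z, Im z)"
  let ?f = "\<lambda>p::real \<times> real. pker e (Complex (fst p) (snd p) - z)"
  let ?A = "cbox (-R,-R) (R,R) :: (real \<times> real) set"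
  let ?B = "cbox ((-1,-1) - - ?c) ((1,1) - - ?c) :: (real \<times> real) set"
  have cont: "continuous_on S ?f" for S
    using e by (auto intro!: continuous_intros simp: Complex_eq)
  have R: "R \<ge> 1" and sub: "?B \<subseteq> ?A" using z by (auto simp: sq_def cbox_Pair_eq)
  have "(\<lambda>p. pker e (Complex (fst (p + - ?c)) (snd (p + - ?c)))) = ?f"
    by (auto simp: fun_eq_iff complex_eq_iff intro!: arg_cong[where f = "pker e"])
  then have B: "integral ?B ?f = pmass e"
    unfolding pmass_def qint_def
    using integral_shift_cbox[of "(-1,-1)" "- ?c" "(1,1)" "\<lambda>p. pker e (Complex (fst p) (snd p))"]
    by simp
  have hB: "((\<lambda>p. if p \<in> ?B then ?f p else 0) has_integral pmass e) ?A"
    unfolding has_integral_restrict[OF sub] B[symmetric]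
    by (intro integrable_integral integrable_continuous cont)
  have hA: "(?f has_integral qint R (\<lambda>w. pker e (w - z))) ?A"
    unfolding qint_def by (intro integrable_integral integrable_continuous cont)
  have "norm (qint R (\<lambda>w. pker e (w - z)) - pmass e) \<le> 2 * e\<^sup>2 * measure lborel ?A"
  proof (rule has_integral_bound[OF _ has_integral_diff[OF hA hB]])
    fix p assume "p \<in> ?A"
    show "norm (?f p - (if p \<in> ?B then ?f p else 0)) \<le> 2 * e\<^sup>2"
    proof (cases "p \<in> ?B")
      case False
      then have "1 \<le> \<bar>fst p - Re z\<bar> \<or> 1 \<le> \<bar>snd p - Im z\<bar>"
        by (cases p) (auto simp: cbox_Pair_eq abs_le_iff not_le)
      then have "1 \<le> cmod (Complex (fst p) (snd p) - z)"
        using abs_Re_le_cmod[of "Complex (fst p) (snd p) - z"] abs_Im_le_cmod[of "Complex (fst p) (snd p) - z"]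
        by auto
      then have "1 \<le> (cmod (Complex (fst p) (snd p) - z))\<^sup>2" by simp
      then have "1\<^sup>2 \<le> (e\<^sup>2 + (cmod (Complex (fst p) (snd p) - z))\<^sup>2)\<^sup>2"
        using zero_le_power2[of e] by (intro power_mono) linarith+
      then have "2 * e\<^sup>2 / (e\<^sup>2 + (cmod (Complex (fst p) (snd p) - z))\<^sup>2)\<^sup>2 \<le> 2 * e\<^sup>2 / 1"
        by (intro divide_left_mono) auto
      then show ?thesis using False by (simp add: pker_def)
    qed simp
  qed simp
  then show ?thesis using R by (simp add: content_Pair power2_eq_square)
qed

text \<open>Uniform continuity of f handles w near z, smallness of the kernel handles w far away.
  The comparison is with \<open>pmass e\<close> times f because the kernel is not
  normalised.\<close>

lemma pker_approximate_identity:
  assumes f: "continuous_on (sq R) f" and R: "R \<ge> 1" and d: "d > 0"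
  obtains e0 where "0 < e0" "e0 \<le> 1"
    "\<And>e z. 0 < e \<Longrightarrow> e \<le> e0 \<Longrightarrow> z \<in> sq (R - 1) \<Longrightarrow>
      cmod (qint R (\<lambda>w. f w * of_real (pker e (w - z))) - of_real (pmass e) * f z) \<le> d"
proof -
  obtain M where M: "M > 0" "\<And>w. w \<in> sq R \<Longrightarrow> cmod (f w) \<le> M"
    using compact_imp_bounded[OF compact_continuous_image[OF f compact_sq]]
    unfolding bounded_pos by auto
  have "uniformly_continuous_on (sq R) f"
    by (rule compact_uniformly_continuous[OF f compact_sq])
  then obtain \<eta> where \<eta>: "\<eta> > 0" "\<And>w z. w \<in> sq R \<Longrightarrow> z \<in> sq R \<Longrightarrow> cmod (w - z) < \<eta> \<Longrightarrow> cmod (f w - f z) < d / 64"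
    using d unfolding uniformly_continuous_on_def dist_norm by (metis divide_pos_pos zero_less_numeral)
  \<comment> \<open>The far part gets a quartic majorant because |w - z|^4 times the kernel is at
    most 2 e^2 pointwise. The 64 makes the near part contribute d / 2 after
    \<open>qint_pker_le\<close>.\<close>
  have mod: "cmod (f w - f z) \<le> d / 64 + 2 * M / \<eta> ^ 4 * cmod (w - z) ^ 4"
    if "w \<in> sq R" "z \<in> sq R" for w z
  proof (cases "cmod (w - z) < \<eta>")
    case True
    have "0 \<le> 2 * M / \<eta> ^ 4 * cmod (w - z) ^ 4" using M \<eta> by simp
    then show ?thesis using \<eta>(2)[OF that True] by linarith
  next
    case False
    then have "\<eta> ^ 4 \<le> cmod (w - z) ^ 4" using \<eta> by (intro power_mono) auto
    then have "2 * M * \<eta> ^ 4 \<le> 2 * M * cmod (w - z) ^ 4" using M by simp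
    then have "2 * M \<le> 2 * M / \<eta> ^ 4 * cmod (w - z) ^ 4"
      using \<eta>(1) by (simp add: field_simps)
    moreover have "cmod (f w - f z) \<le> 2 * M"
      using norm_triangle_ineq4[of "f w" "f z"] M(2)[OF that(1)] M(2)[OF that(2)] by linarith
    ultimately show ?thesis using d by linarith
  qed
  \<comment> \<open>Collects the coefficients of e^2: from the quartic majorant, and from replacing
    the mass on \<open>sq R\<close> by \<open>pmass e\<close>.\<close>
  define Q where "Q = 2 * M / \<eta> ^ 4 * 2 * 4 * R\<^sup>2 + M * 8 * R\<^sup>2"
  have Q: "Q \<ge> 0" using M \<eta> by (simp add: Q_def)
  show ?thesis
  proof (rule that[of "min 1 (d / (2 * (Q + 1)))"])
    show "0 < min 1 (d / (2 * (Q + 1)))" using d Q by simp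
    fix e z assume e: "0 < e" "e \<le> min 1 (d / (2 * (Q + 1)))" and z: "z \<in> sq (R - 1)"
    have zR: "z \<in> sq R" using z by (auto simp: sq_def)
    let ?P = "\<lambda>w. pker e (w - z)"
    have cP: "continuous_on S ?P" for S by (intro continuous_intros e)
    have 1: "qint R (\<lambda>w. f w * of_real (?P w)) - f z * of_real (qint R ?P) = qint R (\<lambda>w. (f w - f z) * of_real (?P w))"
    proof -
      have "qint R (\<lambda>w. (f w - f z) * of_real (?P w)) = qint R (\<lambda>w. f w * of_real (?P w) - f z * of_real (?P w))"
        by (simp add: algebra_simps)
      also have "\<dots> = qint R (\<lambda>w. f w * of_real (?P w)) - qint R (\<lambda>w. f z * of_real (?P w))"
        by (rule qint_diff; intro continuous_on_mult f continuous_on_const continuous_on_of_real cP)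
      also have "qint R (\<lambda>w. f z * of_real (?P w)) = f z * of_real (qint R ?P)"
        using qint_cmult[of R "f z" "\<lambda>w. of_real (?P w)"] qint_of_real[OF cP[of "sq R"]] by simp
      finally show ?thesis ..
    qed
    have "cmod (qint R (\<lambda>w. (f w - f z) * of_real (?P w))) \<le> qint R (\<lambda>w. d / 64 * ?P w + 2 * M / \<eta> ^ 4 * (2 * e\<^sup>2))"
    proof (rule qint_norm_le)
      show "continuous_on (sq R) (\<lambda>w. (f w - f z) * of_real (?P w))"
        by (intro continuous_on_mult continuous_on_diff f continuous_on_const continuous_on_of_real cP)
      show "continuous_on (sq R) (\<lambda>w. d / 64 * ?P w + 2 * M / \<eta> ^ 4 * (2 * e\<^sup>2))"
        by (intro continuous_on_add continuous_on_mult continuous_on_const cP)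
      fix w assume w: "w \<in> sq R"
      have "cmod ((f w - f z) * of_real (?P w)) = cmod (f w - f z) * ?P w"
        by (simp add: norm_mult)
      also have "\<dots> \<le> (d / 64 + 2 * M / \<eta> ^ 4 * cmod (w - z) ^ 4) * ?P w"
        by (intro mult_right_mono mod w zR) simp
      also have "\<dots> = d / 64 * ?P w + 2 * M / \<eta> ^ 4 * (cmod (w - z) ^ 4 * ?P w)"
        by (simp add: algebra_simps)
      also have "\<dots> \<le> d / 64 * ?P w + 2 * M / \<eta> ^ 4 * (2 * e\<^sup>2)"
      proof -
        have "cmod (w - z) ^ 4 \<le> (e\<^sup>2 + (cmod (w - z))\<^sup>2)\<^sup>2"
        proof -
          have "((cmod (w - z))\<^sup>2)\<^sup>2 \<le> (e\<^sup>2 + (cmod (w - z))\<^sup>2)\<^sup>2" by (intro power_mono) auto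
          then show ?thesis by simp
        qed
        then have "cmod (w - z) ^ 4 * (2 * e\<^sup>2) \<le> (e\<^sup>2 + (cmod (w - z))\<^sup>2)\<^sup>2 * (2 * e\<^sup>2)"
          by (rule mult_right_mono) simp
        then have "cmod (w - z) ^ 4 * ?P w \<le> 2 * e\<^sup>2"
          unfolding pker_def times_divide_eq_right using cker_denom_pos[OF e(1), of "w - z"]
          by (subst pos_divide_le_eq) (auto simp only: mult.commute zero_less_power)
        then show ?thesis using M \<eta> by (intro add_left_mono mult_left_mono) auto
      qed
      finally show "cmod ((f w - f z) * of_real (?P w)) \<le> d / 64 * ?P w + 2 * M / \<eta> ^ 4 * (2 * e\<^sup>2)" .
    qed
    also have "qint R (\<lambda>w. d / 64 * ?P w + 2 * M / \<eta> ^ 4 * (2 * e\<^sup>2)) =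
        d / 64 * qint R ?P + 4 * R\<^sup>2 * (2 * M / \<eta> ^ 4 * (2 * e\<^sup>2))"
    proof -
      have "continuous_on (sq R) (\<lambda>w. d / 64 * ?P w)" by (intro continuous_on_mult continuous_on_const cP)
      from qint_add[OF this continuous_on_const]
      show ?thesis using qint_cmult_real[of R "d / 64" ?P] qint_const[of R] R by simp
    qed
    finally have "cmod (qint R (\<lambda>w. f w * of_real (?P w)) - f z * of_real (qint R ?P)) \<le>
        d / 64 * qint R ?P + 4 * R\<^sup>2 * (2 * M / \<eta> ^ 4 * (2 * e\<^sup>2))"
      unfolding 1 .
    also have "\<dots> \<le> d / 64 * 32 + 4 * R\<^sup>2 * (2 * M / \<eta> ^ 4 * (2 * e\<^sup>2))"
      using qint_pker_le[OF e(1), of R z] R d by (intro add_right_mono mult_left_mono) auto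
    finally have A: "cmod (qint R (\<lambda>w. f w * of_real (?P w)) - f z * of_real (qint R ?P)) \<le>
        d / 2 + 4 * R\<^sup>2 * (2 * M / \<eta> ^ 4 * (2 * e\<^sup>2))" by simp
    have "f z * of_real (qint R ?P) - of_real (pmass e) * f z = f z * of_real (qint R ?P - pmass e)"
      by (simp add: algebra_simps)
    then have "cmod (f z * of_real (qint R ?P) - of_real (pmass e) * f z) = cmod (f z) * \<bar>qint R ?P - pmass e\<bar>"
      by (simp only: norm_mult norm_of_real)
    also have "\<dots> \<le> M * (8 * e\<^sup>2 * R\<^sup>2)"
      by (intro mult_mono M zR qint_pker_minus_pmass e z) (use M in auto)
    finally have B: "cmod (f z * of_real (qint R ?P) - of_real (pmass e) * f z) \<le> M * (8 * e\<^sup>2 * R\<^sup>2)" .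
    have "cmod (qint R (\<lambda>w. f w * of_real (?P w)) - of_real (pmass e) * f z) \<le>
        d / 2 + 4 * R\<^sup>2 * (2 * M / \<eta> ^ 4 * (2 * e\<^sup>2)) + M * (8 * e\<^sup>2 * R\<^sup>2)"
      using norm_triangle_ineq[of "qint R (\<lambda>w. f w * of_real (?P w)) - f z * of_real (qint R ?P)"
          "f z * of_real (qint R ?P) - of_real (pmass e) * f z"] A B by simp
    also have "\<dots> = d / 2 + Q * e\<^sup>2" by (simp add: Q_def algebra_simps)
    also have "Q * e\<^sup>2 \<le> d / 2"
    proof -
      have "Q * e\<^sup>2 \<le> (Q + 1) * e"
        using e Q by (intro mult_mono) (auto simp: power2_eq_square mult_left_le_one_le)
      also have "\<dots> \<le> d / 2" using e Q by (simp add: field_simps)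
      finally show ?thesis .
    qed
    finally show "cmod (qint R (\<lambda>w. f w * of_real (?P w)) - of_real (pmass e) * f z) \<le> d" by simp
  qed simp
qed

text \<open>A polynomial cutoff: it is 1 at the centre and vanishes on the boundary of
  \<open>sq 2\<close>, which is enough since integration by parts stays inside that square.\<close>

lemma has_partials_cutoff:
  "has_partials (\<lambda>z. of_real ((1 - (Re z)\<^sup>2 / 4) * (1 - (Im z)\<^sup>2 / 4)))
     (\<lambda>z. of_real (- (Re z / 2) * (1 - (Im z)\<^sup>2 / 4)))
     (\<lambda>z. of_real ((1 - (Re z)\<^sup>2 / 4) * - (Im z / 2)))"
proof (rule has_partialsI)
  show "((\<lambda>z. of_real ((1 - (Re z)\<^sup>2 / 4) * (1 - (Im z)\<^sup>2 / 4))) has_derivative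
    (\<lambda>h. complex_of_real (Re h) * of_real (- (Re z / 2) * (1 - (Im z)\<^sup>2 / 4)) +
         of_real (Im h) * of_real ((1 - (Re z)\<^sup>2 / 4) * - (Im z / 2)))) (at z)" for z
    unfolding of_real_mult[symmetric] of_real_add[symmetric]
    by (rule has_derivative_of_real) (auto intro!: derivative_eq_intros simp: algebra_simps)
qed (auto intro!: continuous_intros)

text \<open>After translation to z and multiplication by the cutoff, integration by parts represents
  g near z by a potential whose density is bounded by 3 M: one M from g, one from each derivative of
  the cutoff. Division by \<open>pmass e\<close> \<ge> 1/2 turns 3 into 6; the extra 1 pays for
  removing the cutoff at z'.\<close>

lemma dbar_holder:
  assumes g: "has_partials g gx gy" and b: "\<And>w. cmod (g w) \<le> M" "\<And>w. cmod (gx w + \<i> * gy w) \<le> M"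
    and z: "cmod (z - z') \<le> 1"
  shows "cmod (g z - g z') \<le> (6 * pot_const 2 + 1) * M * cmod (z - z') powr (3/4)"
proof -
  define \<kappa> :: "complex \<Rightarrow> real" where "\<kappa> z = (1 - (Re z)\<^sup>2 / 4) * (1 - (Im z)\<^sup>2 / 4)" for z
  define h where "h = z' - z"
  have h: "cmod h \<le> 1" using z by (simp add: h_def norm_minus_commute)
  note G = has_partials_mult[OF has_partials_shift[OF g, of z] has_partials_cutoff, folded \<kappa>_def]
  let ?G = "\<lambda>w. g (w + z) * of_real (\<kappa> w)"
  define D where "D = (\<lambda>w. (g (w + z) * of_real (- (Re w / 2) * (1 - (Im w)\<^sup>2 / 4)) + gx (w + z) * of_real (\<kappa> w)) +
     \<i> * (g (w + z) * of_real ((1 - (Re w)\<^sup>2 / 4) * - (Im w / 2)) + gy (w + z) * of_real (\<kappa> w)))"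
  have M: "M \<ge> 0" using b(1)[of 0] norm_ge_zero order_trans by blast
  have cD: "continuous_on S D" for S
    unfolding D_def by (rule continuous_on_add[OF has_partials_continuous_x[OF G]
          continuous_on_mult[OF continuous_on_const has_partials_continuous_y[OF G]]])
  have D: "cmod (D w) \<le> 3 * M" if w: "w \<in> sq 2" for w
  proof -
    have q: "(Re w)\<^sup>2 \<le> 4" "(Im w)\<^sup>2 \<le> 4"
      using w power2_le_iff_abs_le[of 2 "Re w"] power2_le_iff_abs_le[of 2 "Im w"] by (auto simp: sq_def)
    have x: "\<bar>1 - (Re w)\<^sup>2 / 4\<bar> \<le> 1" "\<bar>1 - (Im w)\<^sup>2 / 4\<bar> \<le> 1" "\<bar>Re w / 2\<bar> \<le> 1" "\<bar>Im w / 2\<bar> \<le> 1"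
      using q w by (auto simp: sq_def abs_le_iff)
    have p: "\<bar>a * b\<bar> \<le> 1" if "\<bar>a\<bar> \<le> 1" "\<bar>b\<bar> \<le> 1" for a b :: real
      using mult_mono[OF that] by (simp add: abs_mult)
    have "D w = (gx (w + z) + \<i> * gy (w + z)) * of_real (\<kappa> w) +
      (g (w + z) * of_real (- (Re w / 2) * (1 - (Im w)\<^sup>2 / 4)) +
       g (w + z) * (\<i> * of_real ((1 - (Re w)\<^sup>2 / 4) * - (Im w / 2))))"
      unfolding D_def by (simp add: algebra_simps)
    also have "cmod \<dots> \<le> M * 1 + (M * 1 + M * 1)"
      unfolding \<kappa>_def
      by (intro norm_triangle_le add_mono; simp only: norm_mult norm_of_real norm_ii mult_1;
          intro mult_mono b M abs_ge_zero p x; use x in simp)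
    finally show ?thesis by simp
  qed
  have ip: "qint 2 (\<lambda>w. D w * cker e (w - p)) = - qint 2 (\<lambda>w. ?G w * of_real (pker e (w - p)))" if "e > 0" for e p
    unfolding D_def
  proof (rule cauchy_pompeiu_regularized[OF G])
    show "?G w = 0" if "\<bar>Re w\<bar> = 2 \<or> \<bar>Im w\<bar> = 2" for w
    proof -
      have "(Re w)\<^sup>2 = 2\<^sup>2 \<or> (Im w)\<^sup>2 = 2\<^sup>2" using that by (metis power2_abs)
      then have "\<kappa> w = 0" by (auto simp: \<kappa>_def)
      then show ?thesis by simp
    qed
  qed (use that in auto)
  \<comment> \<open>The kernel reproduces \<open>?G\<close> only approximately, so an arbitrary d is
    added; an error d / 4 at each of the two points becomes d after division by 1/2.\<close>
  have *: "cmod (?G 0 - ?G h) \<le> 6 * pot_const 2 * M * cmod h powr (3/4)"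
  proof (rule field_le_epsilon)
    fix d :: real assume d: "d > 0"
    have cG: "continuous_on (sq 2) ?G" by (rule has_partials_continuous[OF G])
    have d4: "d / 4 > 0" using d by simp
    obtain e where e: "0 < e" "e \<le> 1"
      and ae0: "\<And>e' p. 0 < e' \<Longrightarrow> e' \<le> e \<Longrightarrow> p \<in> sq (2 - 1) \<Longrightarrow>
        cmod (qint 2 (\<lambda>w. ?G w * of_real (pker e' (w - p))) - of_real (pmass e') * ?G p) \<le> d / 4"
      by (rule pker_approximate_identity[OF cG _ d4]) auto
    have ae: "cmod (qint 2 (\<lambda>w. ?G w * of_real (pker e (w - p))) - of_real (pmass e) * ?G p) \<le> d / 4"
      if "p \<in> sq 1" for p
      by (rule ae0[OF e(1) order_refl]) (use that in simp)
    have in1: "0 \<in> sq 1" "h \<in> sq 1" "0 \<in> sq 2" "h \<in> sq 2"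
      using h abs_Re_le_cmod[of h] abs_Im_le_cmod[of h] by (auto simp: sq_def)
    let ?I = "\<lambda>p. qint 2 (\<lambda>w. ?G w * of_real (pker e (w - p)))"
    have I: "cmod (?I 0 - ?I h) \<le> 3 * M * pot_const 2 * cmod h powr (3/4)"
      using potential_holder[OF e in1(3,4) cD D] unfolding ip[OF e(1)] by (simp add: norm_minus_commute)
    have tri: "cmod x \<le> k + (l + m)" if "x = u - (v - w)" "cmod u \<le> k" "cmod v \<le> l" "cmod w \<le> m"
      for x u v w :: complex and k l m
      using norm_triangle_ineq4[of u "v - w"] norm_triangle_ineq4[of v w] that(2-) unfolding that(1) by linarith
    have "of_real (pmass e) * (?G 0 - ?G h) =
      (?I 0 - ?I h) - ((?I 0 - of_real (pmass e) * ?G 0) - (?I h - of_real (pmass e) * ?G h))"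
      by (simp add: algebra_simps)
    then have "cmod (of_real (pmass e) * (?G 0 - ?G h)) \<le> 3 * M * pot_const 2 * cmod h powr (3/4) + (d / 4 + d / 4)"
      by (rule tri[OF _ I ae[OF in1(1)] ae[OF in1(2)]])
    moreover have "1 / 2 * cmod (?G 0 - ?G h) \<le> \<bar>pmass e\<bar> * cmod (?G 0 - ?G h)"
      using pmass_ge[OF e] by (intro mult_right_mono) auto
    ultimately show "cmod (?G 0 - ?G h) \<le> 6 * pot_const 2 * M * cmod h powr (3/4) + d"
      by (simp only: norm_mult norm_of_real) (simp add: algebra_simps)
  qed
  \<comment> \<open>The cutoff equals 1 up to second order at 0, and |h|^2 is at most |h|^(3/4)
    because |h| \<le> 1.\<close>
  have x1: "\<bar>1 - \<kappa> h\<bar> \<le> cmod h powr (3/4)"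
  proof -
    have r: "(Re h)\<^sup>2 + (Im h)\<^sup>2 = (cmod h)\<^sup>2" by (simp add: cmod_power2)
    have c1: "(cmod h)\<^sup>2 \<le> 1" using h by (simp add: power_le_one)
    have e: "1 - \<kappa> h = ((Re h)\<^sup>2 + (Im h)\<^sup>2) / 4 - (Re h)\<^sup>2 * (Im h)\<^sup>2 / 16"
      by (simp add: \<kappa>_def field_simps)
    have gen: "\<bar>(X + Y) / 4 - P / 16\<bar> \<le> X + Y" if "0 \<le> X" "0 \<le> Y" "0 \<le> P" "P \<le> Y" for X Y P :: real
      by (rule abs_leI) (use that in \<open>simp_all add: field_simps\<close>)
    have "(Re h)\<^sup>2 * (Im h)\<^sup>2 \<le> 1 * (Im h)\<^sup>2"
      by (rule mult_right_mono) (use c1 r zero_le_power2[of "Im h"] in linarith, simp)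
    then have "\<bar>1 - \<kappa> h\<bar> \<le> (cmod h)\<^sup>2"
      unfolding e r[symmetric] using gen[of "(Re h)\<^sup>2" "(Im h)\<^sup>2" "(Re h)\<^sup>2 * (Im h)\<^sup>2"] by simp
    also have "(cmod h)\<^sup>2 \<le> cmod h powr (3/4)"
    proof (cases "h = 0")
      case False
      then have "(cmod h)\<^sup>2 = cmod h powr 2" by (simp add: powr_numeral)
      also have "\<dots> \<le> cmod h powr (3/4)" using h by (intro powr_mono') auto
      finally show ?thesis .
    qed simp
    finally show ?thesis .
  qed
  have "g z - g z' = (?G 0 - ?G h) - g z' * of_real (1 - \<kappa> h)"
    by (simp add: \<kappa>_def h_def algebra_simps)
  then have "cmod (g z - g z') \<le> cmod (?G 0 - ?G h) + cmod (g z' * of_real (1 - \<kappa> h))"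
    by (simp only: norm_triangle_ineq4)
  also have "\<dots> \<le> 6 * pot_const 2 * M * cmod h powr (3/4) + M * cmod h powr (3/4)"
    unfolding norm_mult norm_of_real by (intro add_mono * mult_mono b x1 M) auto
  finally show ?thesis by (simp add: h_def norm_minus_commute algebra_simps)
qed

section \<open>Approximate solutions of the inhomogeneous Cauchy-Riemann equation\<close>

text \<open>Differentiation under the integral sign, legitimate because the smoothed kernel is
  continuously differentiable everywhere. The minus signs come from differentiating in z instead of
  w.\<close>

lemma has_partials_potential:
  assumes a: "continuous_on (sq R) a" and e: "e > 0"
  shows "has_partials (\<lambda>z. qint R (\<lambda>w. a w * cker e (w - z)))
     (\<lambda>z. - qint R (\<lambda>w. a w * cker_x e (w - z))) (\<lambda>z. - qint R (\<lambda>w. a w * cker_y e (w - z)))"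
proof (rule has_partialsI)
  note k = has_partials_cker[OF e]
  let ?c = "\<lambda>p::real \<times> real. Complex (fst p) (snd p)"
  let ?B = "cbox (-R,-R) (R,R) :: (real \<times> real) set"
  have cc: "continuous_on S ?c" for S by (auto intro!: continuous_intros simp: Complex_eq)
  have ca: "continuous_on (UNIV \<times> ?B) (\<lambda>q. a (?c (snd q)))"
    by (rule continuous_on_compose2[OF a])
      (auto simp: sq_def cbox_Pair_eq intro!: continuous_on_compose2[OF cc[of UNIV]] continuous_intros)
  have cd: "continuous_on (UNIV \<times> ?B) (\<lambda>q. f (?c (snd q) - fst q))" if "continuous_on UNIV f"
    for f :: "complex \<Rightarrow> complex"
    by (rule continuous_on_compose2[OF that])
      (auto intro!: continuous_on_compose2[OF cc[of UNIV]] continuous_intros)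
  have cx: "continuous_on (UNIV \<times> ?B) (\<lambda>q. a (?c (snd q)) * cker_x e (?c (snd q) - fst q))"
    and cy: "continuous_on (UNIV \<times> ?B) (\<lambda>q. a (?c (snd q)) * cker_y e (?c (snd q) - fst q))"
    by (intro continuous_on_mult ca cd has_partials_continuous_x[OF k] has_partials_continuous_y[OF k])+
  show "continuous_on UNIV (\<lambda>z. - qint R (\<lambda>w. a w * cker_x e (w - z)))"
    "continuous_on UNIV (\<lambda>z. - qint R (\<lambda>w. a w * cker_y e (w - z)))"
    unfolding qint_def
    by (intro continuous_on_minus integral_continuous_on_param; use cx cy in \<open>simp add: case_prod_beta\<close>)+
  fix z
  \<comment> \<open>The Leibniz rule wants the total derivative as a bounded linear map; it is
    assembled from these two coordinate functionals.\<close>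
  define B1 :: "complex \<Rightarrow>\<^sub>L complex" where "B1 = Blinfun (\<lambda>h. of_real (Re h))"
  define B2 :: "complex \<Rightarrow>\<^sub>L complex" where "B2 = Blinfun (\<lambda>h. of_real (Im h))"
  have B1: "blinfun_apply B1 h = of_real (Re h)" and B2: "blinfun_apply B2 h = of_real (Im h)" for h
    unfolding B1_def B2_def
    by (subst bounded_linear_Blinfun_apply; simp add: bounded_linear_of_real bounded_linear_Re bounded_linear_Im
        bounded_linear_compose[OF bounded_linear_of_real])+
  define fx where "fx z p = - ((blinfun_mult_right (a (?c p) * cker_x e (?c p - z)) o\<^sub>L B1)
      + (blinfun_mult_right (a (?c p) * cker_y e (?c p - z)) o\<^sub>L B2))" for z p
  have fx_apply: "blinfun_apply (fx z p) h =
      - (of_real (Re h) * (a (?c p) * cker_x e (?c p - z)) + of_real (Im h) * (a (?c p) * cker_y e (?c p - z)))" for z p h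
    by (simp add: fx_def blinfun.bilinear_simps B1 B2 mult.commute)
  have cfx: "continuous_on (UNIV \<times> ?B) (\<lambda>(z, p). fx z p)"
    unfolding fx_def case_prod_beta
    by (intro continuous_on_minus continuous_on_add bounded_bilinear.continuous_on[OF bounded_bilinear_blinfun_compose]
        bounded_linear.continuous_on[OF bounded_linear_blinfun_mult_right] cx cy continuous_on_const)
  have "((\<lambda>z. qint R (\<lambda>w. a w * cker e (w - z))) has_derivative integral ?B (fx z)) (at z within UNIV)"
    unfolding qint_def
  proof (rule leibniz_rule[OF _ _ cfx])
    fix z' p assume p: "p \<in> ?B"
    have "((\<lambda>z. ?c p - z) has_derivative (\<lambda>h. - h)) (at z')"
      by (auto intro!: derivative_eq_intros)
    from has_derivative_compose[OF this has_partials_derivative[OF k]]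
    have "((\<lambda>z. a (?c p) * cker e (?c p - z)) has_derivative
        (\<lambda>h. a (?c p) * (of_real (Re (- h)) * cker_x e (?c p - z') + of_real (Im (- h)) * cker_y e (?c p - z')))) (at z')"
      by (rule has_derivative_mult_right)
    then show "((\<lambda>z. a (?c p) * cker e (?c p - z)) has_derivative blinfun_apply (fx z' p)) (at z' within UNIV)"
      by (rule has_derivative_eq_rhs) (simp add: fun_eq_iff fx_apply algebra_simps)
  next
    show "(\<lambda>p. a (?c p) * cker e (?c p - z')) integrable_on ?B" for z'
      by (rule qint_integrable) (intro continuous_on_mult a continuous_intros e)
  qed auto
  then show "((\<lambda>z. qint R (\<lambda>w. a w * cker e (w - z))) has_derivative
     (\<lambda>h. of_real (Re h) * - qint R (\<lambda>w. a w * cker_x e (w - z)) +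
          of_real (Im h) * - qint R (\<lambda>w. a w * cker_y e (w - z)))) (at z)"
  proof (rule has_derivative_eq_rhs)
    show "blinfun_apply (integral ?B (fx z)) = (\<lambda>h. of_real (Re h) * - qint R (\<lambda>w. a w * cker_x e (w - z)) +
          of_real (Im h) * - qint R (\<lambda>w. a w * cker_y e (w - z)))"
    proof
      fix h
      have cf: "continuous_on (sq R) (\<lambda>w. a w * f (w - z))" if "continuous_on UNIV f" for f
        by (intro continuous_on_mult a continuous_on_compose2[OF that] continuous_intros) auto
      have ci: "continuous_on ?B (\<lambda>p. (\<lambda>(z, p). fx z p) (z, p))"
        by (rule continuous_on_compose2[OF cfx]) (auto intro!: continuous_intros)
      have i: "fx z integrable_on ?B"
        by (rule integrable_continuous) (use ci in simp)
      have "blinfun_apply (integral ?B (fx z)) h = integral ?B (\<lambda>p. blinfun_apply (fx z p) h)"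
        by (rule blinfun_apply_integral[OF i])
      also have "\<dots> = qint R (\<lambda>w. (- of_real (Re h)) * (a w * cker_x e (w - z)) + (- of_real (Im h)) * (a w * cker_y e (w - z)))"
        by (simp add: qint_def fx_apply)
      also have "\<dots> = qint R (\<lambda>w. (- of_real (Re h)) * (a w * cker_x e (w - z))) + qint R (\<lambda>w. (- of_real (Im h)) * (a w * cker_y e (w - z)))"
        by (rule qint_add; intro continuous_on_mult[OF continuous_on_const] cf
            has_partials_continuous_x[OF k] has_partials_continuous_y[OF k])
      finally show "blinfun_apply (integral ?B (fx z)) h = of_real (Re h) * - qint R (\<lambda>w. a w * cker_x e (w - z)) +
          of_real (Im h) * - qint R (\<lambda>w. a w * cker_y e (w - z))"
        using qint_cmult[of R "- of_real (Re h)" "\<lambda>w. a w * cker_x e (w - z)"]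
          qint_cmult[of R "- of_real (Im h)" "\<lambda>w. a w * cker_y e (w - z)"] by simp
    qed
  qed
qed

text \<open>The potential of a, divided by minus the kernel mass, solves the equation up to the
  error of the approximate identity. The Hoelder constant depends on the bound of a and on R but not
  on d, and the normalisation at 0 turns it into a uniform bound: the input for Arzela-Ascoli. The
  factor 2 bounds 1 / \<open>pmass e\<close>.\<close>

lemma approximate_dbar_solution:
  assumes a: "continuous_on (sq R) a" "\<And>w. w \<in> sq R \<Longrightarrow> cmod (a w) \<le> L" and R: "R \<ge> 1" and d: "d > 0"
  obtains \<phi> \<phi>x \<phi>y where "has_partials \<phi> \<phi>x \<phi>y" "\<phi> 0 = 0"
    "\<And>z z'. z \<in> sq R \<Longrightarrow> z' \<in> sq R \<Longrightarrow> cmod (\<phi> z - \<phi> z') \<le> 2 * L * pot_const R * cmod (z - z') powr (3/4)"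
    "\<And>z. z \<in> sq (R - 1) \<Longrightarrow> cmod (\<phi>x z + \<i> * \<phi>y z - a z) \<le> d"
proof -
  have d2: "d / 2 > 0" using d by simp
  obtain e where e: "0 < e" "e \<le> 1" and ae0: "\<And>e' z. 0 < e' \<Longrightarrow> e' \<le> e \<Longrightarrow> z \<in> sq (R - 1) \<Longrightarrow>
      cmod (qint R (\<lambda>w. a w * of_real (pker e' (w - z))) - of_real (pmass e') * a z) \<le> d / 2"
    by (rule pker_approximate_identity[OF a(1) R d2]) auto
  note ae = ae0[OF e(1) order_refl]
  define c :: complex where "c = - (1 / of_real (pmass e))"
  have pm: "1/2 \<le> pmass e" by (rule pmass_ge[OF e])
  have c: "cmod c \<le> 2" using pm by (simp add: c_def norm_divide divide_simps)
  note k = has_partials_cker[OF e(1)]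
  let ?p = "\<lambda>z. qint R (\<lambda>w. a w * cker e (w - z))"
  let ?px = "\<lambda>z. - qint R (\<lambda>w. a w * cker_x e (w - z))"
  let ?py = "\<lambda>z. - qint R (\<lambda>w. a w * cker_y e (w - z))"
  have L: "L \<ge> 0" using order_trans[OF norm_ge_zero a(2), of 0] R by (simp add: sq_def)
  show ?thesis
  proof (rule that[of "\<lambda>z. c * ?p z - c * ?p 0" "\<lambda>z. c * ?px z" "\<lambda>z. c * ?py z"])
    show "has_partials (\<lambda>z. c * ?p z - c * ?p 0) (\<lambda>z. c * ?px z) (\<lambda>z. c * ?py z)"
      using has_partials_diff[OF has_partials_mult[OF has_partials_const has_partials_potential[OF a(1) e(1)]] has_partials_const]
      by simp
    fix z z' assume z: "z \<in> sq R" "z' \<in> sq R"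
    have "cmod (c * ?p z - c * ?p 0 - (c * ?p z' - c * ?p 0)) = cmod c * cmod (?p z - ?p z')"
      unfolding norm_mult[symmetric] by (simp add: algebra_simps)
    also have "\<dots> \<le> 2 * (L * pot_const R * cmod (z - z') powr (3/4))"
      by (intro mult_mono c potential_holder e z a) auto
    finally show "cmod (c * ?p z - c * ?p 0 - (c * ?p z' - c * ?p 0)) \<le> 2 * L * pot_const R * cmod (z - z') powr (3/4)"
      by simp
  next
    fix z assume z: "z \<in> sq (R - 1)"
    have cf: "continuous_on (sq R) (\<lambda>w. a w * f (w - z))" if "continuous_on UNIV f" for f
      by (intro continuous_on_mult a continuous_on_compose2[OF that] continuous_intros) auto
    let ?P = "qint R (\<lambda>w. a w * of_real (pker e (w - z)))"
    have "?P = qint R (\<lambda>w. a w * cker_x e (w - z) + \<i> * (a w * cker_y e (w - z)))"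
      by (rule qint_cong) (simp add: cker_dbar[OF e(1), symmetric] algebra_simps)
    also have "\<dots> = qint R (\<lambda>w. a w * cker_x e (w - z)) + qint R (\<lambda>w. \<i> * (a w * cker_y e (w - z)))"
      by (rule qint_add; intro continuous_on_mult[OF continuous_on_const] cf
            has_partials_continuous_x[OF k] has_partials_continuous_y[OF k])
    finally have P: "?P = - ?px z + \<i> * - ?py z"
      using qint_cmult[of R \<i> "\<lambda>w. a w * cker_y e (w - z)"] by simp
    have "c * ?px z + \<i> * (c * ?py z) - a z = - c * (?P - of_real (pmass e) * a z)"
      unfolding P using pm by (auto simp: c_def field_simps)
    then have "cmod (c * ?px z + \<i> * (c * ?py z) - a z) = cmod c * cmod (?P - of_real (pmass e) * a z)"
      by (simp only: norm_mult norm_minus_cancel)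
    also have "\<dots> \<le> 2 * (d / 2)"
      by (intro mult_mono c ae z) auto
    finally show "cmod (c * ?px z + \<i> * (c * ?py z) - a z) \<le> d" by simp
  qed simp
qed

text \<open>Green's theorem: the two ways along the boundary from the lower left corner to (x, y)
  differ by i times the integral of the Cauchy-Riemann operator, over an area of at most 4
  r^2.\<close>

lemma rectangle_dbar:
  assumes h: "has_partials h hx hy" and b: "\<And>z. z \<in> sq r \<Longrightarrow> cmod (hx z + \<i> * hy z) \<le> d"
    and x: "-r \<le> x" "x \<le> r" and y: "-r \<le> y" "y \<le> r"
  shows "cmod ((integral {-r..x} (\<lambda>t. h (Complex t (-r))) + \<i> * integral {-r..y} (\<lambda>t. h (Complex x t)))
     - (integral {-r..x} (\<lambda>t. h (Complex t y)) + \<i> * integral {-r..y} (\<lambda>t. h (Complex (-r) t)))) \<le> d * (4 * r\<^sup>2)"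
proof -
  let ?c = "\<lambda>p::real \<times> real. Complex (fst p) (snd p)"
  let ?B = "cbox (-r,-r) (x,y) :: (real \<times> real) set"
  have ch: "continuous_on S (\<lambda>t. h (Complex t b))" "continuous_on S (\<lambda>t. h (Complex b t))" for b S
    by (auto intro!: continuous_on_compose2[OF has_partials_continuous[OF h, of UNIV]] continuous_intros simp: Complex_eq)
  have cx: "continuous_on S (\<lambda>p. hx (?c p))" and cy: "continuous_on S (\<lambda>p. hy (?c p))" for S
    by (auto intro!: continuous_on_compose2[OF has_partials_continuous_x[OF h, of UNIV]]
        continuous_on_compose2[OF has_partials_continuous_y[OF h, of UNIV]] continuous_intros simp: Complex_eq)
  have "integral ?B (\<lambda>p. hy (?c p)) = integral {-r..x} (\<lambda>s. integral {-r..y} (\<lambda>t. hy (Complex s t)))"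
    using integral_prod_continuous[OF cy] by simp
  also have "\<dots> = integral {-r..x} (\<lambda>s. h (Complex s y) - h (Complex s (-r)))"
    by (intro integral_cong integral_unique fundamental_theorem_of_calculus has_partials_vector_derivative_y[OF h] y)
  also have "\<dots> = integral {-r..x} (\<lambda>s. h (Complex s y)) - integral {-r..x} (\<lambda>s. h (Complex s (-r)))"
    by (intro integral_diff integrable_continuous_interval ch)
  finally have Y: "integral ?B (\<lambda>p. hy (?c p)) = \<dots>" .
  have "integral ?B (\<lambda>p. hx (?c p)) = integral {-r..y} (\<lambda>t. integral {-r..x} (\<lambda>s. hx (Complex s t)))"
    using integral_prod_continuous[OF cx] integral_swap_continuous[of "-r" "-r" x y "\<lambda>x y. hx (Complex x y)"] cx
    by (simp add: case_prod_beta')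
  also have "\<dots> = integral {-r..y} (\<lambda>t. h (Complex x t) - h (Complex (-r) t))"
    by (intro integral_cong integral_unique fundamental_theorem_of_calculus has_partials_vector_derivative_x[OF h] x)
  also have "\<dots> = integral {-r..y} (\<lambda>t. h (Complex x t)) - integral {-r..y} (\<lambda>t. h (Complex (-r) t))"
    by (intro integral_diff integrable_continuous_interval ch)
  finally have X: "integral ?B (\<lambda>p. hx (?c p)) = \<dots>" .
  have "integral ?B (\<lambda>p. hx (?c p) + \<i> * hy (?c p)) = integral ?B (\<lambda>p. hx (?c p)) + integral ?B (\<lambda>p. \<i> * hy (?c p))"
    by (intro integral_add integrable_continuous continuous_on_mult continuous_on_const cx cy)
  then have XY: "\<i> * integral ?B (\<lambda>p. hx (?c p) + \<i> * hy (?c p)) =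
     \<i> * integral ?B (\<lambda>p. hx (?c p)) - integral ?B (\<lambda>p. hy (?c p))"
    by (simp add: algebra_simps)
  have d: "d \<ge> 0" using order_trans[OF norm_ge_zero b, of "Complex x y"] x y by (simp add: sq_def abs_le_iff)
  have i: "(\<lambda>p. hx (?c p) + \<i> * hy (?c p)) integrable_on ?B"
    by (intro integrable_continuous continuous_on_add continuous_on_mult continuous_on_const cx cy)
  have "norm (integral ?B (\<lambda>p. hx (?c p) + \<i> * hy (?c p))) \<le> d * measure lborel ?B"
  proof (rule has_integral_bound[OF d integrable_integral[OF i]])
    fix p assume "p \<in> ?B"
    then have "?c p \<in> sq r" using x y by (cases p) (auto simp: sq_def cbox_Pair_eq abs_le_iff)
    then show "norm (hx (?c p) + \<i> * hy (?c p)) \<le> d" by (rule b)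
  qed
  also have "\<dots> \<le> d * (4 * r\<^sup>2)"
  proof -
    have "(x - - r) * (y - - r) \<le> (2 * r) * (2 * r)" using x y by (intro mult_mono) auto
    then show ?thesis using x y d by (intro mult_left_mono) (auto simp: content_Pair power2_eq_square)
  qed
  finally have "cmod (\<i> * integral ?B (\<lambda>p. hx (?c p) + \<i> * hy (?c p))) \<le> d * (4 * r\<^sup>2)"
    by (simp add: norm_mult)
  then show ?thesis unfolding XY X Y by (simp add: algebra_simps)
qed

section \<open>Similarity principle\<close>

text \<open>Morera's argument. In the limit the two corner paths \<open>A\<close> and
  \<open>B\<close> give the same integral. From \<open>B\<close> its x-derivative is g, from
  \<open>A\<close> its y-derivative is i g, so it is a complex primitive of g, and derivatives of
  holomorphic functions are holomorphic.\<close>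

lemma holomorphic_dbar_limit:
  assumes hp: "\<And>n. has_partials (h n) (hx n) (hy n)"
    and ul: "uniform_limit (sq r) h g sequentially"
    and db: "\<And>e. e > 0 \<Longrightarrow> \<forall>\<^sub>F n in sequentially. \<forall>z\<in>sq r. cmod (hx n z + \<i> * hy n z) \<le> e"
    and r: "r > 0"
  shows "g holomorphic_on {z. \<bar>Re z\<bar> < r \<and> \<bar>Im z\<bar> < r}"
proof -
  have cg: "continuous_on (sq r) g"
    by (rule uniform_limit_theorem[OF always_eventually ul]) (use hp in \<open>auto intro: has_partials_continuous\<close>)
  define A where "A k x y = integral {-r..x} (\<lambda>t. k (Complex t (-r))) + \<i> * integral {-r..y} (\<lambda>t. k (Complex x t))"
    for k :: "complex \<Rightarrow> complex" and x y
  define B where "B k x y = integral {-r..x} (\<lambda>t. k (Complex t y)) + \<i> * integral {-r..y} (\<lambda>t. k (Complex (-r) t))"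
    for k :: "complex \<Rightarrow> complex" and x y
  have cont1: "continuous_on S (\<lambda>t. k (Complex t b))" if "continuous_on (sq r) k" "S \<subseteq> {-r..r}" "b \<in> {-r..r}"
    for k :: "complex \<Rightarrow> complex" and S b
    by (rule continuous_on_compose2[OF that(1)]) (use that in \<open>auto intro!: continuous_intros simp: Complex_eq sq_def abs_le_iff subset_iff\<close>)
  have cont2: "continuous_on S (\<lambda>t. k (Complex b t))" if "continuous_on (sq r) k" "S \<subseteq> {-r..r}" "b \<in> {-r..r}"
    for k :: "complex \<Rightarrow> complex" and S b
    by (rule continuous_on_compose2[OF that(1)]) (use that in \<open>auto intro!: continuous_intros simp: Complex_eq sq_def abs_le_iff subset_iff\<close>)
  have close: "cmod (integral {-r..x} u - integral {-r..x} v) \<le> d * (2 * r)"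
    if "x \<in> {-r..r}" "continuous_on {-r..x} u" "continuous_on {-r..x} v" "d \<ge> 0"
      "\<And>t. t \<in> {-r..x} \<Longrightarrow> cmod (u t - v t) \<le> d" for u v :: "real \<Rightarrow> complex" and x d
  proof -
    have "integral {-r..x} u - integral {-r..x} v = integral {-r..x} (\<lambda>t. u t - v t)"
      by (intro integral_diff[symmetric] integrable_continuous_interval that)
    also have "cmod (integral {-r..x} (\<lambda>t. u t - v t)) \<le> d * (x - - r)"
      using that(1) by (intro integral_bound continuous_on_diff that) auto
    also have "\<dots> \<le> d * (2 * r)" using that by (intro mult_left_mono) auto
    finally show ?thesis .
  qed
  have AB: "A g x y = B g x y" if x: "x \<in> {-r..r}" and y: "y \<in> {-r..r}" for x y
  proof -
    have "cmod (A g x y - B g x y) \<le> 0"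
    proof (rule field_le_epsilon)
      fix e :: real assume e: "e > 0"
      \<comment> \<open>The 8 r stands for four sides of length at most 2 r on which h replaces g,
        the 4 r^2 for the area term of \<open>rectangle_dbar\<close>.\<close>
      define d where "d = e / (8 * r + 4 * r\<^sup>2)"
      have d: "d > 0" using e r by (simp add: d_def add_pos_pos)
      have "\<forall>\<^sub>F n in sequentially. (\<forall>z\<in>sq r. dist (h n z) (g z) < d) \<and> (\<forall>z\<in>sq r. cmod (hx n z + \<i> * hy n z) \<le> d)"
        using uniform_limitD[OF ul d] db[OF d] by (rule eventually_conj)
      then obtain n where n: "\<And>z. z \<in> sq r \<Longrightarrow> cmod (h n z - g z) \<le> d"
        "\<And>z. z \<in> sq r \<Longrightarrow> cmod (hx n z + \<i> * hy n z) \<le> d"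
        unfolding eventually_sequentially dist_norm by (meson less_imp_le order_refl)
      have n': "cmod (g z - h n z) \<le> d" if "z \<in> sq r" for z
        using n(1)[OF that] by (simp add: norm_minus_commute)
      have ch: "continuous_on (sq r) (h n)" by (rule has_partials_continuous[OF hp])
      have 1: "cmod (A (h n) x y - B (h n) x y) \<le> d * (4 * r\<^sup>2)"
        unfolding A_def B_def using rectangle_dbar[OF hp n(2)] x y by auto
      have 2: "cmod (integral {-r..x} (\<lambda>t. g (Complex t b)) - integral {-r..x} (\<lambda>t. h n (Complex t b))) \<le> d * (2 * r)"
        if "b \<in> {-r..r}" "x \<in> {-r..r}" for b x
        using that d by (intro close cont1 cg ch n') (auto simp: sq_def)
      have 3: "cmod (integral {-r..x} (\<lambda>t. g (Complex b t)) - integral {-r..x} (\<lambda>t. h n (Complex b t))) \<le> d * (2 * r)"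
        if "b \<in> {-r..r}" "x \<in> {-r..r}" for b x
        using that d by (intro close cont2 cg ch n') (auto simp: sq_def)
      have tri: "cmod ((a1 + \<i> * a2) - (b1 + \<i> * b2)) \<le> 8 * r * d + M"
        if "cmod (a1 - c1) \<le> d * (2 * r)" "cmod (a2 - c2) \<le> d * (2 * r)"
          "cmod (b1 - e1) \<le> d * (2 * r)" "cmod (b2 - e2) \<le> d * (2 * r)"
          "cmod ((c1 + \<i> * c2) - (e1 + \<i> * e2)) \<le> M" for a1 a2 b1 b2 c1 c2 e1 e2 M
      proof -
        have "(a1 + \<i> * a2) - (b1 + \<i> * b2) = ((a1 - c1) + \<i> * (a2 - c2)) - ((b1 - e1) + \<i> * (b2 - e2)) + ((c1 + \<i> * c2) - (e1 + \<i> * e2))"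
          by (simp add: algebra_simps)
        also have "cmod \<dots> \<le> ((d * (2 * r) + d * (2 * r)) + (d * (2 * r) + d * (2 * r))) + M"
          by (intro norm_triangle_mono norm_triangle_le_diff[OF add_mono] that order_trans[OF norm_triangle_ineq add_mono]; simp add: norm_mult that)
        finally show ?thesis by (simp add: mult_ac)
      qed
      have "cmod (A g x y - B g x y) \<le> 8 * r * d + d * (4 * r\<^sup>2)"
        unfolding A_def B_def
        by (rule tri[OF 2 3 2 3 1[unfolded A_def B_def]]) (use x y r in auto)
      also have "\<dots> = e"
      proof -
        have "8 * r + 4 * r\<^sup>2 \<noteq> 0" using r by (simp add: add_pos_pos less_imp_neq[THEN not_sym])
        moreover have "8 * r * d + d * (4 * r\<^sup>2) = d * (8 * r + 4 * r\<^sup>2)" by (simp add: algebra_simps)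
        ultimately show ?thesis by (simp add: d_def)
      qed
      finally show "cmod (A g x y - B g x y) \<le> 0 + e" by simp
    qed
    then show ?thesis by simp
  qed
  let ?X = "{-r<..<r}"
  define S where "S = {z. \<bar>Re z\<bar> < r \<and> \<bar>Im z\<bar> < r}"
  have S: "open S"
    unfolding S_def by (intro open_Collect_conj open_Collect_less continuous_intros)
  have der: "((\<lambda>z. B g (Re z) (Im z)) has_field_derivative g z) (at z)" if z: "z \<in> S" for z
  proof -
    define x y where "x = Re z" and "y = Im z"
    have xy: "x \<in> ?X" "y \<in> ?X" using z by (auto simp: S_def x_def y_def)
    have ii: "((\<lambda>u. integral {-r..u} k) has_vector_derivative k x) (at x within ?X)"
      if "continuous_on {-r..r} k" "x \<in> ?X" for k :: "real \<Rightarrow> complex" and x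
      by (rule has_vector_derivative_within_subset[OF integral_has_vector_derivative[OF that(1)]]) (use that in auto)
    have "((\<lambda>(x, y). B g x y) has_derivative (\<lambda>(tx, ty). tx *\<^sub>R g (Complex x y) + blinfun_apply (blinfun_scaleR_left (\<i> * g (Complex x y))) ty))
        (at (x, y) within ?X \<times> ?X)"
    proof (rule has_derivative_partialsI)
      have "((\<lambda>x. integral {-r..x} (\<lambda>t. g (Complex t y))) has_vector_derivative g (Complex x y)) (at x within ?X)"
        by (rule ii[OF cont1[OF cg]]) (use xy in auto)
      then have "((\<lambda>x. B g x y) has_vector_derivative g (Complex x y)) (at x within ?X)"
        unfolding B_def by (auto intro!: derivative_eq_intros)
      then show "((\<lambda>x. B g x y) has_derivative (\<lambda>tx. tx *\<^sub>R g (Complex x y))) (at x within ?X)"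
        by (simp add: has_vector_derivative_def)
      show "((\<lambda>y. B g a y) has_derivative blinfun_apply (blinfun_scaleR_left (\<i> * g (Complex a b)))) (at b within ?X)"
        if ab: "a \<in> ?X" "b \<in> ?X" for a b
      proof -
        have "((\<lambda>y. integral {-r..y} (\<lambda>t. g (Complex a t))) has_vector_derivative g (Complex a b)) (at b within ?X)"
          by (rule ii[OF cont2[OF cg]]) (use ab in auto)
        then have "((\<lambda>y. A g a y) has_vector_derivative \<i> * g (Complex a b)) (at b within ?X)"
          unfolding A_def by (auto intro!: derivative_eq_intros)
        then have "((\<lambda>y. A g a y) has_derivative blinfun_apply (blinfun_scaleR_left (\<i> * g (Complex a b)))) (at b within ?X)"
          by (simp add: has_vector_derivative_def)
        then show ?thesis
          by (rule has_derivative_transform[rotated 2]) (use ab AB in auto)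
      qed
      have "continuous_on (?X \<times> ?X) (\<lambda>p. blinfun_scaleR_left (\<i> * g (Complex (fst p) (snd p))) :: real \<Rightarrow>\<^sub>L complex)"
        by (intro continuous_intros continuous_on_compose2[OF cg])
          (auto simp: sq_def Complex_eq intro!: continuous_intros)
      then show "continuous (at (x, y) within ?X \<times> ?X) (\<lambda>(x, y). blinfun_scaleR_left (\<i> * g (Complex x y)))"
        unfolding case_prod_beta' continuous_on_eq_continuous_within by (rule bspec) (use xy in simp)
    qed (use xy in auto)
    moreover have "at (x, y) within ?X \<times> ?X = at (x, y)"
      by (rule at_within_open) (use xy in \<open>auto intro: open_Times\<close>)
    ultimately have d: "((\<lambda>(x, y). B g x y) has_derivative (\<lambda>(tx, ty). tx *\<^sub>R g (Complex x y) + ty *\<^sub>R (\<i> * g (Complex x y)))) (at (Re z, Im z))"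
      by (simp add: x_def y_def)
    have "((\<lambda>z. (Re z, Im z)) has_derivative (\<lambda>h. (Re h, Im h))) (at z)"
      by (auto intro!: derivative_eq_intros)
    from has_derivative_compose[OF this d]
    have "((\<lambda>z. B g (Re z) (Im z)) has_derivative (\<lambda>h. Re h *\<^sub>R g z + Im h *\<^sub>R (\<i> * g z))) (at z)"
      by (simp add: x_def y_def)
    moreover have "(\<lambda>h. Re h *\<^sub>R g z + Im h *\<^sub>R (\<i> * g z)) = (*) (g z)"
      by (auto simp: fun_eq_iff complex_eq_iff)
    ultimately show ?thesis by (simp add: has_field_derivative_def)
  qed
  have "(\<lambda>z. B g (Re z) (Im z)) holomorphic_on S"
    using der S by (auto simp: holomorphic_on_open)
  then have "deriv (\<lambda>z. B g (Re z) (Im z)) holomorphic_on S"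
    using S by (rule holomorphic_deriv)
  then have "g holomorphic_on S"
    by (rule holomorphic_transform) (auto intro: DERIV_imp_deriv der)
  then show ?thesis by (simp add: S_def)
qed

text \<open>The modulus inverts x^(3/4); H + 1 replaces H so that H = 0 is no exception.\<close>

lemma holder_modulus:
  assumes "0 \<le> H" "0 < e" "0 \<le> x" "x < (e / (H + 1)) powr (4/3)"
  shows "H * x powr (3/4) < (e :: real)"
proof -
  have "x powr (3/4) < ((e / (H + 1)) powr (4/3)) powr (3/4)"
    using assms by (intro powr_less_mono2) auto
  also have "\<dots> = e / (H + 1)" using assms by (simp add: powr_powr)
  finally have "(H + 1) * x powr (3/4) < e" using assms by (simp add: field_simps)
  moreover have "H * x powr (3/4) \<le> (H + 1) * x powr (3/4)"
    by (intro mult_right_mono) auto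
  ultimately show ?thesis by linarith
qed

text \<open>The Bers-Vekua similarity principle. Formally \<phi>_x + i \<phi>_y = (D_x + i D_y) / D
  and h = exp (- \<phi>) D. The quotient 1 / D is replaced by cnj D / (|D|^2 + \<epsilon>^2), giving
  continuous densities \<open>a n\<close> all bounded by |L|; the corresponding exp (- \<phi>) D
  have Cauchy-Riemann operator tending to 0, so their limit is holomorphic.\<close>

lemma similarity_principle:
  assumes D: "has_partials D Dx Dy" and L: "\<And>z. cmod (Dx z + \<i> * Dy z) \<le> L * cmod (D z)"
    and R: "R > 1"
  obtains \<phi> h where "continuous_on (sq (R - 1)) \<phi>"
    "h holomorphic_on {z. \<bar>Re z\<bar> < R - 1 \<and> \<bar>Im z\<bar> < R - 1}"
    "\<And>z. z \<in> sq (R - 1) \<Longrightarrow> D z = exp (\<phi> z) * h z"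
proof -
  define \<epsilon> where "\<epsilon> n = 1 / real (Suc n)" for n
  have \<epsilon>: "\<epsilon> n > 0" for n by (simp add: \<epsilon>_def)
  define q where "q n z = (cmod (D z))\<^sup>2 + (\<epsilon> n)\<^sup>2" for n z
  have q: "q n z > 0" for n z using \<epsilon>[of n] by (simp add: q_def add_nonneg_pos)
  define a where "a n z = (Dx z + \<i> * Dy z) * cnj (D z) / of_real (q n z)" for n z
  define K where "K = 2 * \<bar>L\<bar> * pot_const R"
  have K: "K \<ge> 0" using pot_const_pos[of R] by (simp add: K_def)
  note cD = has_partials_continuous[OF D] has_partials_continuous_x[OF D] has_partials_continuous_y[OF D]
  have ca: "continuous_on S (a n)" for S n
    unfolding a_def q_def using q[of n, unfolded q_def]
    by (intro continuous_intros cD) (auto simp: less_imp_neq[THEN not_sym] simp flip: of_real_add of_real_power)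
  have ba: "cmod (a n w) \<le> \<bar>L\<bar>" for n w
  proof -
    have "cmod (Dx w + \<i> * Dy w) * cmod (D w) \<le> (\<bar>L\<bar> * cmod (D w)) * cmod (D w)"
      by (intro mult_right_mono order_trans[OF L]) auto
    also have "\<dots> \<le> \<bar>L\<bar> * q n w" by (simp add: q_def power2_eq_square distrib_left)
    finally show ?thesis
      using q[of n w] by (simp add: a_def norm_mult norm_divide pos_divide_le_eq)
  qed
  have "\<exists>\<phi> \<phi>x \<phi>y. has_partials \<phi> \<phi>x \<phi>y \<and> \<phi> 0 = 0 \<and>
     (\<forall>z\<in>sq R. \<forall>z'\<in>sq R. cmod (\<phi> z - \<phi> z') \<le> 2 * \<bar>L\<bar> * pot_const R * cmod (z - z') powr (3/4)) \<and>
     (\<forall>z\<in>sq (R - 1). cmod (\<phi>x z + \<i> * \<phi>y z - a n z) \<le> \<epsilon> n)" for n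
    by (rule approximate_dbar_solution[OF ca ba less_imp_le[OF R] \<epsilon>, of n n]) blast
  then obtain \<phi> \<phi>x \<phi>y where \<phi>: "\<And>n. has_partials (\<phi> n) (\<phi>x n) (\<phi>y n)" "\<And>n. \<phi> n 0 = 0"
    "\<And>n z z'. z \<in> sq R \<Longrightarrow> z' \<in> sq R \<Longrightarrow> cmod (\<phi> n z - \<phi> n z') \<le> 2 * \<bar>L\<bar> * pot_const R * cmod (z - z') powr (3/4)"
    "\<And>n z. z \<in> sq (R - 1) \<Longrightarrow> cmod (\<phi>x n z + \<i> * \<phi>y n z - a n z) \<le> \<epsilon> n"
    by metis
  have sub: "sq (R - 1) \<subseteq> sq R" by (auto simp: sq_def)
  note hol = \<phi>(3)[folded K_def]
  define B where "B = K * (2 * R) powr (3/4)"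
  have bound: "cmod (\<phi> n z) \<le> B" if z: "z \<in> sq R" for n z
  proof -
    have "cmod z \<le> 2 * R" using cmod_le[of z] z by (auto simp: sq_def)
    then have "cmod (z - 0) powr (3/4) \<le> (2 * R) powr (3/4)" by (intro powr_mono2) auto
    then have "K * cmod (z - 0) powr (3/4) \<le> B" unfolding B_def using K by (intro mult_left_mono) auto
    moreover have "0 \<in> sq R" using R by (simp add: sq_def)
    ultimately show ?thesis using hol[OF z, of 0 n] by (simp add: \<phi>(2))
  qed
  \<comment> \<open>Neither K nor B depends on n, so the approximate solutions are equicontinuous
    and uniformly bounded.\<close>
  obtain g k where g: "continuous_on (sq (R - 1)) g" "strict_mono (k :: nat \<Rightarrow> nat)"
    and lim: "\<And>e. 0 < e \<Longrightarrow> \<exists>N. \<forall>n x. n \<ge> N \<and> x \<in> sq (R - 1) \<longrightarrow> norm (\<phi> (k n) x - g x) < e"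
  proof (rule Arzela_Ascoli[of "sq (R - 1)" \<phi> B])
    show "\<exists>d>0. \<forall>n y. y \<in> sq (R - 1) \<and> norm (x - y) < d \<longrightarrow> norm (\<phi> n x - \<phi> n y) < e"
      if x: "x \<in> sq (R - 1)" and e: "0 < e" for x e
    proof (intro exI[of _ "(e / (K + 1)) powr (4/3)"] conjI allI impI)
      show "0 < (e / (K + 1)) powr (4/3)" using e K by simp
      fix n y assume y: "y \<in> sq (R - 1) \<and> norm (x - y) < (e / (K + 1)) powr (4/3)"
      then have "K * cmod (x - y) powr (3/4) < e" by (intro holder_modulus K e) auto
      moreover have "cmod (\<phi> n x - \<phi> n y) \<le> K * cmod (x - y) powr (3/4)"
        by (rule hol) (use x y sub in auto)
      ultimately show "norm (\<phi> n x - \<phi> n y) < e" by simp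
    qed
  qed (use bound sub in auto)
  have ulg: "uniform_limit (sq (R - 1)) (\<lambda>n. \<phi> (k n)) g sequentially"
    unfolding uniform_limit_iff eventually_sequentially dist_norm using lim by blast
  obtain M where M: "M > 0" "\<And>w. w \<in> sq (R - 1) \<Longrightarrow> cmod (D w) \<le> M"
    using compact_imp_bounded[OF compact_continuous_image[OF cD(1) compact_sq[of "R - 1"]]]
    unfolding bounded_pos by blast
  let ?h = "\<lambda>n z. exp (0 - \<phi> (k n) z) * D z"
  note hp = has_partials_mult[OF has_partials_exp[OF has_partials_diff[OF has_partials_const[of 0] \<phi>(1)]] D]
  have ulh: "uniform_limit (sq (R - 1)) ?h (\<lambda>z. exp (0 - g z) * D z) sequentially"
  proof (rule uniform_lim_mult)
    have u: "uniform_limit (sq (R - 1)) (\<lambda>n z. 0 - \<phi> (k n) z) (\<lambda>z. 0 - g z) sequentially"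
      by (intro uniform_limit_intros ulg)
    show "uniform_limit (sq (R - 1)) (\<lambda>n z. exp (0 - \<phi> (k n) z)) (\<lambda>z. exp (0 - g z)) sequentially"
    proof (rule uniform_limit_compose_uniformly_continuous_on[OF u, of "cball 0 B"])
      show "uniformly_continuous_on (cball 0 B) (exp :: complex \<Rightarrow> complex)"
        by (intro compact_uniformly_continuous continuous_intros) auto
      show "\<forall>\<^sub>F n in sequentially. \<forall>z\<in>sq (R - 1). 0 - \<phi> (k n) z \<in> cball 0 B"
        using bound sub by (auto intro!: always_eventually)
    qed simp
    show "bounded ((\<lambda>z. exp (0 - g z)) ` sq (R - 1))"
      by (intro compact_imp_bounded compact_continuous_image continuous_intros g compact_sq)
    show "bounded (D ` sq (R - 1))"
      by (intro compact_imp_bounded compact_continuous_image cD compact_sq)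
  qed (intro uniform_limit_const)
  have "(\<lambda>z. exp (0 - g z) * D z) holomorphic_on {z. \<bar>Re z\<bar> < R - 1 \<and> \<bar>Im z\<bar> < R - 1}"
  proof (rule holomorphic_dbar_limit[OF hp ulh])
    fix e :: real assume e: "e > 0"
    define c where "c = exp B * (\<bar>L\<bar> + M)"
    have bnd: "cmod ((exp (0 - \<phi> (k n) z) * Dx z + exp (0 - \<phi> (k n) z) * (0 - \<phi>x (k n) z) * D z) +
          \<i> * (exp (0 - \<phi> (k n) z) * Dy z + exp (0 - \<phi> (k n) z) * (0 - \<phi>y (k n) z) * D z)) \<le> c * \<epsilon> (k n)"
      if z: "z \<in> sq (R - 1)" for n z
    proof -
      define m where "m = k n"
      have e1: "(exp (0 - \<phi> m z) * Dx z + exp (0 - \<phi> m z) * (0 - \<phi>x m z) * D z) +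
          \<i> * (exp (0 - \<phi> m z) * Dy z + exp (0 - \<phi> m z) * (0 - \<phi>y m z) * D z) =
          exp (0 - \<phi> m z) * ((Dx z + \<i> * Dy z - D z * a m z) - D z * (\<phi>x m z + \<i> * \<phi>y m z - a m z))"
        by (simp add: algebra_simps)
      \<comment> \<open>By |D_x + i D_y| \<le> |L| |D| and 2 |D| \<epsilon> \<le> q, the defect left
        by the regularisation is at most |L| \<epsilon> everywhere, also near zeros of D.\<close>
      have "Dx z + \<i> * Dy z - D z * a m z = (Dx z + \<i> * Dy z) * of_real ((\<epsilon> m)\<^sup>2 / q m z)"
      proof -
        have dd: "D z * cnj (D z) = of_real (q m z - (\<epsilon> m)\<^sup>2)"
          by (simp add: q_def complex_norm_square[symmetric])
        have "D z * a m z = (Dx z + \<i> * Dy z) * (D z * cnj (D z)) / of_real (q m z)"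
          by (simp add: a_def)
        then show ?thesis unfolding dd using q[of m z] by (simp add: field_simps)
      qed
      then have "cmod (Dx z + \<i> * Dy z - D z * a m z) = cmod (Dx z + \<i> * Dy z) * ((\<epsilon> m)\<^sup>2 / q m z)"
        using q[of m z] by (simp add: norm_mult norm_divide norm_power)
      also have "\<dots> \<le> (\<bar>L\<bar> * cmod (D z)) * ((\<epsilon> m)\<^sup>2 / q m z)"
        by (intro mult_right_mono order_trans[OF L]) (use q[of m z] in \<open>auto intro: mult_right_mono\<close>)
      also have "\<dots> = \<bar>L\<bar> * \<epsilon> m * (cmod (D z) * \<epsilon> m / q m z)" by (simp add: power2_eq_square)
      also have "\<dots> \<le> \<bar>L\<bar> * \<epsilon> m * 1"
      proof (rule mult_left_mono)
        have "2 * (cmod (D z) * \<epsilon> m) \<le> q m z" using sum_squares_bound[of "cmod (D z)" "\<epsilon> m"] by (simp add: q_def)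
        moreover have "0 \<le> cmod (D z) * \<epsilon> m" using \<epsilon>[of m] by simp
        ultimately show "cmod (D z) * \<epsilon> m / q m z \<le> 1" using q[of m z] by simp
      qed (use \<epsilon>[of m] in simp)
      finally have e2: "cmod (Dx z + \<i> * Dy z - D z * a m z) \<le> \<bar>L\<bar> * \<epsilon> m" by simp
      have e3: "cmod (D z * (\<phi>x m z + \<i> * \<phi>y m z - a m z)) \<le> M * \<epsilon> m"
        unfolding norm_mult by (intro mult_mono M \<phi>(4) z) (use M in auto)
      have e4: "cmod (exp (0 - \<phi> m z)) \<le> exp B"
        using bound[of z m] z sub by (intro order_trans[OF norm_exp]) auto
      have "cmod (exp (0 - \<phi> m z)) * cmod ((Dx z + \<i> * Dy z - D z * a m z) - D z * (\<phi>x m z + \<i> * \<phi>y m z - a m z)) \<le>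
         exp B * (\<bar>L\<bar> * \<epsilon> m + M * \<epsilon> m)"
        by (intro mult_mono e4 order_trans[OF norm_triangle_ineq4 add_mono[OF e2 e3]]) auto
      moreover have "exp B * (\<bar>L\<bar> * \<epsilon> m + M * \<epsilon> m) = c * \<epsilon> m" by (simp add: c_def algebra_simps)
      ultimately show ?thesis unfolding m_def[symmetric] e1 norm_mult by (simp only:)
    qed
    have "(\<lambda>n. c * \<epsilon> (k n)) \<longlonglongrightarrow> c * 0"
      unfolding \<epsilon>_def
      by (intro tendsto_mult tendsto_const LIMSEQ_subseq_LIMSEQ[OF _ g(2), unfolded o_def] lim_inverse_n'[THEN LIMSEQ_Suc])
    then have "\<forall>\<^sub>F n in sequentially. c * \<epsilon> (k n) < e"
      using e by (intro order_tendstoD) auto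
    then show "\<forall>\<^sub>F n in sequentially. \<forall>z\<in>sq (R - 1). cmod ((exp (0 - \<phi> (k n) z) * Dx z + exp (0 - \<phi> (k n) z) * (0 - \<phi>x (k n) z) * D z) +
          \<i> * (exp (0 - \<phi> (k n) z) * Dy z + exp (0 - \<phi> (k n) z) * (0 - \<phi>y (k n) z) * D z)) \<le> e"
      by eventually_elim (intro ballI order_trans[OF bnd less_imp_le])
  qed (use R in simp)
  then show ?thesis
    by (rule that[OF g(1)]) (simp add: exp_minus)
qed

section \<open>Winding numbers along circles\<close>

text \<open>A continuous logarithm of q plus f is a continuous logarithm of p; as f returns to its
  initial value, both have the same increment. Here mere continuity of the exponent in the
  similarity principle is enough.\<close>

lemma winding_number_exp_mult:
  assumes q: "path q" "0 \<notin> path_image q"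
    and f: "continuous_on {0..1} f" "f 0 = f 1"
    and p: "\<And>t. t \<in> {0..1} \<Longrightarrow> p t = exp (f t) * q t"
  shows "winding_number p 0 = winding_number q 0"
proof -
  obtain l where l: "path l" "pathfinish l - pathstart l = 2 * of_real pi * \<i> * winding_number q 0"
    "\<And>t. t \<in> {0..1} \<Longrightarrow> q t = 0 + exp (l t)"
    using winding_number_as_continuous_log[OF q] by metis
  have "path (\<lambda>t. f t + l t)"
    using f l(1) by (auto simp: path_def intro!: continuous_intros)
  from winding_number_compose_exp[OF this]
  have "winding_number (exp \<circ> (\<lambda>t. f t + l t)) 0 = winding_number q 0"
    using l(2) f(2) by (simp add: pathfinish_def pathstart_def)
  moreover have "winding_number (exp \<circ> (\<lambda>t. f t + l t)) 0 = winding_number p 0"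
    by (rule winding_number_cong) (simp add: p l(3) exp_add)
  ultimately show ?thesis by simp
qed

lemma open_sq_interior: "open {z. \<bar>Re z\<bar> < r \<and> \<bar>Im z\<bar> < r}"
  and convex_sq_interior: "convex {z. \<bar>Re z\<bar> < r \<and> \<bar>Im z\<bar> < r}"
proof -
  have "{z. \<bar>Re z\<bar> < r \<and> \<bar>Im z\<bar> < r} = box (Complex (-r) (-r)) (Complex r r)"
    by (auto simp: in_box_complex_iff abs_less_iff)
  then show "open {z. \<bar>Re z\<bar> < r \<and> \<bar>Im z\<bar> < r}" "convex {z. \<bar>Re z\<bar> < r \<and> \<bar>Im z\<bar> < r}"
    by (simp_all only: open_box convex_box)
qed

text \<open>Winding numbers are complex-valued; the real part makes them comparable. The loop is one
  turn t in [0, 1], and the value is meaningful when D has no zero on the circle.\<close>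

definition wind :: "(complex \<Rightarrow> complex) \<Rightarrow> real \<Rightarrow> real" where
  "wind D s = Re (winding_number (\<lambda>t. D (Complex s t)) 0)"

lemma path_circle:
  assumes "continuous_on UNIV D"
  shows "path (\<lambda>t. D (Complex s (a + t)))"
  unfolding path_def
  by (rule continuous_on_compose2[OF assms]) (auto simp: Complex_eq intro!: continuous_intros)

lemma periodic_int:
  fixes D :: "complex \<Rightarrow> complex"
  assumes per: "\<And>z. D (z + \<i>) = D z"
  shows "D (Complex s (t + of_int m)) = D (Complex s t)"
proof -
  have nat: "D (z + of_nat n * \<i>) = D z" for z n
  proof (induction n)
    case (Suc n)
    have "D (z + of_nat (Suc n) * \<i>) = D ((z + of_nat n * \<i>) + \<i>)" by (simp add: algebra_simps)
    then show ?case using Suc per by simp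
  qed simp
  have "Complex s (t + of_int m) = Complex s t + of_int m * \<i>" by (simp add: complex_eq_iff)
  moreover have "D (z + of_int m * \<i>) = D z" for z
  proof (cases "m \<ge> 0")
    case True then show ?thesis using nat[of z "nat m"] by simp
  next
    case False
    then show ?thesis using nat[of "z + of_int m * \<i>" "nat (- m)"] by (simp add: algebra_simps)
  qed
  ultimately show ?thesis by simp
qed

section \<open>Zeros and winding numbers of a difference of two solutions\<close>

locale cr_difference =
  fixes D Dx Dy :: "complex \<Rightarrow> complex" and L :: real
  assumes hp: "has_partials D Dx Dy"
    and ineq: "\<And>z. cmod (Dx z + \<i> * Dy z) \<le> L * cmod (D z)"
    and per: "\<And>z. D (z + \<i>) = D z"
    and nonzero: "\<exists>z. D z \<noteq> 0"
begin

lemma contD: "continuous_on S D"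
  by (rule has_partials_continuous[OF hp])

lemma per_int: "D (Complex s (t + of_int m)) = D (Complex s t)"
  by (rule periodic_int) (rule per)

text \<open>The square is enlarged until it contains a point with D \<noteq> 0; otherwise h might
  vanish identically on it and carry no information about zeros.\<close>

lemma local_factor:
  obtains q \<phi> h where "r < q" "continuous_on {z. \<bar>Re z\<bar> < q \<and> \<bar>Im z\<bar> < q} \<phi>"
    "h holomorphic_on {z. \<bar>Re z\<bar> < q \<and> \<bar>Im z\<bar> < q}"
    "\<And>z. \<bar>Re z\<bar> < q \<Longrightarrow> \<bar>Im z\<bar> < q \<Longrightarrow> D z = exp (\<phi> z) * h z"
    "\<exists>z. \<bar>Re z\<bar> < q \<and> \<bar>Im z\<bar> < q \<and> h z \<noteq> 0"
proof -
  obtain z0 where z0: "D z0 \<noteq> 0" using nonzero by blast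
  define q where "q = \<bar>r\<bar> + cmod z0 + 1"
  have q: "r < q" "q > 0" "\<bar>Re z0\<bar> < q" "\<bar>Im z0\<bar> < q"
    using abs_Re_le_cmod[of z0] abs_Im_le_cmod[of z0] by (auto simp: q_def add_nonneg_pos)
  have q1: "q + 1 > 1" using q by simp
  obtain \<phi> h where *: "continuous_on (sq (q + 1 - 1)) \<phi>"
    "h holomorphic_on {z. \<bar>Re z\<bar> < q + 1 - 1 \<and> \<bar>Im z\<bar> < q + 1 - 1}"
    "\<And>z. z \<in> sq (q + 1 - 1) \<Longrightarrow> D z = exp (\<phi> z) * h z"
    by (rule similarity_principle[OF hp ineq q1]) (rule that)
  show ?thesis
  proof (rule that[OF q(1)])
    show "continuous_on {z. \<bar>Re z\<bar> < q \<and> \<bar>Im z\<bar> < q} \<phi>"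
      by (rule continuous_on_subset[OF *(1)]) (auto simp: sq_def)
    show e: "D z = exp (\<phi> z) * h z" if "\<bar>Re z\<bar> < q" "\<bar>Im z\<bar> < q" for z
      using *(3)[of z] that by (simp add: sq_def)
    show "\<exists>z. \<bar>Re z\<bar> < q \<and> \<bar>Im z\<bar> < q \<and> h z \<noteq> 0"
      using z0 q e[OF q(3,4)] by auto
  qed (use * in simp)
qed

text \<open>The factor exp \<phi> has no zeros, so the zeros of D are those of a holomorphic
  function that is not identically zero.\<close>

lemma finite_zeros: "finite {z \<in> sq r. D z = 0}"
proof -
  obtain q \<phi> h where q: "r < q" and \<phi>: "continuous_on {z. \<bar>Re z\<bar> < q \<and> \<bar>Im z\<bar> < q} \<phi>"
    and h: "h holomorphic_on {z. \<bar>Re z\<bar> < q \<and> \<bar>Im z\<bar> < q}"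
    and D: "\<And>z. \<bar>Re z\<bar> < q \<Longrightarrow> \<bar>Im z\<bar> < q \<Longrightarrow> D z = exp (\<phi> z) * h z"
    and nz: "\<exists>z. \<bar>Re z\<bar> < q \<and> \<bar>Im z\<bar> < q \<and> h z \<noteq> 0"
    by (rule local_factor[of r]) (rule that)
  let ?S = "{z. \<bar>Re z\<bar> < q \<and> \<bar>Im z\<bar> < q}"
  show ?thesis
  proof (cases "h constant_on ?S")
    case True
    then have "h z \<noteq> 0" if "\<bar>Re z\<bar> < q" "\<bar>Im z\<bar> < q" for z
      using nz that unfolding constant_on_def by fastforce
    then have "{z \<in> sq r. D z = 0} = {}" using D q by (auto simp: sq_def)
    then show ?thesis by (metis finite.emptyI)
  next
    case False
    have "finite {z \<in> sq r. h z = 0}"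
      by (rule holomorphic_compact_finite_zeros[OF h open_sq_interior convex_connected[OF convex_sq_interior] compact_sq _ False])
        (use q in \<open>auto simp: sq_def\<close>)
    then show ?thesis by (rule rev_finite_subset) (use D q in \<open>auto simp: sq_def\<close>)
  qed
qed

text \<open>Along a closed path exp \<phi> does not wind, so the argument principle for h applies to
  D. There are no poles and every zero has positive order; m is the sum of the orders inside the
  rectangle.\<close>

lemma winding_rectangle:
  assumes s: "s1 < s2" and nz: "\<And>z. z \<in> path_image (rectpath (Complex s1 t0) (Complex s2 (t0 + 1))) \<Longrightarrow> D z \<noteq> 0"
  obtains m :: int where "m \<ge> 0"
    "\<exists>z\<in>box (Complex s1 t0) (Complex s2 (t0 + 1)). D z = 0 \<Longrightarrow> m > 0"
    "winding_number (D \<circ> rectpath (Complex s1 t0) (Complex s2 (t0 + 1))) 0 = of_int m"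
proof -
  let ?a = "Complex s1 t0" and ?b = "Complex s2 (t0 + 1)"
  let ?\<gamma> = "rectpath ?a ?b"
  define r where "r = \<bar>s1\<bar> + \<bar>s2\<bar> + \<bar>t0\<bar> + 1"
  have cb: "z \<in> sq r" if "z \<in> cbox ?a ?b" for z
    using that by (auto simp: sq_def r_def in_cbox_complex_iff)
  obtain q \<phi> h where q: "r < q" and \<phi>: "continuous_on {z. \<bar>Re z\<bar> < q \<and> \<bar>Im z\<bar> < q} \<phi>"
    and h: "h holomorphic_on {z. \<bar>Re z\<bar> < q \<and> \<bar>Im z\<bar> < q}"
    and D: "\<And>z. \<bar>Re z\<bar> < q \<Longrightarrow> \<bar>Im z\<bar> < q \<Longrightarrow> D z = exp (\<phi> z) * h z"
    and hnz: "\<exists>z. \<bar>Re z\<bar> < q \<and> \<bar>Im z\<bar> < q \<and> h z \<noteq> 0"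
    by (rule local_factor[of r]) (rule that)
  define q' where "q' = (r + q) / 2"
  have q': "r < q'" "q' < q" using q by (auto simp: q'_def)
  define S where "S = {z. \<bar>Re z\<bar> < q' \<and> \<bar>Im z\<bar> < q'}"
  have S: "open S" "connected S"
    unfolding S_def by (rule open_sq_interior convex_connected[OF convex_sq_interior])+
  have sub: "S \<subseteq> {z. \<bar>Re z\<bar> < q \<and> \<bar>Im z\<bar> < q}" using q' by (auto simp: S_def)
  have hS: "h holomorphic_on S" by (rule holomorphic_on_subset[OF h sub])
  have cbS: "cbox ?a ?b \<subseteq> S" using cb q' by (force simp: S_def sq_def)
  have pi: "path_image ?\<gamma> \<subseteq> cbox ?a ?b"
    using s by (intro path_image_rectpath_subset_cbox) auto
  have DS: "D z = exp (\<phi> z) * h z" if "z \<in> S" for z using D that sub by auto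
  have hz: "h z \<noteq> 0" if "z \<in> path_image ?\<gamma>" for z
    using nz[OF that] DS[of z] that pi cbS by auto
  have vp: "valid_path (h \<circ> ?\<gamma>)"
    by (rule valid_path_compose_holomorphic[OF valid_path_rectpath hS S(1)]) (use pi cbS in auto)
  have n0: "0 \<notin> path_image (h \<circ> ?\<gamma>)"
    using hz by (auto simp: path_image_compose)
  have 1: "winding_number (D \<circ> ?\<gamma>) 0 = winding_number (h \<circ> ?\<gamma>) 0"
  proof (rule winding_number_exp_mult[OF valid_path_imp_path[OF vp] n0, of "\<phi> \<circ> ?\<gamma>"])
    have "path (rectpath ?a ?b)" by simp
    then show "continuous_on {0..1} (\<phi> \<circ> ?\<gamma>)"
      unfolding path_def
      by (rule continuous_on_compose) (use pi cbS sub in \<open>auto simp: path_image_def intro: continuous_on_subset[OF \<phi>]\<close>)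
    show "(\<phi> \<circ> ?\<gamma>) 0 = (\<phi> \<circ> ?\<gamma>) 1"
      using pathstart_rectpath[of ?a ?b] pathfinish_rectpath[of ?a ?b] by (simp add: pathstart_def pathfinish_def)
    show "(D \<circ> ?\<gamma>) t = exp ((\<phi> \<circ> ?\<gamma>) t) * (h \<circ> ?\<gamma>) t" if "t \<in> {0..1}" for t
    proof -
      have "?\<gamma> t \<in> path_image ?\<gamma>" using that by (auto simp: path_image_def)
      then have "?\<gamma> t \<in> S" using pi cbS by blast
      then show ?thesis by (simp add: DS)
    qed
  qed
  have an: "h analytic_on path_image ?\<gamma>"
    using hS S pi cbS by (meson analytic_on_open analytic_on_subset subset_trans)
  define Z where "Z = {w \<in> S. h w = 0 \<or> w \<in> {}}"
  have fin: "finite Z"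
  proof (rule rev_finite_subset[OF finite_zeros[of q']])
    show "Z \<subseteq> {z \<in> sq q'. D z = 0}" using DS by (auto simp: Z_def S_def sq_def)
  qed
  have "contour_integral ?\<gamma> (\<lambda>x. deriv h x * 1 / h x) = 2 * pi * \<i> * (\<Sum>p\<in>Z. winding_number ?\<gamma> p * 1 * zorder h p)"
    unfolding Z_def
  proof (rule argument_principle[OF S])
    show "\<forall>z. z \<notin> S \<longrightarrow> winding_number ?\<gamma> z = 0"
      using cbS s by (intro allI impI winding_number_rectpath_outside) auto
    show "path_image ?\<gamma> \<subseteq> S - {w \<in> S. h w = 0 \<or> w \<in> {}}" using pi cbS hz by auto
  qed (use hS fin in \<open>auto simp: Z_def\<close>)
  moreover have "winding_number (h \<circ> ?\<gamma>) 0 = 1 / (2 * pi * \<i>) * contour_integral ?\<gamma> (\<lambda>x. deriv h x * 1 / h x)"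
    unfolding winding_number_valid_path[OF vp n0]
    using contour_integral_comp_analyticW[OF an valid_path_rectpath order_refl, of "\<lambda>w. 1 / (w - 0)"] by simp
  ultimately have 2: "winding_number (h \<circ> ?\<gamma>) 0 = (\<Sum>p\<in>Z. winding_number ?\<gamma> p * zorder h p)"
    by simp
  define g where "g p = (if p \<in> box ?a ?b then zorder h p else 0)" for p
  have 3: "winding_number ?\<gamma> p * zorder h p = of_int (g p)" if "p \<in> Z" for p
  proof (cases "p \<in> box ?a ?b")
    case True
    then show ?thesis by (simp add: g_def winding_number_rectpath)
  next
    case False
    have "p \<notin> path_image ?\<gamma>" using that hz by (auto simp: Z_def)
    then have "p \<notin> cbox ?a ?b" using False s by (auto simp: path_image_rectpath_cbox_minus_box)
    then have "winding_number ?\<gamma> p = 0" using s by (intro winding_number_rectpath_outside) auto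
    then show ?thesis using False by (simp add: g_def)
  qed
  \<comment> \<open>The order is positive once h does not vanish near p; the point \<beta>
    guarantees this through the identity theorem on the whole square.\<close>
  have zo: "zorder h p > 0" if p: "p \<in> Z" for p
  proof -
    obtain \<beta> where \<beta>: "\<bar>Re \<beta>\<bar> < q" "\<bar>Im \<beta>\<bar> < q" "h \<beta> \<noteq> 0" using hnz by blast
    have pq: "p \<in> {z. \<bar>Re z\<bar> < q \<and> \<bar>Im z\<bar> < q}" using p sub by (auto simp: Z_def)
    have "\<forall>\<^sub>F w in at p. h w \<noteq> 0 \<and> w \<in> {z. \<bar>Re z\<bar> < q \<and> \<bar>Im z\<bar> < q}"
      by (rule non_zero_neighbour_alt[OF h open_sq_interior convex_connected[OF convex_sq_interior] pq _ \<beta>(3)])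
        (use \<beta> in auto)
    then have "\<exists>\<^sub>F w in at p. h w \<noteq> 0"
      by (intro eventually_frequently) (auto elim: eventually_mono)
    then show ?thesis
      using zorder_pos_iff[OF hS S(1)] p by (auto simp: Z_def)
  qed
  show ?thesis
  proof (rule that[of "\<Sum>p\<in>Z. g p"])
    show "(\<Sum>p\<in>Z. g p) \<ge> 0" using zo by (intro sum_nonneg) (auto simp: g_def less_imp_le)
    show "(\<Sum>p\<in>Z. g p) > 0" if "\<exists>z\<in>box ?a ?b. D z = 0"
    proof -
      obtain z where z: "z \<in> box ?a ?b" "D z = 0" using \<open>\<exists>z\<in>box ?a ?b. D z = 0\<close> by blast
      have "z \<in> S" using z cbS box_subset_cbox by blast
      then have "z \<in> Z" using z DS[of z] by (simp add: Z_def)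
      then show ?thesis using zo z fin by (intro sum_pos2[of _ z]) (auto simp: g_def less_imp_le)
    qed
    show "winding_number (D \<circ> ?\<gamma>) 0 = of_int (\<Sum>p\<in>Z. g p)"
      unfolding 1 2 of_int_sum by (rule sum.cong) (auto simp: 3)
  qed
qed

text \<open>The height is one period, so the horizontal sides carry the same values of D in opposite
  directions and cancel. Each vertical side is the loop of its circle, started at t0 instead of
  0.\<close>

lemma winding_rectangle_eq:
  assumes s: "s1 < s2" and t0: "t0 \<in> {0..1}"
    and nz: "\<And>z. z \<in> path_image (rectpath (Complex s1 t0) (Complex s2 (t0 + 1))) \<Longrightarrow> D z \<noteq> 0"
  shows "winding_number (D \<circ> rectpath (Complex s1 t0) (Complex s2 (t0 + 1))) 0 =
     winding_number (\<lambda>t. D (Complex s2 t)) 0 - winding_number (\<lambda>t. D (Complex s1 t)) 0"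
proof -
  let ?a1 = "Complex s1 t0" and ?a2 = "Complex s2 t0" and ?a3 = "Complex s2 (t0 + 1)" and ?a4 = "Complex s1 (t0 + 1)"
  have per1: "D (Complex s (t + 1)) = D (Complex s t)" for s t using per_int[of s t 1] by simp
  have path: "path (D \<circ> linepath a b)" for a b
    using contD by (intro path_continuous_image) auto
  have "D z \<noteq> 0" if "z \<in> path_image (linepath ?a1 ?a2) \<union> path_image (linepath ?a2 ?a3) \<union> path_image (linepath ?a3 ?a4) \<union> path_image (linepath ?a4 ?a1)" for z
    using that by (intro nz) (auto simp: rectpath_def Let_def path_image_join)
  then have n0: "0 \<notin> path_image (D \<circ> linepath ?a1 ?a2)" "0 \<notin> path_image (D \<circ> linepath ?a2 ?a3)"
    "0 \<notin> path_image (D \<circ> linepath ?a3 ?a4)" "0 \<notin> path_image (D \<circ> linepath ?a4 ?a1)"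
    by (auto simp: path_image_compose simp del: path_image_linepath)
  have vert: "winding_number (D \<circ> linepath (Complex s t0) (Complex s (t0 + 1))) 0 = winding_number (\<lambda>t. D (Complex s t)) 0"
    if "0 \<notin> path_image (D \<circ> linepath (Complex s t0) (Complex s (t0 + 1)))" for s
  proof -
    have lin: "D \<circ> linepath (Complex s t0) (Complex s (t0 + 1)) = (\<lambda>t. D (Complex s (t0 + t)))"
    proof
      fix t
      have "linepath (Complex s t0) (Complex s (t0 + 1)) t = Complex s (t0 + t)"
        by (simp add: linepath_def complex_eq_iff algebra_simps)
      then show "(D \<circ> linepath (Complex s t0) (Complex s (t0 + 1))) t = D (Complex s (t0 + t))" by simp
    qed
    have sh: "(\<lambda>t. D (Complex s (t0 + t))) = shiftpath t0 (\<lambda>t. D (Complex s t))"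
      using per1[of s "t0 + t - 1" for t] by (auto simp: fun_eq_iff shiftpath_def)
    have "D (Complex s t) \<noteq> 0" for t
    proof
      assume 0: "D (Complex s t) = 0"
      define m where "m = \<lfloor>t - t0\<rfloor>"
      have "D (Complex s (t0 + (t - t0 - m))) = 0" using per_int[of s t "- m"] 0 by (simp add: algebra_simps)
      moreover have "t - t0 - m \<in> {0..1}" unfolding m_def by (simp; linarith)
      ultimately show False using that unfolding lin path_image_def by (metis imageI)
    qed
    then have "0 \<notin> path_image (\<lambda>t. D (Complex s t))" by (auto simp: path_image_def)
    then show ?thesis unfolding lin sh
      using path_circle[OF contD, of s 0] per1[of s 0] t0
      by (intro winding_number_shiftpath) (auto simp: pathfinish_def pathstart_def)
  qed
  have top: "D \<circ> linepath ?a3 ?a4 = reversepath (D \<circ> linepath ?a1 ?a2)"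
  proof
    fix t
    have "linepath ?a3 ?a4 t = Complex (s2 - t * (s2 - s1)) (t0 + 1)" "linepath ?a1 ?a2 (1 - t) = Complex (s2 - t * (s2 - s1)) t0"
      by (auto simp: linepath_def complex_eq_iff algebra_simps)
    then show "(D \<circ> linepath ?a3 ?a4) t = reversepath (D \<circ> linepath ?a1 ?a2) t"
      by (simp add: reversepath_def per1)
  qed
  have left: "D \<circ> linepath ?a4 ?a1 = reversepath (D \<circ> linepath ?a1 ?a4)"
    by (auto simp: fun_eq_iff reversepath_def linepath_def algebra_simps)
  have n0': "0 \<notin> path_image (D \<circ> linepath ?a1 ?a4)"
    using n0(4) unfolding left by simp
  have "D \<circ> rectpath ?a1 ?a3 = (D \<circ> linepath ?a1 ?a2) +++ (D \<circ> linepath ?a2 ?a3) +++ (D \<circ> linepath ?a3 ?a4) +++ (D \<circ> linepath ?a4 ?a1)"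
    by (simp add: rectpath_def Let_def path_compose_join)
  then have "winding_number (D \<circ> rectpath ?a1 ?a3) 0 =
     winding_number (D \<circ> linepath ?a1 ?a2) 0 + (winding_number (D \<circ> linepath ?a2 ?a3) 0 +
     (winding_number (D \<circ> linepath ?a3 ?a4) 0 + winding_number (D \<circ> linepath ?a4 ?a1) 0))"
    using n0 path
    by (simp add: winding_number_join pathstart_compose pathfinish_compose path_image_join not_in_path_image_join)
  also have "winding_number (D \<circ> linepath ?a3 ?a4) 0 = - winding_number (D \<circ> linepath ?a1 ?a2) 0"
    unfolding top by (rule winding_number_reversepath[OF path n0(1)])
  also have "winding_number (D \<circ> linepath ?a4 ?a1) 0 = - winding_number (\<lambda>t. D (Complex s1 t)) 0"
    unfolding left winding_number_reversepath[OF path n0'] vert[OF n0'] ..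
  also have "winding_number (D \<circ> linepath ?a2 ?a3) 0 = winding_number (\<lambda>t. D (Complex s2 t)) 0"
    by (rule vert[OF n0(2)])
  finally show ?thesis by (simp add: comp_def)
qed

text \<open>The horizontal sides of the rectangle must avoid zeros of D. In a bounded region there
  are finitely many, so all but finitely many heights t0 in (0, 1) are admissible.\<close>

lemma wind_increase:
  assumes s: "s1 < s2" and nz: "\<And>t. D (Complex s1 t) \<noteq> 0" "\<And>t. D (Complex s2 t) \<noteq> 0"
  shows "wind D s1 \<le> wind D s2"
    and "s1 < s \<Longrightarrow> s < s2 \<Longrightarrow> D (Complex s t) = 0 \<Longrightarrow> wind D s1 < wind D s2"
proof -
  define r where "r = \<bar>s1\<bar> + \<bar>s2\<bar> + 2"
  have "infinite ({0<..<1::real} - Im ` {z \<in> sq r. D z = 0})"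
    using finite_zeros[of r] by (intro Diff_infinite_finite finite_imageI) auto
  then obtain t0 where t0: "0 < t0" "t0 < 1" "t0 \<notin> Im ` {z \<in> sq r. D z = 0}"
    by (metis (no_types, lifting) DiffE ex_in_conv finite.emptyI greaterThanLessThan_iff)
  have hor: "D (Complex s t0) \<noteq> 0" if "s1 \<le> s" "s \<le> s2" for s
  proof
    assume "D (Complex s t0) = 0"
    then have "Complex s t0 \<in> {z \<in> sq r. D z = 0}" using that t0 by (auto simp: sq_def r_def)
    then show False using t0(3) by (metis imageI complex.sel(2))
  qed
  have nzp: "D z \<noteq> 0" if "z \<in> path_image (rectpath (Complex s1 t0) (Complex s2 (t0 + 1)))" for z
  proof -
    have "z \<in> {z. Re z \<in> {s1, s2} \<and> Im z \<in> {t0..t0 + 1}} \<union> {z. Im z \<in> {t0, t0 + 1} \<and> Re z \<in> {s1..s2}}"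
      using that s by (subst (asm) path_image_rectpath) auto
    then consider "Re z = s1" | "Re z = s2" | "Im z = t0" "s1 \<le> Re z" "Re z \<le> s2" | "Im z = t0 + 1" "s1 \<le> Re z" "Re z \<le> s2"
      by auto
    then show ?thesis
    proof cases
      case 4
      have "D (Complex (Re z) (t0 + 1)) = D (Complex (Re z) t0)" using per_int[of "Re z" t0 1] by simp
      then show ?thesis using hor[OF 4(2,3)] 4(1) by (metis complex.collapse)
    qed (use nz hor in \<open>metis complex.collapse\<close>)+
  qed
  have t01: "t0 \<in> {0..1}" using t0 by simp
  obtain m where m: "m \<ge> 0" "\<exists>z\<in>box (Complex s1 t0) (Complex s2 (t0 + 1)). D z = 0 \<Longrightarrow> m > 0"
    "winding_number (D \<circ> rectpath (Complex s1 t0) (Complex s2 (t0 + 1))) 0 = of_int m"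
    using winding_rectangle[OF s nzp] by blast
  have eq: "wind D s2 - wind D s1 = of_int m"
    using winding_rectangle_eq[OF s t01 nzp] m(3) unfolding wind_def by (metis Re_complex_of_real minus_complex.sel(1) of_real_of_int_eq)
  show "wind D s1 \<le> wind D s2" using eq m(1) by (metis diff_ge_0_iff_ge of_int_0_le_iff)
  show "wind D s1 < wind D s2" if "s1 < s" "s < s2" "D (Complex s t) = 0"
  proof -
    \<comment> \<open>Periodicity moves the zero into the window from t0 to t0 + 1; it ends up in
      the interior because no zero has height t0.\<close>
    define k where "k = \<lfloor>t - t0\<rfloor>"
    have 0: "D (Complex s (t - k)) = 0" using per_int[of s t "- k"] that by simp
    have "t0 \<le> t - k" "t - k < t0 + 1" unfolding k_def by linarith+
    moreover have "t - k \<noteq> t0" using hor[of s] 0 that by auto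
    ultimately have "Complex s (t - k) \<in> box (Complex s1 t0) (Complex s2 (t0 + 1))"
      using that by (auto simp: in_box_complex_iff)
    then have "m > 0" using 0 by (intro m(2)) blast
    then show ?thesis using eq by (metis diff_gt_0_iff_gt of_int_0_less_iff)
  qed
qed

text \<open>Modulo the period, the zeros with bounded real part are finitely many, so a single
  \<epsilon> can avoid them on both sides of s at once.\<close>

lemma nonzero_circles_dense:
  assumes "\<delta> > 0"
  obtains \<epsilon> where "0 < \<epsilon>" "\<epsilon> < \<delta>" "\<And>t. D (Complex (s - \<epsilon>) t) \<noteq> 0" "\<And>t. D (Complex (s + \<epsilon>) t) \<noteq> 0"
proof -
  define r where "r = \<bar>s\<bar> + \<delta> + 1"
  let ?Z = "{z \<in> sq r. D z = 0}"
  have "infinite ({0<..<\<delta>} - ((\<lambda>z. Re z - s) ` ?Z \<union> (\<lambda>z. s - Re z) ` ?Z))"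
    using finite_zeros[of r] assms by (intro Diff_infinite_finite finite_UnI finite_imageI) auto
  then have "{0<..<\<delta>} - ((\<lambda>z. Re z - s) ` ?Z \<union> (\<lambda>z. s - Re z) ` ?Z) \<noteq> {}"
    by (rule infinite_imp_nonempty)
  then obtain \<epsilon> where "\<epsilon> \<in> {0<..<\<delta>} - ((\<lambda>z. Re z - s) ` ?Z \<union> (\<lambda>z. s - Re z) ` ?Z)"
    by (auto simp only: ex_in_conv[symmetric])
  then have \<epsilon>: "0 < \<epsilon>" "\<epsilon> < \<delta>" "\<epsilon> \<notin> (\<lambda>z. Re z - s) ` ?Z" "\<epsilon> \<notin> (\<lambda>z. s - Re z) ` ?Z"
    by auto
  have nz: "D (Complex s' t) \<noteq> 0" if "\<bar>s'\<bar> \<le> r" "\<And>z. z \<in> ?Z \<Longrightarrow> Re z \<noteq> s'" for s' t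
  proof
    assume 0: "D (Complex s' t) = 0"
    have "D (Complex s' (t - \<lfloor>t\<rfloor>)) = 0" using per_int[of s' t "- \<lfloor>t\<rfloor>"] 0 by simp
    moreover have "\<bar>t - \<lfloor>t\<rfloor>\<bar> \<le> r" using assms unfolding r_def by linarith
    ultimately have "Complex s' (t - \<lfloor>t\<rfloor>) \<in> ?Z" using that by (simp add: sq_def)
    then show False using that(2) by fastforce
  qed
  show ?thesis
  proof (rule that[OF \<epsilon>(1,2)])
    show "D (Complex (s - \<epsilon>) t) \<noteq> 0" for t
      by (rule nz) (use \<epsilon> in \<open>auto simp: r_def image_iff\<close>)
    show "D (Complex (s + \<epsilon>) t) \<noteq> 0" for t
      by (rule nz) (use \<epsilon> in \<open>auto simp: r_def image_iff\<close>)
  qed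
qed

end

section \<open>Compactness of the space of bounded solutions\<close>

definition lconv :: "(nat \<Rightarrow> complex \<Rightarrow> complex) \<Rightarrow> (complex \<Rightarrow> complex) \<Rightarrow> bool" where
  "lconv f g \<longleftrightarrow> (\<forall>R. uniform_limit (sq R) f g sequentially)"

lemma in_sq_cmod: "cmod z \<le> R \<Longrightarrow> z \<in> sq R"
  using abs_Re_le_cmod[of z] abs_Im_le_cmod[of z] by (simp add: sq_def)

lemma lconv_pointwise: "lconv f g \<Longrightarrow> (\<lambda>n. f n z) \<longlonglongrightarrow> g z"
  unfolding lconv_def
  by (rule tendsto_uniform_limitI[where S = "sq (cmod z)"]) (auto simp: in_sq_cmod)

lemma uniform_limit_subseq:
  "uniform_limit S f g sequentially \<Longrightarrow> strict_mono k \<Longrightarrow> uniform_limit S (\<lambda>n. f (k n)) g sequentially"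
  unfolding uniform_limit_iff
proof (intro allI impI)
  fix e :: real assume "\<forall>e>0. \<forall>\<^sub>F n in sequentially. \<forall>x\<in>S. dist (f n x) (g x) < e" "strict_mono k" "e > 0"
  then show "\<forall>\<^sub>F n in sequentially. \<forall>x\<in>S. dist (f (k n) x) (g x) < e"
    using eventually_subseq[of k "\<lambda>n. \<forall>x\<in>S. dist (f n x) (g x) < e"] by simp
qed

lemma lconv_subseq: "lconv f g \<Longrightarrow> strict_mono k \<Longrightarrow> lconv (\<lambda>n. f (k n)) g"
  unfolding lconv_def using uniform_limit_subseq by metis

text \<open>Halving the step makes the difference of consecutive quotients a multiple of a second
  difference of U, the quantity that \<open>sol_second_difference\<close> controls.\<close>

definition dyadic_quotient :: "(complex \<Rightarrow> complex) \<Rightarrow> complex \<Rightarrow> nat \<Rightarrow> complex \<Rightarrow> complex" where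
  "dyadic_quotient U e j z = 2 ^ j * (U (z + of_real ((1/2) ^ j) * e) - U z)"

lemma uniform_limit_dyadic_quotient:
  assumes "lconv f g"
  shows "uniform_limit (sq R) (\<lambda>n. dyadic_quotient (f n) e j) (dyadic_quotient g e j) sequentially"
proof -
  define h where "h = of_real ((1/2) ^ j) * e"
  have "uniform_limit (sq R) f g sequentially" using assms by (simp add: lconv_def)
  moreover have "uniform_limit (sq R) (\<lambda>n z. f n (z + h)) (\<lambda>z. g (z + h)) sequentially"
  proof (rule uniform_limit_compose'[where A = "sq (R + cmod h)"])
    show "uniform_limit (sq (R + cmod h)) f g sequentially" using assms by (simp add: lconv_def)
    show "(\<lambda>z. z + h) \<in> sq R \<rightarrow> sq (R + cmod h)"
      using abs_Re_le_cmod[of h] abs_Im_le_cmod[of h] by (auto simp: sq_def)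
  qed
  ultimately show ?thesis
    unfolding dyadic_quotient_def h_def[symmetric]
    by (intro bounded_linear.uniform_limit[OF bounded_linear_mult_right] uniform_limit_intros)
qed

definition unit_partial :: "complex \<Rightarrow> (complex \<Rightarrow> complex) \<Rightarrow> (complex \<Rightarrow> complex) \<Rightarrow> complex \<Rightarrow> complex" where
  "unit_partial e Ux Uy = (\<lambda>z. of_real (Re e) * Ux z + of_real (Im e) * Uy z)"

lemma dyadic_quotient_tendsto:
  assumes U: "has_partials U Ux Uy" and e: "cmod e = 1"
  shows "(\<lambda>j. dyadic_quotient U e j z) \<longlonglongrightarrow> unit_partial e Ux Uy z"
proof -
  let ?D = "\<lambda>h. of_real (Re h) * Ux z + of_real (Im h) * Uy z"
  define h where "h j = of_real ((1/2) ^ j) * e" for j :: nat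
  have nh: "cmod (h j) = (1/2) ^ j" for j using e by (simp add: h_def norm_mult norm_power)
  have "(\<lambda>j. of_real ((1/2) ^ j) * e) \<longlonglongrightarrow> of_real 0 * e"
    by (intro tendsto_mult tendsto_of_real tendsto_const LIMSEQ_realpow_zero) auto
  moreover have "h j \<noteq> 0" for j using nh[of j] by auto
  ultimately have "filterlim h (at 0) sequentially"
    by (auto simp: filterlim_at h_def[abs_def])
  moreover have "((\<lambda>h. norm (U (z + h) - U z - ?D h) / norm h) \<longlongrightarrow> 0) (at 0)"
    using has_partials_derivative[OF U, of z UNIV] by (simp add: has_derivative_at)
  ultimately have "(\<lambda>j. norm (U (z + h j) - U z - ?D (h j)) / norm (h j)) \<longlonglongrightarrow> 0"
    by (rule filterlim_compose[rotated])
  moreover have "norm (U (z + h j) - U z - ?D (h j)) / norm (h j) = norm (dyadic_quotient U e j z - ?D e)" for j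
  proof -
    have "dyadic_quotient U e j z - ?D e = 2 ^ j * (U (z + h j) - U z - ?D (h j))"
      by (simp add: dyadic_quotient_def h_def algebra_simps power_one_over)
    then have "norm (dyadic_quotient U e j z - ?D e) = 2 ^ j * norm (U (z + h j) - U z - ?D (h j))"
      by (simp only: norm_mult norm_power norm_numeral)
    then show ?thesis unfolding nh by (simp add: power_one_over)
  qed
  ultimately show ?thesis
    unfolding unit_partial_def by (simp add: tendsto_norm_zero_iff LIM_zero_iff)
qed

text \<open>One M bounds both the solutions and the right-hand side, because
  \<open>dbar_holder\<close> takes a common bound. The Lipschitz condition involves z since second
  differences compare the equation at z and z + h. \<open>G_shift\<close> makes translation in s a
  symmetry.\<close>

locale cr_system =
  fixes G :: "complex \<Rightarrow> complex \<Rightarrow> complex" and C M L :: real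
  assumes C_le: "0 \<le> C" "C \<le> M" and L_nonneg: "0 \<le> L"
    and G_bound: "\<And>z w. cmod w \<le> C \<Longrightarrow> cmod (G z w) \<le> M"
    and G_lip: "\<And>z z' w w'. cmod (z - z') \<le> 1 \<Longrightarrow> cmod w \<le> C \<Longrightarrow> cmod w' \<le> C \<Longrightarrow>
      cmod (G z w - G z' w') \<le> L * (cmod (z - z') + cmod (w - w'))"
    and G_shift: "\<And>z w s. G (z + of_real s) w = G z w"
begin

definition sol :: "(complex \<Rightarrow> complex) set" where
  "sol = {U. (\<exists>Ux Uy. has_partials U Ux Uy \<and> (\<forall>z. Ux z + \<i> * Uy z = G z (U z))) \<and>
     (\<forall>z. U (z + \<i>) = U z) \<and> (\<forall>z. cmod (U z) \<le> C)}"

lemma solE: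
  assumes "U \<in> sol"
  obtains Ux Uy where "has_partials U Ux Uy" "\<And>z. Ux z + \<i> * Uy z = G z (U z)"
    "\<And>z. U (z + \<i>) = U z" "\<And>z. cmod (U z) \<le> C"
  using assms by (auto simp: sol_def)

lemma sol_periodic: "U \<in> sol \<Longrightarrow> U (z + \<i>) = U z"
  and sol_bound: "U \<in> sol \<Longrightarrow> cmod (U z) \<le> C"
  by (auto simp: sol_def)

lemma sol_continuous: "U \<in> sol \<Longrightarrow> continuous_on S U"
  by (auto elim!: solE intro: has_partials_continuous)

definition shift :: "real \<Rightarrow> (complex \<Rightarrow> complex) \<Rightarrow> complex \<Rightarrow> complex" where
  "shift \<sigma> U = (\<lambda>z. U (z + of_real \<sigma>))"

lemma shift_sol: "U \<in> sol \<Longrightarrow> shift \<sigma> U \<in> sol"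
proof (erule solE)
  fix Ux Uy assume U: "has_partials U Ux Uy" "\<And>z. Ux z + \<i> * Uy z = G z (U z)"
    "\<And>z. U (z + \<i>) = U z" "\<And>z. cmod (U z) \<le> C"
  have "U (z + \<i> + of_real \<sigma>) = U (z + of_real \<sigma>)" for z
    using U(3)[of "z + of_real \<sigma>"] by (simp add: algebra_simps)
  moreover have "\<exists>Vx Vy. has_partials (\<lambda>z. U (z + of_real \<sigma>)) Vx Vy \<and> (\<forall>z. Vx z + \<i> * Vy z = G z (U (z + of_real \<sigma>)))"
    using has_partials_shift[OF U(1), of "of_real \<sigma>"] U(2)[of "z + of_real \<sigma>" for z] by (fastforce simp: G_shift)
  ultimately show ?thesis
    unfolding sol_def shift_def using U(4) by auto
qed

definition hconst :: real where "hconst = (6 * pot_const 2 + 1) * M"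

lemma hconst_nonneg: "hconst \<ge> 0"
  using pot_const_pos[of 2] C_le by (simp add: hconst_def)

lemma sol_holder:
  assumes U: "U \<in> sol" and z: "cmod (z - z') \<le> 1"
  shows "cmod (U z - U z') \<le> hconst * cmod (z - z') powr (3/4)"
proof -
  obtain Ux Uy where u: "has_partials U Ux Uy" "\<And>z. Ux z + \<i> * Uy z = G z (U z)"
    "\<And>z. U (z + \<i>) = U z" "\<And>z. cmod (U z) \<le> C" by (rule solE[OF U]) (rule that)
  show ?thesis unfolding hconst_def
    by (rule dbar_holder[OF u(1) _ _ z]) (use u C_le G_bound in \<open>auto intro: order_trans\<close>)
qed

lemma sol_uniform:
  assumes "\<eta> > 0"
  obtains d where "d > 0" "\<And>a z z'. a \<in> sol \<Longrightarrow> cmod (z - z') < d \<Longrightarrow> cmod (a z - a z') < \<eta>"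
proof (rule that[of "min 1 ((\<eta> / (hconst + 1)) powr (4/3))"])
  show "0 < min 1 ((\<eta> / (hconst + 1)) powr (4/3))" using assms hconst_nonneg by simp
  fix a z z' assume a: "a \<in> sol" and z: "cmod (z - z') < min 1 ((\<eta> / (hconst + 1)) powr (4/3))"
  then have "hconst * cmod (z - z') powr (3/4) < \<eta>"
    by (intro holder_modulus hconst_nonneg assms) auto
  moreover have "cmod (a z - a z') \<le> hconst * cmod (z - z') powr (3/4)"
    by (rule sol_holder[OF a]) (use z in simp)
  ultimately show "cmod (a z - a z') < \<eta>" by simp
qed

text \<open>As multiples of |h|^(3/4), \<open>hconst\<close> bounds the increment U (z + h) - U z
  and \<open>L * (1 + hconst)\<close> its Cauchy-Riemann operator; the outer factor is the constant
  of \<open>dbar_holder\<close>.\<close>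

definition hconst2 :: real where "hconst2 = (6 * pot_const 2 + 1) * (hconst + L * (1 + hconst))"

lemma sol_second_difference:
  assumes U: "U \<in> sol" and h: "cmod h \<le> 1"
  shows "cmod (U (z + h + h) - 2 * U (z + h) + U z) \<le> hconst2 * cmod h powr (3/2)"
proof -
  obtain Ux Uy where u: "has_partials U Ux Uy" "\<And>z. Ux z + \<i> * Uy z = G z (U z)"
    "\<And>z. U (z + \<i>) = U z" "\<And>z. cmod (U z) \<le> C" by (rule solE[OF U]) (rule that)
  let ?h = "cmod h powr (3/4)"
  \<comment> \<open>The variation of G in its first argument is of order |h|, which is absorbed into
    |h|^(3/4).\<close>
  have hh: "cmod h \<le> ?h"
  proof (cases "h = 0")
    case False
    then have "cmod h powr 1 \<le> ?h" using h by (intro powr_mono') auto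
    then show ?thesis using False by simp
  qed simp
  have w: "cmod (U (z + h) - U z) \<le> hconst * ?h" for z
    using sol_holder[OF U, of "z + h" z] h by simp
  have g: "cmod (G (z + h) (U (z + h)) - G z (U z)) \<le> L * (1 + hconst) * ?h" for z
  proof -
    have "cmod (G (z + h) (U (z + h)) - G z (U z)) \<le> L * (cmod h + cmod (U (z + h) - U z))"
      using G_lip[of "z + h" z "U (z + h)" "U z"] h u(4) by simp
    also have "\<dots> \<le> L * (?h + hconst * ?h)"
      by (intro mult_left_mono add_mono hh w L_nonneg)
    finally show ?thesis by (simp add: algebra_simps)
  qed
  have 1: "hconst * ?h \<le> (hconst + L * (1 + hconst)) * ?h" "L * (1 + hconst) * ?h \<le> (hconst + L * (1 + hconst)) * ?h"
    using hconst_nonneg L_nonneg by (auto intro!: mult_right_mono)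
  have "cmod ((U (z + h + h) - U (z + h)) - (U (z + h) - U z)) \<le>
     (6 * pot_const 2 + 1) * ((hconst + L * (1 + hconst)) * ?h) * cmod (z + h - z) powr (3/4)"
  proof (rule dbar_holder[OF has_partials_diff[OF has_partials_shift[OF u(1), of h] u(1)]])
    show "cmod (U (w + h) - U w) \<le> (hconst + L * (1 + hconst)) * ?h" for w
      using w[of w] 1 by linarith
    have "Ux (w + h) - Ux w + \<i> * (Uy (w + h) - Uy w) = G (w + h) (U (w + h)) - G w (U w)" for w
      using u(2)[of "w + h"] u(2)[of w] by (simp add: algebra_simps)
    then show "cmod (Ux (w + h) - Ux w + \<i> * (Uy (w + h) - Uy w)) \<le> (hconst + L * (1 + hconst)) * ?h" for w
      using g[of w] 1 by simp
  qed (use h in simp)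
  also have "\<dots> = hconst2 * (?h * ?h)" by (simp add: hconst2_def)
  also have "?h * ?h = cmod h powr (3/2)" using powr_add[of "cmod h" "3/4" "3/4"] by simp
  finally show ?thesis by (simp add: algebra_simps)
qed

lemma hconst2_nonneg: "hconst2 \<ge> 0"
  using pot_const_pos[of 2] hconst_nonneg L_nonneg by (simp add: hconst2_def)

text \<open>The tail from index j of the geometric series with ratio sqrt (1/2) that dominates the
  steps in \<open>dyadic_quotient_step\<close>.\<close>

definition rate :: "nat \<Rightarrow> real" where "rate j = hconst2 * sqrt (1/2) ^ j / (1 - sqrt (1/2))"

lemma sqrt_half: "0 < sqrt (1/2)" "sqrt (1/2) < 1"
  using real_sqrt_less_mono[of "1/2" 1] by simp_all

lemma sqrt_half_le: "sqrt (1/2) \<le> (2 :: real)"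
  using sqrt_half(2) by linarith

lemma rate_tendsto: "rate \<longlonglongrightarrow> 0"
proof -
  have "(\<lambda>j. hconst2 * sqrt (1/2) ^ j / (1 - sqrt (1/2))) \<longlonglongrightarrow> hconst2 * 0 / (1 - sqrt (1/2))"
    using sqrt_half by (intro tendsto_divide tendsto_mult tendsto_const LIMSEQ_realpow_zero) auto
  then show ?thesis by (simp add: rate_def[abs_def])
qed

text \<open>The factor 2^j meets a second difference with step 2^(-j-1), of order 2^(-3(j+1)/2);
  what remains decays like 2^(-j/2).\<close>

lemma dyadic_quotient_step:
  assumes U: "U \<in> sol" and e: "cmod e = 1"
  shows "cmod (dyadic_quotient U e j z - dyadic_quotient U e (Suc j) z) \<le> hconst2 * sqrt (1/2) ^ j"
proof -
  define h where "h = of_real ((1/2) ^ Suc j) * e"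
  have nh: "cmod h = (1/2) ^ Suc j" using e by (simp add: h_def norm_mult norm_power)
  have h1: "cmod h \<le> 1" unfolding nh by (rule power_le_one) auto
  have "z + of_real ((1/2) ^ j) * e = z + h + h" by (simp add: h_def)
  then have "dyadic_quotient U e j z - dyadic_quotient U e (Suc j) z = 2 ^ j * (U (z + h + h) - 2 * U (z + h) + U z)"
    unfolding dyadic_quotient_def h_def[symmetric] by (simp add: algebra_simps)
  then have "cmod (dyadic_quotient U e j z - dyadic_quotient U e (Suc j) z) =
      2 ^ j * cmod (U (z + h + h) - 2 * U (z + h) + U z)"
    by (simp add: norm_mult norm_power)
  also have "\<dots> \<le> 2 ^ j * (hconst2 * cmod h powr (3/2))"
    by (intro mult_left_mono sol_second_difference U h1) auto
  also have "cmod h powr (3/2) = cmod h powr 1 * cmod h powr (1/2)"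
    using powr_add[of "cmod h" 1 "1/2"] by simp
  also have "\<dots> = (1/2) ^ Suc j * sqrt (1/2) ^ Suc j"
    unfolding nh using powr_half_sqrt[of "(1/2) ^ Suc j"] real_sqrt_power[of "1/2" "Suc j"]
    by (simp del: power_Suc)
  also have "2 ^ j * (hconst2 * ((1/2) ^ Suc j * sqrt (1/2) ^ Suc j)) = hconst2 * sqrt (1/2) ^ j * (sqrt (1/2) / 2)"
    by (simp add: power_one_over)
  also have "\<dots> \<le> hconst2 * sqrt (1/2) ^ j * 1"
    using sqrt_half_le hconst2_nonneg by (intro mult_left_mono) auto
  finally show ?thesis by simp
qed

lemma dyadic_quotient_rate:
  assumes U: "U \<in> sol" and p: "has_partials U Ux Uy" and e: "cmod e = 1"
  shows "cmod (dyadic_quotient U e j z - unit_partial e Ux Uy z) \<le> rate j"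
proof -
  let ?r = "sqrt (1/2) :: real"
  have step: "cmod (dyadic_quotient U e j z - dyadic_quotient U e (j + m) z) \<le> hconst2 * (?r ^ j * (1 - ?r ^ m) / (1 - ?r))" for m
  proof (induction m)
    case (Suc m)
    have "cmod (dyadic_quotient U e j z - dyadic_quotient U e (j + Suc m) z) \<le>
       hconst2 * (?r ^ j * (1 - ?r ^ m) / (1 - ?r)) + hconst2 * ?r ^ (j + m)"
      using norm_triangle_ineq[of "dyadic_quotient U e j z - dyadic_quotient U e (j + m) z"
          "dyadic_quotient U e (j + m) z - dyadic_quotient U e (Suc (j + m)) z"]
        Suc dyadic_quotient_step[OF U e, of "j + m" z] by simp
    also have "\<dots> = hconst2 * (?r ^ j * (1 - ?r ^ m) / (1 - ?r) + ?r ^ (j + m))" by (simp add: distrib_left)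
    also have "?r ^ j * (1 - ?r ^ m) / (1 - ?r) + ?r ^ (j + m) = ?r ^ j * (1 - ?r ^ Suc m) / (1 - ?r)"
    proof -
      have gen: "x * (1 - y) / (1 - r) + x * y = x * (1 - r * y) / (1 - r)" if "r < 1" for x y r :: real
        using that by (simp add: field_simps)
      show ?thesis using gen[OF sqrt_half(2), of "?r ^ j" "?r ^ m"] by (simp only: power_add power_Suc)
    qed
    finally show ?case .
  qed simp
  have le: "cmod (dyadic_quotient U e j z - dyadic_quotient U e (j + m) z) \<le> rate j" for m
  proof -
    have "?r ^ j * (1 - ?r ^ m) / (1 - ?r) \<le> ?r ^ j * 1 / (1 - ?r)"
      using sqrt_half by (intro divide_right_mono mult_left_mono) auto
    then have "hconst2 * (?r ^ j * (1 - ?r ^ m) / (1 - ?r)) \<le> hconst2 * (?r ^ j * 1 / (1 - ?r))"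
      by (rule mult_left_mono[OF _ hconst2_nonneg])
    then show ?thesis using step[of m] by (simp add: rate_def)
  qed
  have "(\<lambda>m. dyadic_quotient U e (m + j) z) \<longlonglongrightarrow> unit_partial e Ux Uy z"
    by (rule LIMSEQ_ignore_initial_segment[OF dyadic_quotient_tendsto[OF p e]])
  then have "(\<lambda>m. cmod (dyadic_quotient U e j z - dyadic_quotient U e (j + m) z)) \<longlonglongrightarrow> cmod (dyadic_quotient U e j z - unit_partial e Ux Uy z)"
    by (intro tendsto_intros) (simp add: add.commute)
  then show ?thesis by (rule Lim_bounded[where M = 0]) (use le in auto)
qed

text \<open>For fixed j the difference quotients converge along with f, and \<open>rate j\<close>
  bounds their distance to the derivative for all solutions at once. Locally uniform convergence of
  solutions therefore forces that of the derivatives.\<close>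

lemma unit_partial_limit:
  assumes f: "\<And>n. f n \<in> sol" "\<And>n. has_partials (f n) (fx n) (fy n)" and lim: "lconv f U" and e: "cmod e = 1"
  obtains Ue where "\<And>R. uniform_limit (sq R) (\<lambda>n. unit_partial e (fx n) (fy n)) Ue sequentially"
proof -
  have "uniformly_Cauchy_on (sq R) (\<lambda>n. unit_partial e (fx n) (fy n))" for R
  proof (rule uniformly_Cauchy_onI)
    fix d :: real assume d: "d > 0"
    then have "\<forall>\<^sub>F j in sequentially. rate j < d / 3" by (intro order_tendstoD(2)[OF rate_tendsto]) auto
    then obtain j where j: "rate j < d / 3" by (auto simp: eventually_sequentially)
    have "uniformly_Cauchy_on (sq R) (\<lambda>n. dyadic_quotient (f n) e j)"
      by (rule uniformly_convergent_Cauchy[OF uniformly_convergentI[OF uniform_limit_dyadic_quotient[OF lim]]])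
    then obtain N where N: "\<And>m n z. m \<ge> N \<Longrightarrow> n \<ge> N \<Longrightarrow> z \<in> sq R \<Longrightarrow>
        dist (dyadic_quotient (f m) e j z) (dyadic_quotient (f n) e j z) < d / 3"
      unfolding uniformly_Cauchy_on_def using d by (metis zero_less_divide_iff zero_less_numeral)
    show "\<exists>N. \<forall>x\<in>sq R. \<forall>m\<ge>N. \<forall>n\<ge>N. dist (unit_partial e (fx m) (fy m) x) (unit_partial e (fx n) (fy n) x) < d"
    proof (intro exI ballI allI impI)
      fix z m n assume *: "z \<in> sq R" "m \<ge> N" "n \<ge> N"
      have "dist (dyadic_quotient (f k) e j z) (unit_partial e (fx k) (fy k) z) \<le> rate j" for k
        unfolding dist_norm by (rule dyadic_quotient_rate[OF f e])
      from this[of m] this[of n] N[OF *(2,3,1)] j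
      show "dist (unit_partial e (fx m) (fy m) z) (unit_partial e (fx n) (fy n) z) < d"
        by metric
    qed
  qed
  then have c: "uniformly_convergent_on (sq R) (\<lambda>n. unit_partial e (fx n) (fy n))" for R
    by (rule Cauchy_uniformly_convergent)
  show ?thesis
    by (rule that) (rule uniformly_convergent_uniform_limit_iff[THEN iffD1, OF c])
qed

text \<open>Both partial derivatives converge locally uniformly, so the limit is differentiable with
  the limiting derivatives, and the equation passes to the limit pointwise.\<close>

lemma sol_closed:
  assumes f: "\<And>n. f n \<in> sol" and lim: "lconv f U"
  shows "U \<in> sol"
proof -
  have "\<exists>fx fy. has_partials (f n) fx fy \<and> (\<forall>z. fx z + \<i> * fy z = G z (f n z))" for n
    using f[of n] by (auto simp: sol_def)
  then obtain fx fy where p: "\<And>n. has_partials (f n) (fx n) (fy n)"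
    and eq: "\<And>n z. fx n z + \<i> * fy n z = G z (f n z)"
    by metis
  have u: "unit_partial 1 a b = a" "unit_partial \<i> a b = b" for a b
    by (auto simp: unit_partial_def)
  obtain Ux where Ux: "\<And>R. uniform_limit (sq R) fx Ux sequentially"
    using unit_partial_limit[OF f p lim, of 1] unfolding u by auto
  obtain Uy where Uy: "\<And>R. uniform_limit (sq R) fy Uy sequentially"
    using unit_partial_limit[OF f p lim, of \<i>] unfolding u by auto
  have cont: "continuous_on UNIV V" if "\<And>R. uniform_limit (sq R) v V sequentially" "\<And>n. continuous_on UNIV (v n)" for v V
  proof -
    have "isCont V z" for z
    proof -
      have "continuous_on (sq (cmod z + 1)) V"
        by (rule uniform_limit_theorem[OF always_eventually that(1)])
          (auto intro: continuous_on_subset[OF that(2)])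
      moreover have "ball z 1 \<subseteq> sq (cmod z + 1)"
      proof
        fix w assume "w \<in> ball z 1"
        then have "cmod w \<le> cmod z + 1" using norm_triangle_sub[of w z] by (simp add: dist_norm norm_minus_commute)
        then show "w \<in> sq (cmod z + 1)" by (rule in_sq_cmod)
      qed
      ultimately have "continuous_on (ball z 1) V" by (rule continuous_on_subset)
      then show ?thesis by (auto intro: continuous_on_interior)
    qed
    then show ?thesis by (simp add: continuous_at_imp_continuous_on)
  qed
  have pw: "(\<lambda>n. v n z) \<longlonglongrightarrow> V z" if "\<And>R. uniform_limit (sq R) v V sequentially"
    for v :: "nat \<Rightarrow> complex \<Rightarrow> complex" and V z
    by (rule lconv_pointwise) (simp add: lconv_def that)
  have hp: "has_partials U Ux Uy"
  proof (rule has_partialsI)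
    show "continuous_on UNIV Ux" by (rule cont[OF Ux has_partials_continuous_x[OF p]])
    show "continuous_on UNIV Uy" by (rule cont[OF Uy has_partials_continuous_y[OF p]])
    fix z
    let ?S = "ball z 1" and ?R = "cmod z + 1"
    have sub: "w \<in> sq ?R" if "w \<in> ?S" for w
    proof -
      have "cmod w \<le> cmod z + 1" using that norm_triangle_sub[of w z] by (simp add: dist_norm norm_minus_commute)
      then show ?thesis by (rule in_sq_cmod)
    qed
    have "\<exists>g. \<forall>x\<in>?S. (\<lambda>n. f n x) \<longlonglongrightarrow> g x \<and>
      (g has_derivative (\<lambda>h. of_real (Re h) * Ux x + of_real (Im h) * Uy x)) (at x within ?S)"
    proof (rule has_derivative_sequence[OF _ has_partials_derivative[OF p]])
      fix d :: real assume d: "d > 0"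
      then have "\<forall>\<^sub>F n in sequentially. \<forall>x\<in>sq ?R. dist (fx n x) (Ux x) < d / 2"
        "\<forall>\<^sub>F n in sequentially. \<forall>x\<in>sq ?R. dist (fy n x) (Uy x) < d / 2"
        using uniform_limitD[OF Ux[of ?R], of "d / 2"] uniform_limitD[OF Uy[of ?R], of "d / 2"] by auto
      then show "\<forall>\<^sub>F n in sequentially. \<forall>x\<in>?S. \<forall>h. norm ((of_real (Re h) * fx n x + of_real (Im h) * fy n x) -
          (of_real (Re h) * Ux x + of_real (Im h) * Uy x)) \<le> d * norm h"
      proof eventually_elim
        case (elim n)
        show ?case
        proof (intro ballI allI)
          fix x h assume "x \<in> ?S"
          then have x: "cmod (fx n x - Ux x) \<le> d / 2" "cmod (fy n x - Uy x) \<le> d / 2"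
            using elim sub by (auto simp: dist_norm less_imp_le)
          have "(of_real (Re h) * fx n x + of_real (Im h) * fy n x) - (of_real (Re h) * Ux x + of_real (Im h) * Uy x)
            = of_real (Re h) * (fx n x - Ux x) + of_real (Im h) * (fy n x - Uy x)" by (simp add: algebra_simps)
          also have "norm \<dots> \<le> norm h * (d / 2) + norm h * (d / 2)"
            by (intro order_trans[OF norm_triangle_ineq] add_mono; simp only: norm_mult norm_of_real;
                intro mult_mono x abs_Re_le_cmod abs_Im_le_cmod) auto
          finally show "norm ((of_real (Re h) * fx n x + of_real (Im h) * fy n x) -
            (of_real (Re h) * Ux x + of_real (Im h) * Uy x)) \<le> d * norm h" by (simp add: mult.commute)
        qed
      qed
    next
      show "(\<lambda>n. f n z) \<longlonglongrightarrow> U z" by (rule lconv_pointwise[OF lim])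
    qed auto
    then obtain g where g: "\<And>x. x \<in> ?S \<Longrightarrow> (\<lambda>n. f n x) \<longlonglongrightarrow> g x"
      "\<And>x. x \<in> ?S \<Longrightarrow> (g has_derivative (\<lambda>h. of_real (Re h) * Ux x + of_real (Im h) * Uy x)) (at x within ?S)"
      by blast
    have gU: "g x = U x" if "x \<in> ?S" for x
      using LIMSEQ_unique[OF g(1)[OF that] lconv_pointwise[OF lim]] .
    have "(g has_derivative (\<lambda>h. of_real (Re h) * Ux z + of_real (Im h) * Uy z)) (at z)"
      using g(2)[of z] by (simp add: at_within_open[of z ?S])
    then show "(U has_derivative (\<lambda>h. of_real (Re h) * Ux z + of_real (Im h) * Uy z)) (at z)"
      by (rule has_derivative_transform_within_open[of _ _ _ _ ?S]) (auto simp: gU)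
  qed
  have bd: "cmod (U z) \<le> C" for z
    by (rule Lim_bounded[where M = 0, OF tendsto_norm[OF lconv_pointwise[OF lim]]]) (simp add: sol_bound[OF f])
  have "Ux z + \<i> * Uy z = G z (U z)" for z
  proof -
    have "(\<lambda>n. fx n z + \<i> * fy n z) \<longlonglongrightarrow> Ux z + \<i> * Uy z"
      by (intro tendsto_intros pw Ux Uy)
    moreover have "(\<lambda>n. G z (f n z)) \<longlonglongrightarrow> G z (U z)"
    proof (rule LIM_zero_cancel, rule Lim_null_comparison[OF always_eventually], rule allI)
      show "norm (G z (f n z) - G z (U z)) \<le> L * (0 + cmod (f n z - U z))" for n
        using G_lip[of z z "f n z" "U z"] sol_bound[OF f] bd by simp
      have "(\<lambda>n. L * (0 + cmod (f n z - U z))) \<longlonglongrightarrow> L * (0 + cmod (U z - U z))"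
        by (intro tendsto_intros lconv_pointwise[OF lim])
      then show "(\<lambda>n. L * (0 + cmod (f n z - U z))) \<longlonglongrightarrow> 0" by simp
    qed
    ultimately show ?thesis unfolding eq by (rule LIMSEQ_unique)
  qed
  moreover have "U (z + \<i>) = U z" for z
    by (rule LIMSEQ_unique[OF lconv_pointwise[OF lim]]) (simp add: sol_periodic[OF f] lconv_pointwise[OF lim])
  ultimately show ?thesis unfolding sol_def using hp bd by blast
qed

lemma sol_compact:
  assumes f: "\<And>n. f n \<in> sol"
  obtains k U where "strict_mono (k :: nat \<Rightarrow> nat)" "U \<in> sol" "lconv (\<lambda>n. f (k n)) U"
proof -
  define P where "P i r \<longleftrightarrow> (\<exists>g. uniform_limit (sq (real i)) (\<lambda>n. f (r n)) g sequentially)"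
    for i :: nat and r :: "nat \<Rightarrow> nat"
  \<comment> \<open>One subsequence for all squares: Arzela-Ascoli on \<open>sq i\<close>, then
    diagonalisation over i.\<close>
  obtain k :: "nat \<Rightarrow> nat" where k: "strict_mono k" "\<And>i. P i (id \<circ> k)"
  proof (rule subsequence_diagonalization_lemma[of P id])
    fix i and r :: "nat \<Rightarrow> nat"
    show "\<exists>k. strict_mono (k :: nat \<Rightarrow> nat) \<and> P i (r \<circ> k)"
    proof -
      obtain g k where k: "strict_mono (k :: nat \<Rightarrow> nat)"
        and g: "\<And>e. 0 < e \<Longrightarrow> \<exists>N. \<forall>n x. n \<ge> N \<and> x \<in> sq (real i) \<longrightarrow> norm (f (r (k n)) x - g x) < e"
      proof (rule Arzela_Ascoli[of "sq (real i)" "\<lambda>n. f (r n)" C])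
        show "\<exists>d>0. \<forall>n y. y \<in> sq (real i) \<and> norm (x - y) < d \<longrightarrow> norm (f (r n) x - f (r n) y) < e" if e: "0 < e" for x e
        proof -
          obtain d where "d > 0" "\<And>a z z'. a \<in> sol \<Longrightarrow> cmod (z - z') < d \<Longrightarrow> cmod (a z - a z') < e"
            by (rule sol_uniform[OF e]) (rule that)
          then show ?thesis using f by blast
        qed
      qed (use sol_bound[OF f] in auto)
      have "uniform_limit (sq (real i)) (\<lambda>n. f ((r \<circ> k) n)) g sequentially"
      proof (rule uniform_limitI)
        fix e :: real assume "e > 0"
        from g[OF this] show "\<forall>\<^sub>F n in sequentially. \<forall>x\<in>sq (real i). dist (f ((r \<circ> k) n) x) (g x) < e"
          unfolding eventually_sequentially dist_norm o_def by blast
      qed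
      then show ?thesis using k by (auto simp: P_def)
    qed
  next
    fix i N and r :: "nat \<Rightarrow> nat" and k1 k2 :: "nat \<Rightarrow> nat"
    assume P1: "P i (r \<circ> k1)" and k: "\<And>j. N \<le> j \<Longrightarrow> \<exists>j'. j \<le> j' \<and> k2 j = k1 j'"
    obtain g where g: "uniform_limit (sq (real i)) (\<lambda>n. f (r (k1 n))) g sequentially"
      using P1 by (auto simp: P_def)
    have "uniform_limit (sq (real i)) (\<lambda>n. f (r (k2 n))) g sequentially"
    proof (rule uniform_limitI)
      fix e :: real assume "e > 0"
      from uniform_limitD[OF g this] obtain N' where N': "\<And>n. n \<ge> N' \<Longrightarrow> \<forall>x\<in>sq (real i). dist (f (r (k1 n)) x) (g x) < e"
        by (auto simp: eventually_sequentially)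
      show "\<forall>\<^sub>F n in sequentially. \<forall>x\<in>sq (real i). dist (f (r (k2 n)) x) (g x) < e"
        unfolding eventually_sequentially
      proof (intro exI allI impI)
        fix n assume n: "max N N' \<le> n"
        then obtain j' where "n \<le> j'" "k2 n = k1 j'" using k[of n] by auto
        then show "\<forall>x\<in>sq (real i). dist (f (r (k2 n)) x) (g x) < e" using N'[of j'] n by simp
      qed
    qed
    then show "P i (r \<circ> k2)" by (auto simp: P_def)
  qed (rule that)
  have "\<exists>g. uniform_limit (sq (real i)) (\<lambda>n. f (k n)) g sequentially" for i
    using k(2)[of i] by (simp add: P_def)
  then obtain g where g: "\<And>i. uniform_limit (sq (real i)) (\<lambda>n. f (k n)) (g i) sequentially" by metis
  \<comment> \<open>The limits on the different squares agree on overlaps, each being the pointwise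
    limit.\<close>
  define U where "U z = lim (\<lambda>n. f (k n) z)" for z
  have gU: "g i z = U z" if "z \<in> sq (real i)" for i z
    using tendsto_uniform_limitI[OF g that] unfolding U_def by (simp add: limI)
  have lim: "lconv (\<lambda>n. f (k n)) U"
    unfolding lconv_def
  proof
    fix R :: real
    obtain i :: nat where i: "R \<le> real i" using real_arch_simple by blast
    have "uniform_limit (sq (real i)) (\<lambda>n. f (k n)) U sequentially"
      using g[of i] by (rule uniform_limit_cong'[THEN iffD1, rotated 2]) (auto simp: gU)
    then show "uniform_limit (sq R) (\<lambda>n. f (k n)) U sequentially"
      by (rule uniform_limit_on_subset) (use i in \<open>auto simp: sq_def\<close>)
  qed
  show ?thesis by (rule that[OF k(1) sol_closed[OF f lim] lim])
qed

end

section \<open>Pairs of points in an omega-limit set\<close>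

context cr_system
begin

definition apart :: "(complex \<Rightarrow> complex) \<Rightarrow> (complex \<Rightarrow> complex) \<Rightarrow> real \<Rightarrow> bool" where
  "apart a b s \<longleftrightarrow> (\<forall>t. a (Complex s t) \<noteq> b (Complex s t))"

definition W :: "(complex \<Rightarrow> complex) \<Rightarrow> (complex \<Rightarrow> complex) \<Rightarrow> real \<Rightarrow> real" where
  "W a b s = wind (\<lambda>z. a z - b z) s"

lemma sol_cr_difference:
  assumes a: "a \<in> sol" and b: "b \<in> sol" and ne: "a \<noteq> b"
  obtains Dx Dy where "cr_difference (\<lambda>z. a z - b z) Dx Dy L"
proof -
  obtain ax ay where A: "has_partials a ax ay" "\<And>z. ax z + \<i> * ay z = G z (a z)"
    "\<And>z. a (z + \<i>) = a z" "\<And>z. cmod (a z) \<le> C" by (rule solE[OF a]) (rule that)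
  obtain bx by' where B: "has_partials b bx by'" "\<And>z. bx z + \<i> * by' z = G z (b z)"
    "\<And>z. b (z + \<i>) = b z" "\<And>z. cmod (b z) \<le> C" by (rule solE[OF b]) (rule that)
  show ?thesis
  proof (rule that, unfold_locales)
    show "has_partials (\<lambda>z. a z - b z) (\<lambda>z. ax z - bx z) (\<lambda>z. ay z - by' z)"
      by (rule has_partials_diff[OF A(1) B(1)])
    show "cmod (ax z - bx z + \<i> * (ay z - by' z)) \<le> L * cmod (a z - b z)" for z
    proof -
      have "ax z - bx z + \<i> * (ay z - by' z) = G z (a z) - G z (b z)"
        using A(2)[of z] B(2)[of z] by (simp add: algebra_simps)
      then show ?thesis using G_lip[of z z "a z" "b z"] A(4) B(4) by simp
    qed
    show "a (z + \<i>) - b (z + \<i>) = a z - b z" for z by (simp add: A(3) B(3))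
    show "\<exists>z. a z - b z \<noteq> 0" using ne by auto
  qed
qed

lemma apart_ne: "apart a b s \<Longrightarrow> a \<noteq> b"
  by (auto simp: apart_def)

lemma W_mono:
  assumes ab: "a \<in> sol" "b \<in> sol" and s: "s1 \<le> s2" and ap: "apart a b s1" "apart a b s2"
  shows "W a b s1 \<le> W a b s2"
proof (cases "s1 = s2")
  case False
  obtain Dx Dy where "cr_difference (\<lambda>z. a z - b z) Dx Dy L"
    using sol_cr_difference[OF ab apart_ne[OF ap(1)]] by blast
  then interpret cr_difference "\<lambda>z. a z - b z" Dx Dy L .
  show ?thesis unfolding W_def
    by (rule wind_increase(1)) (use False s ap in \<open>auto simp: apart_def\<close>)
qed simp

lemma W_strict:
  assumes ab: "a \<in> sol" "b \<in> sol" and s: "s1 < s" "s < s2" and ap: "apart a b s1" "apart a b s2"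
    and na: "\<not> apart a b s"
  shows "W a b s1 < W a b s2"
proof -
  obtain Dx Dy where "cr_difference (\<lambda>z. a z - b z) Dx Dy L"
    using sol_cr_difference[OF ab apart_ne[OF ap(1)]] by blast
  then interpret cr_difference "\<lambda>z. a z - b z" Dx Dy L .
  obtain t where "a (Complex s t) - b (Complex s t) = 0" using na by (auto simp: apart_def)
  then show ?thesis unfolding W_def
    by (intro wind_increase(2)[of s1 s2 s t]) (use s ap in \<open>auto simp: apart_def\<close>)
qed

lemma apart_dense:
  assumes ab: "a \<in> sol" "b \<in> sol" and ne: "a \<noteq> b"
  obtains \<epsilon> where "0 < \<epsilon>" "apart a b (s - \<epsilon>)" "apart a b (s + \<epsilon>)"
proof -
  obtain Dx Dy where "cr_difference (\<lambda>z. a z - b z) Dx Dy L"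
    using sol_cr_difference[OF ab ne] by blast
  then interpret cr_difference "\<lambda>z. a z - b z" Dx Dy L .
  show ?thesis
    by (rule nonzero_circles_dense[of 1 s]) (auto simp: apart_def intro: that)
qed

lemma sol_periodic_frac:
  assumes "a \<in> sol"
  shows "a (Complex s t) = a (Complex s (frac t))"
  using periodic_int[of a, OF sol_periodic[OF assms], of s "frac t" "\<lfloor>t\<rfloor>"] by (simp add: frac_def)

lemma path_diff:
  assumes "a \<in> sol" "b \<in> sol"
  shows "path (\<lambda>t. a (Complex s t) - b (Complex s t))"
  using path_circle[of "\<lambda>z. a z - b z" s 0] assms by (simp add: continuous_on_diff sol_continuous)

lemma loop_diff:
  assumes "a \<in> sol" "b \<in> sol"
  shows "a (Complex s 1) - b (Complex s 1) = a (Complex s 0) - b (Complex s 0)"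
  using sol_periodic_frac[OF assms(1), of s 1] sol_periodic_frac[OF assms(2), of s 1] by simp

text \<open>Closeness on one circle is all that is asked for, since \<open>W\<close> at s depends
  only on the values there.\<close>

definition near :: "real \<Rightarrow> real \<Rightarrow> (complex \<Rightarrow> complex) \<Rightarrow> (complex \<Rightarrow> complex) \<Rightarrow> bool" where
  "near \<eta> s a b \<longleftrightarrow> (\<forall>t\<in>{0..1}. cmod (a (Complex s t) - b (Complex s t)) < \<eta>)"

text \<open>With \<eta> half the least distance of a and b on the circle, perturbing both changes
  the difference by less than its modulus; nearby loops of this kind have equal winding
  numbers.\<close>

lemma W_stable:
  assumes ab: "a \<in> sol" "b \<in> sol" and ap: "apart a b s"
  obtains \<eta> where "\<eta> > 0"
    "\<And>a' b'. a' \<in> sol \<Longrightarrow> b' \<in> sol \<Longrightarrow> near \<eta> s a' a \<Longrightarrow> near \<eta> s b' b \<Longrightarrow>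
      apart a' b' s \<and> W a' b' s = W a b s"
proof -
  have "compact ((\<lambda>t. cmod (a (Complex s t) - b (Complex s t))) ` {0..1})"
    using path_diff[OF ab, of s] unfolding path_def
    by (intro compact_continuous_image continuous_on_norm) auto
  then obtain t0 where t0: "\<And>t. t \<in> {0..1} \<Longrightarrow> cmod (a (Complex s t0) - b (Complex s t0)) \<le> cmod (a (Complex s t) - b (Complex s t))"
    using compact_attains_inf[of "(\<lambda>t. cmod (a (Complex s t) - b (Complex s t))) ` {0..1}"] by fastforce
  define \<eta> where "\<eta> = cmod (a (Complex s t0) - b (Complex s t0)) / 2"
  have \<eta>: "\<eta> > 0" using ap by (simp add: \<eta>_def apart_def)
  show ?thesis
  proof (rule that[OF \<eta>])
    fix a' b' assume ab': "a' \<in> sol" "b' \<in> sol"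
      and cl: "near \<eta> s a' a" "near \<eta> s b' b"
    have cl: "cmod ((a' (Complex s t) - b' (Complex s t)) - (a (Complex s t) - b (Complex s t))) <
        cmod ((a (Complex s t) - b (Complex s t)) - 0)" if t: "t \<in> {0..1}" for t
    proof -
      have "(a' (Complex s t) - b' (Complex s t)) - (a (Complex s t) - b (Complex s t)) =
          (a' (Complex s t) - a (Complex s t)) - (b' (Complex s t) - b (Complex s t))" by simp
      also have "cmod ((a' (Complex s t) - a (Complex s t)) - (b' (Complex s t) - b (Complex s t))) \<le>
          cmod (a' (Complex s t) - a (Complex s t)) + cmod (b' (Complex s t) - b (Complex s t))"
        by (rule norm_triangle_ineq4)
      also have "\<dots> < \<eta> + \<eta>" using cl t by (intro add_strict_mono) (auto simp: near_def)
      also have "\<dots> \<le> cmod ((a (Complex s t) - b (Complex s t)) - 0)" using t0[OF t] by (simp add: \<eta>_def)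
      finally show ?thesis .
    qed
    have "apart a' b' s"
      unfolding apart_def
    proof (intro allI notI)
      fix t assume "a' (Complex s t) = b' (Complex s t)"
      then have "a' (Complex s (frac t)) = b' (Complex s (frac t))"
        using sol_periodic_frac ab' by metis
      moreover have "frac t \<in> {0..1}" by (simp add: frac_lt_1 less_imp_le)
      ultimately show False using cl[of "frac t"] by (simp add: norm_minus_commute)
    qed
    moreover have "W a' b' s = W a b s"
      unfolding W_def wind_def
      by (rule arg_cong[where f = Re], rule winding_number_nearby_loops_eq[OF path_diff[OF ab] path_diff[OF ab']])
        (use loop_diff[OF ab, of s] loop_diff[OF ab', of s] cl in \<open>auto simp: pathfinish_def pathstart_def\<close>)
    ultimately show "apart a' b' s \<and> W a' b' s = W a b s" by simp
  qed
qed

lemma lconv_close: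
  assumes "lconv f g" "\<eta> > 0"
  shows "\<forall>\<^sub>F n in sequentially. near \<eta> s (f n) g"
proof -
  have "uniform_limit (sq (\<bar>s\<bar> + 1)) f g sequentially" using assms by (simp add: lconv_def)
  from uniform_limitD[OF this assms(2)] show ?thesis
    by eventually_elim (auto simp: dist_norm sq_def near_def)
qed

lemma W_lconv:
  assumes sol: "\<And>n. f n \<in> sol" "\<And>n. g n \<in> sol" "a \<in> sol" "b \<in> sol"
    and lim: "lconv f a" "lconv g b" and ap: "apart a b s"
  shows "\<forall>\<^sub>F n in sequentially. apart (f n) (g n) s \<and> W (f n) (g n) s = W a b s"
proof -
  obtain \<eta> where \<eta>: "\<eta> > 0" "\<And>a' b'. a' \<in> sol \<Longrightarrow> b' \<in> sol \<Longrightarrow>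
      near \<eta> s a' a \<Longrightarrow> near \<eta> s b' b \<Longrightarrow>
      apart a' b' s \<and> W a' b' s = W a b s"
    by (rule W_stable[OF sol(3,4) ap]) (rule that)
  from lconv_close[OF lim(1) \<eta>(1), of s] lconv_close[OF lim(2) \<eta>(1), of s]
  show ?thesis by eventually_elim (use \<eta>(2)[OF sol(1,2)] in blast)
qed

text \<open>A change of sign is multiplication by exp (\<pi> i), a constant exponential
  factor.\<close>

lemma W_sym:
  assumes ab: "a \<in> sol" "b \<in> sol" and ap: "apart a b s"
  shows "W b a s = W a b s"
  unfolding W_def wind_def
  by (rule arg_cong[where f = Re], rule winding_number_exp_mult[OF path_diff[OF ab], of _ "\<lambda>_. of_real pi * \<i>"])
    (use ap in \<open>auto simp: path_image_def apart_def exp_pi_i\<close>)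

section \<open>Translations in s\<close>

lemma Complex_shift: "Complex s t + of_real \<sigma> = Complex (s + \<sigma>) t"
  by (simp add: complex_eq_iff)

lemma apart_shift: "apart (shift \<sigma> a) (shift \<sigma> b) s \<longleftrightarrow> apart a b (s + \<sigma>)"
  by (simp add: apart_def shift_def Complex_shift)

lemma W_shift: "W (shift \<sigma> a) (shift \<sigma> b) s = W a b (s + \<sigma>)"
  by (simp add: W_def wind_def shift_def Complex_shift)

lemma shift_shift: "shift \<sigma> (shift \<tau> a) = shift (\<sigma> + \<tau>) a"
  by (simp add: shift_def add.assoc)

lemma shift_0 [simp]: "shift 0 a = a"
  by (simp add: shift_def)

lemma sol_uniform_shift:
  assumes "\<eta> > 0"
  obtains d where "d > 0" "\<And>a r z. a \<in> sol \<Longrightarrow> \<bar>r\<bar> < d \<Longrightarrow> cmod (a (z + of_real r) - a z) < \<eta>"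
proof -
  obtain d where d: "d > 0" "\<And>a z z'. a \<in> sol \<Longrightarrow> cmod (z - z') < d \<Longrightarrow> cmod (a z - a z') < \<eta>"
    by (rule sol_uniform[OF assms]) (rule that)
  show ?thesis by (rule that[OF d(1)]) (simp add: d(2))
qed

text \<open>The amount of translation may vary with n: convergence on a square enlarged by |\<rho>|
  + d takes care of \<open>f n\<close>, and the modulus of continuity of the limit takes care of the
  difference between \<open>r n\<close> and \<rho>.\<close>

lemma lconv_shift:
  assumes f: "\<And>n. f n \<in> sol" and lim: "lconv f g" and r: "r \<longlonglongrightarrow> \<rho>"
  shows "lconv (\<lambda>n. shift (r n) (f n)) (shift \<rho> g)"
  unfolding lconv_def
proof (intro allI uniform_limitI)
  fix R e :: real assume e: "e > 0"
  have g: "g \<in> sol" by (rule sol_closed[OF f lim])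
  obtain d where d: "d > 0" "\<And>a r z. a \<in> sol \<Longrightarrow> \<bar>r\<bar> < d \<Longrightarrow> cmod (a (z + of_real r) - a z) < e / 2"
    by (rule sol_uniform_shift[of "e / 2"]) (use e in auto)
  have "uniform_limit (sq (R + \<bar>\<rho>\<bar> + d)) f g sequentially" using lim by (simp add: lconv_def)
  from uniform_limitD[OF this, of "e / 2"] e
  have "\<forall>\<^sub>F n in sequentially. \<forall>x\<in>sq (R + \<bar>\<rho>\<bar> + d). dist (f n x) (g x) < e / 2" by simp
  moreover have "\<forall>\<^sub>F n in sequentially. dist (r n) \<rho> < d" using r d(1) by (rule tendstoD)
  ultimately show "\<forall>\<^sub>F n in sequentially. \<forall>x\<in>sq R. dist (shift (r n) (f n) x) (shift \<rho> g x) < e"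
  proof eventually_elim
    case (elim n)
    show ?case
    proof
      fix x assume x: "x \<in> sq R"
      have "x + of_real (r n) \<in> sq (R + \<bar>\<rho>\<bar> + d)"
        using x elim(2) d(1) by (auto simp: sq_def dist_real_def)
      then have 1: "dist (f n (x + of_real (r n))) (g (x + of_real (r n))) < e / 2" using elim by blast
      have "cmod (g (x + of_real \<rho> + of_real (r n - \<rho>)) - g (x + of_real \<rho>)) < e / 2"
        by (rule d(2)[OF g]) (use elim(2) in \<open>simp add: dist_real_def\<close>)
      then have 2: "dist (g (x + of_real (r n))) (g (x + of_real \<rho>)) < e / 2" by (simp add: dist_norm)
      show "dist (shift (r n) (f n) x) (shift \<rho> g x) < e"
        unfolding shift_def using dist_triangle[of "f n (x + of_real (r n))" "g (x + of_real \<rho>)" "g (x + of_real (r n))"] 1 2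
        by linarith
    qed
  qed
qed

text \<open>
  The winding number along the pair \<open>(a, b)\<close> is monotone, so a strict increase
  at a limit pair cannot recur infinitely often.
\<close>

lemma recurrent_pair_apart:
  assumes ab: "a \<in> sol" "b \<in> sol" and \<sigma>: "filterlim \<sigma> at_top sequentially"
    and lim: "lconv (\<lambda>n. shift (\<sigma> n) a) p" "lconv (\<lambda>n. shift (\<sigma> n) b) q" and ne: "p \<noteq> q"
  shows "apart p q s"
proof (rule ccontr)
  assume na: "\<not> apart p q s"
  have sol: "shift x a \<in> sol" "shift x b \<in> sol" for x using ab by (auto intro: shift_sol)
  have pq: "p \<in> sol" "q \<in> sol" by (rule sol_closed[OF sol(1) lim(1)] sol_closed[OF sol(2) lim(2)])+
  obtain \<epsilon> where \<epsilon>: "0 < \<epsilon>" "apart p q (s - \<epsilon>)" "apart p q (s + \<epsilon>)"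
    by (rule apart_dense[OF pq ne]) (rule that)
  have less: "W p q (s - \<epsilon>) < W p q (s + \<epsilon>)"
    by (rule W_strict[OF pq _ _ \<epsilon>(2,3) na]) (use \<epsilon> in auto)
  have "\<forall>\<^sub>F n in sequentially. (apart a b (s - \<epsilon> + \<sigma> n) \<and> W a b (s - \<epsilon> + \<sigma> n) = W p q (s - \<epsilon>)) \<and>
      (apart a b (s + \<epsilon> + \<sigma> n) \<and> W a b (s + \<epsilon> + \<sigma> n) = W p q (s + \<epsilon>))"
    using W_lconv[OF sol pq lim \<epsilon>(2)] W_lconv[OF sol pq lim \<epsilon>(3)]
    unfolding apart_shift W_shift by (rule eventually_conj)
  then obtain N where N: "\<And>n. n \<ge> N \<Longrightarrow> (apart a b (s - \<epsilon> + \<sigma> n) \<and> W a b (s - \<epsilon> + \<sigma> n) = W p q (s - \<epsilon>)) \<and>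
      (apart a b (s + \<epsilon> + \<sigma> n) \<and> W a b (s + \<epsilon> + \<sigma> n) = W p q (s + \<epsilon>))"
    by (auto simp: eventually_sequentially)
  have "\<forall>\<^sub>F n in sequentially. \<sigma> N + 2 * \<epsilon> \<le> \<sigma> n" using \<sigma> by (simp add: filterlim_at_top)
  \<comment> \<open>The gap 2 \<epsilon> puts the window around \<open>\<sigma> m\<close> to the
    right of the one around \<open>\<sigma> N\<close>, so W would have to decrease between the two
    jumps.\<close>
  then obtain m where m: "m \<ge> N" "\<sigma> N + 2 * \<epsilon> \<le> \<sigma> m"
    by (auto simp: eventually_sequentially) (metis nle_le)
  have "W a b (s + \<epsilon> + \<sigma> N) \<le> W a b (s - \<epsilon> + \<sigma> m)"
    by (rule W_mono[OF ab]) (use N[of N] N[OF m(1)] m in auto)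
  then show False using less N[of N] N[OF m(1)] by simp
qed

section \<open>Omega-limit sets and their translates\<close>

definition omega :: "(complex \<Rightarrow> complex) \<Rightarrow> (complex \<Rightarrow> complex) set" where
  "omega u = {w \<in> sol. \<exists>\<sigma>. filterlim \<sigma> at_top sequentially \<and> lconv (\<lambda>n. shift (\<sigma> n) u) w}"

lemma omegaE:
  assumes "w \<in> omega u"
  obtains \<sigma> where "w \<in> sol" "filterlim \<sigma> at_top sequentially" "lconv (\<lambda>n. shift (\<sigma> n) u) w"
  using assms by (auto simp: omega_def)

text \<open>Along the same times, w is a limit of u and its translate a limit of
  \<open>shift \<delta> u\<close>, so this is a recurrent pair.\<close>

lemma omega_shift_apart:
  assumes u: "u \<in> sol" and w: "w \<in> omega u" and ne: "shift \<delta> w \<noteq> w"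
  shows "apart w (shift \<delta> w) s"
proof -
  obtain \<sigma> where \<sigma>: "w \<in> sol" "filterlim \<sigma> at_top sequentially" "lconv (\<lambda>n. shift (\<sigma> n) u) w"
    by (rule omegaE[OF w]) (rule that)
  have "lconv (\<lambda>n. shift \<delta> (shift (\<sigma> n) u)) (shift \<delta> w)"
    by (rule lconv_shift[OF shift_sol[OF u] \<sigma>(3) tendsto_const])
  then have "lconv (\<lambda>n. shift (\<sigma> n) (shift \<delta> u)) (shift \<delta> w)"
    by (simp add: shift_shift add.commute)
  from recurrent_pair_apart[OF u shift_sol[OF u] \<sigma>(2,3) this] ne show ?thesis by metis
qed

text \<open>Changes of s and of \<delta> are both translations of the two arguments; pulled back to
  the circle s = 0 they become small perturbations in the sense of \<open>W_stable\<close>.\<close>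

lemma W_shift_locally_constant:
  assumes w: "w \<in> sol" and ap: "apart w (shift \<delta> w) s"
  obtains d where "d > 0" "\<And>\<delta>' s'. \<bar>s' - s\<bar> < d \<Longrightarrow> \<bar>\<delta>' - \<delta>\<bar> < d \<Longrightarrow> W w (shift \<delta>' w) s' = W w (shift \<delta> w) s"
proof -
  have e: "W (shift x w) (shift (\<delta>' + x) w) 0 = W w (shift \<delta>' w) x" for x \<delta>'
    using W_shift[of x w "shift \<delta>' w" 0] by (simp add: shift_shift add.commute)
  have ap': "apart (shift s w) (shift (\<delta> + s) w) 0"
    using ap apart_shift[of s w "shift \<delta> w" 0] by (simp add: shift_shift add.commute)
  obtain \<eta> where \<eta>: "\<eta> > 0" "\<And>a' b'. a' \<in> sol \<Longrightarrow> b' \<in> sol \<Longrightarrow>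
      near \<eta> 0 a' (shift s w) \<Longrightarrow> near \<eta> 0 b' (shift (\<delta> + s) w) \<Longrightarrow>
      apart a' b' 0 \<and> W a' b' 0 = W (shift s w) (shift (\<delta> + s) w) 0"
    by (rule W_stable[OF shift_sol[OF w] shift_sol[OF w] ap']) (rule that)
  obtain d where d: "d > 0" "\<And>a r z. a \<in> sol \<Longrightarrow> \<bar>r\<bar> < d \<Longrightarrow> cmod (a (z + of_real r) - a z) < \<eta>"
    by (rule sol_uniform_shift[OF \<eta>(1)]) (rule that)
  have cl: "cmod (shift x w z - shift y w z) < \<eta>" if "\<bar>x - y\<bar> < d" for x y z
    using d(2)[OF w that, of "z + of_real y"] by (simp add: shift_def)
  show ?thesis
  \<comment> \<open>The second argument is translated by \<delta>' + s', where the two displacements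
    add up.\<close>
  proof (rule that[of "d / 2"])
    fix \<delta>' s' assume "\<bar>s' - s\<bar> < d / 2" "\<bar>\<delta>' - \<delta>\<bar> < d / 2"
    then have "\<bar>s' - s\<bar> < d" "\<bar>(\<delta>' + s') - (\<delta> + s)\<bar> < d" using d(1) by linarith+
    then have "W (shift s' w) (shift (\<delta>' + s') w) 0 = W (shift s w) (shift (\<delta> + s) w) 0"
      using \<eta>(2)[OF shift_sol[OF w] shift_sol[OF w]] cl unfolding near_def by blast
    then show "W w (shift \<delta>' w) s' = W w (shift \<delta> w) s" unfolding e .
  qed (use d in simp)
qed

text \<open>A locally constant function on the connected half-plane \<delta> > 0 is constant. The
  line \<delta> = 0, where W is meaningless, separates it from \<delta> < 0; exchanging the
  arguments and translating back by \<delta> reduces that case to the first.\<close>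

lemma W_shift_constant:
  assumes w: "w \<in> sol" and ap: "\<And>\<delta> s. \<delta> \<noteq> 0 \<Longrightarrow> apart w (shift \<delta> w) s"
  obtains \<kappa> where "\<And>\<delta> s. \<delta> \<noteq> 0 \<Longrightarrow> W w (shift \<delta> w) s = \<kappa>"
proof -
  let ?A = "{0<..} \<times> UNIV :: (real \<times> real) set"
  let ?f = "\<lambda>p. W w (shift (fst p) w) (snd p)"
  have pos: "W w (shift \<delta> w) s = W w (shift 1 w) 0" if "\<delta> > 0" for \<delta> s
  proof -
    have "?f (\<delta>, s) = ?f (1, 0)"
    proof (rule connected_local_const[of ?A])
      show "connected ?A" by (intro connected_Times) auto
      show "\<forall>a\<in>?A. \<forall>\<^sub>F b in at a within ?A. ?f a = ?f b"
      proof
        fix a assume "a \<in> ?A"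
        then have "fst a \<noteq> 0" by auto
        then obtain d where d: "d > 0" "\<And>\<delta>' s'. \<bar>s' - snd a\<bar> < d \<Longrightarrow> \<bar>\<delta>' - fst a\<bar> < d \<Longrightarrow>
            W w (shift \<delta>' w) s' = W w (shift (fst a) w) (snd a)"
          using W_shift_locally_constant[OF w ap] by metis
        show "\<forall>\<^sub>F b in at a within ?A. ?f a = ?f b"
          unfolding eventually_at
        proof (intro exI[of _ d] conjI ballI impI d(1))
          fix b assume "b \<noteq> a \<and> dist b a < d"
          then have "\<bar>snd b - snd a\<bar> < d" "\<bar>fst b - fst a\<bar> < d"
            using dist_fst_le[of b a] dist_snd_le[of b a] by (auto simp: dist_real_def)
          then show "?f a = ?f b" using d(2) by metis
        qed
      qed
    qed (use that in auto)
    then show ?thesis by simp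
  qed
  show ?thesis
  proof (rule that)
    fix \<delta> s :: real assume \<delta>: "\<delta> \<noteq> 0"
    show "W w (shift \<delta> w) s = W w (shift 1 w) 0"
    proof (cases "\<delta> > 0")
      case False
      have "W w (shift \<delta> w) s = W (shift \<delta> w) w s"
        by (rule W_sym[OF w shift_sol[OF w] ap[OF \<delta>], symmetric])
      also have "\<dots> = W (shift \<delta> w) (shift \<delta> (shift (- \<delta>) w)) s" by (simp add: shift_shift)
      also have "\<dots> = W w (shift 1 w) 0" unfolding W_shift using False \<delta> by (intro pos) auto
      finally show ?thesis .
    qed (rule pos)
  qed
qed

text \<open>Here \<sigma> and \<tau> are times of visits to w1 and w2, and \<tau> (j n) - \<sigma>
  (i n) tells how long the visit to w2 precedes the one to w1. If p differed from w2, then \<kappa>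
  \<le> W w1 w2 (- \<epsilon>) < W w1 w2 \<epsilon> \<le> \<kappa>. The statement is separate
  because it is applied to w1 and to a translate of it.\<close>

lemma recurrent_backward_limit:
  assumes u: "u \<in> sol" and w: "w1 \<in> sol" "w2 \<in> sol"
    and lim: "filterlim \<sigma> at_top sequentially" "filterlim \<tau> at_top sequentially"
      "lconv (\<lambda>n. shift (\<sigma> n) u) w1" "lconv (\<lambda>n. shift (\<tau> n) u) w2"
    and \<kappa>: "\<And>\<delta> s. \<delta> \<noteq> 0 \<Longrightarrow> W w2 (shift \<delta> w2) s = \<kappa>" "\<And>\<delta> s. \<delta> \<noteq> 0 \<Longrightarrow> apart w2 (shift \<delta> w2) s"
    and \<epsilon>: "\<epsilon> > 0" "apart w1 w2 (- \<epsilon>)" "apart w1 w2 \<epsilon>" "W w1 w2 (- \<epsilon>) < W w1 w2 \<epsilon>"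
    and ij: "\<And>n. n \<le> i n" "\<And>n. n \<le> j n"
    and \<theta>: "filterlim (\<lambda>n. \<tau> (j n) - \<sigma> (i n)) at_bot sequentially"
      "lconv (\<lambda>n. shift (\<tau> (j n) - \<sigma> (i n)) w2) p"
  shows "p = w2"
proof (rule ccontr)
  assume ne: "p \<noteq> w2"
  define \<theta>' where "\<theta>' n = \<tau> (j n) - \<sigma> (i n)" for n
  have su: "shift x u \<in> sol" for x by (rule shift_sol[OF u])
  have sw: "shift x w2 \<in> sol" for x by (rule shift_sol[OF w(2)])
  have p: "p \<in> sol" by (rule sol_closed[OF sw \<theta>(2)])
  have ev: "\<forall>\<^sub>F n in sequentially. P (j n) \<and> P (i n)" if "\<forall>\<^sub>F n in sequentially. P n" for P
    using that ij unfolding eventually_sequentially by (meson order_trans)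
  obtain \<eta>1 where \<eta>1: "\<eta>1 > 0" "\<And>a' b'. a' \<in> sol \<Longrightarrow> b' \<in> sol \<Longrightarrow>
      near \<eta>1 (-\<epsilon>) a' w1 \<Longrightarrow> near \<eta>1 (-\<epsilon>) b' w2 \<Longrightarrow>
      apart a' b' (-\<epsilon>) \<and> W a' b' (-\<epsilon>) = W w1 w2 (-\<epsilon>)"
    by (rule W_stable[OF w \<epsilon>(2)]) (rule that)
  obtain \<eta>2 where \<eta>2: "\<eta>2 > 0" "\<And>a' b'. a' \<in> sol \<Longrightarrow> b' \<in> sol \<Longrightarrow>
      near \<eta>2 \<epsilon> a' w1 \<Longrightarrow> near \<eta>2 \<epsilon> b' w2 \<Longrightarrow>
      apart a' b' \<epsilon> \<and> W a' b' \<epsilon> = W w1 w2 \<epsilon>"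
    by (rule W_stable[OF w \<epsilon>(3)]) (rule that)
  have "\<forall>\<^sub>F n in sequentially.
      (near \<eta>1 (-\<epsilon>) (shift (\<sigma> n) u) w1 \<and>
       near \<eta>1 (-\<epsilon>) (shift (\<tau> n) u) w2) \<and>
      (near \<eta>2 \<epsilon> (shift (\<sigma> n) u) w1 \<and>
       near \<eta>2 \<epsilon> (shift (\<tau> n) u) w2)"
    by (intro eventually_conj lconv_close lim \<eta>1(1) \<eta>2(1))
  then obtain N where "\<And>n. n \<ge> N \<Longrightarrow>
      (near \<eta>1 (-\<epsilon>) (shift (\<sigma> n) u) w1 \<and>
       near \<eta>1 (-\<epsilon>) (shift (\<tau> n) u) w2) \<and>
      (near \<eta>2 \<epsilon> (shift (\<sigma> n) u) w1 \<and>
       near \<eta>2 \<epsilon> (shift (\<tau> n) u) w2)"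
    unfolding eventually_sequentially by blast
  \<comment> \<open>The threshold is uniform in both indices, so the visit to w1 and the visit to w2
    can be chosen independently; both comparisons below depend on this freedom.\<close>
  then have N: "apart (shift (\<sigma> n) u) (shift (\<tau> m) u) (-\<epsilon>)" "W (shift (\<sigma> n) u) (shift (\<tau> m) u) (-\<epsilon>) = W w1 w2 (-\<epsilon>)"
      "apart (shift (\<sigma> n) u) (shift (\<tau> m) u) \<epsilon>" "W (shift (\<sigma> n) u) (shift (\<tau> m) u) \<epsilon> = W w1 w2 \<epsilon>"
    if "n \<ge> N" "m \<ge> N" for n m
    using \<eta>1(2)[OF su su, of "\<sigma> n" "\<tau> m"] \<eta>2(2)[OF su su, of "\<sigma> n" "\<tau> m"] that by blast+
  \<comment> \<open>Seen from u, the pair with \<open>shift \<delta> u\<close> imitates (w1, w2)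
    around the time \<open>\<sigma> N\<close> and imitates (w2, \<open>shift \<delta> w2\<close>) at
    the much later times \<open>\<tau> n\<close>.\<close>
  have ge: "W w1 w2 \<epsilon> \<le> \<kappa>"
  proof -
    define \<delta> where "\<delta> = \<tau> N - \<sigma> N"
    have d: "shift (\<sigma> N) (shift \<delta> u) = shift (\<tau> N) u" by (simp add: \<delta>_def shift_shift)
    have ap: "apart u (shift \<delta> u) (\<epsilon> + \<sigma> N)" and WN: "W u (shift \<delta> u) (\<epsilon> + \<sigma> N) = W w1 w2 \<epsilon>"
      using N(3,4)[of N N] unfolding d[symmetric] apart_shift W_shift by auto
    have \<delta>: "\<delta> \<noteq> 0" using apart_ne[OF ap] by auto
    have "lconv (\<lambda>n. shift \<delta> (shift (\<tau> n) u)) (shift \<delta> w2)"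
      by (rule lconv_shift[OF su lim(4) tendsto_const])
    then have l: "lconv (\<lambda>n. shift (\<tau> n) (shift \<delta> u)) (shift \<delta> w2)"
      by (simp add: shift_shift add.commute)
    have "\<forall>\<^sub>F n in sequentially. apart u (shift \<delta> u) (0 + \<tau> n) \<and> W u (shift \<delta> u) (0 + \<tau> n) = W w2 (shift \<delta> w2) 0"
      using W_lconv[OF su shift_sol[OF shift_sol[OF u]] w(2) sw lim(4) l \<kappa>(2)[OF \<delta>, of 0]]
      unfolding apart_shift W_shift by blast
    moreover have "\<forall>\<^sub>F n in sequentially. \<epsilon> + \<sigma> N \<le> \<tau> n" using lim(2) by (simp add: filterlim_at_top)
    ultimately have "\<forall>\<^sub>F n in sequentially. W w1 w2 \<epsilon> \<le> \<kappa>"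
    proof eventually_elim
      case (elim n)
      have "W u (shift \<delta> u) (\<epsilon> + \<sigma> N) \<le> W u (shift \<delta> u) (0 + \<tau> n)"
        by (rule W_mono[OF u su _ ap]) (use elim in auto)
      then show ?case using elim WN \<kappa>(1)[OF \<delta>, of 0] by simp
    qed
    then show ?thesis by simp
  qed
  obtain \<epsilon>' where "apart w2 p (0 + \<epsilon>')"
    by (rule apart_dense[OF w(2) p ne[symmetric], of 0]) (rule that)
  then obtain s where s: "apart w2 p s" by blast
  have l\<tau>: "lconv (\<lambda>n. shift (\<tau> (j n)) u) w2"
    unfolding lconv_def
  proof (intro allI uniform_limitI)
    fix R e :: real assume "e > 0"
    moreover have "uniform_limit (sq R) (\<lambda>n. shift (\<tau> n) u) w2 sequentially" using lim(4) by (simp add: lconv_def)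
    ultimately have "\<forall>\<^sub>F n in sequentially. \<forall>x\<in>sq R. dist (shift (\<tau> n) u x) (w2 x) < e" by (intro uniform_limitD)
    from ev[OF this] show "\<forall>\<^sub>F n in sequentially. \<forall>x\<in>sq R. dist (shift (\<tau> (j n)) u x) (w2 x) < e"
      by eventually_elim blast
  qed
  have lc: "lconv (\<lambda>n. w2) w2" by (simp add: lconv_def uniform_limit_const)
  have l\<theta>: "lconv (\<lambda>n. shift (\<theta>' n) w2) p" using \<theta>(2) by (simp add: \<theta>'_def)
  \<comment> \<open>The bound - \<epsilon> - s places the circle s + \<open>\<theta>' n\<close> at
    or to the left of - \<epsilon>; the bound - 1 ensures \<open>\<theta>' n\<close> \<noteq> 0, so
    that \<kappa> applies.\<close>
  have "\<forall>\<^sub>F n in sequentially. \<theta>' n \<le> min (- \<epsilon> - s) (- 1)"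
    using \<theta>(1) unfolding \<theta>'_def filterlim_at_bot by blast
  moreover have "\<forall>\<^sub>F n in sequentially. n \<ge> N" by (rule eventually_ge_at_top)
  ultimately have "\<forall>\<^sub>F n in sequentially. False"
    using W_lconv[OF _ sw w(2) p lc l\<theta> s, OF w(2)] W_lconv[OF su sw w(2) p l\<tau> l\<theta> s]
  proof eventually_elim
    case (elim n)
    have a: "apart (shift (\<tau> (j n)) u) (shift (\<theta>' n) w2) s" using elim by blast
    have W1: "W (shift (\<tau> (j n)) u) (shift (\<theta>' n) w2) s = \<kappa>"
      using elim \<kappa>(1)[of "\<theta>' n" s] by auto
    have "lconv (\<lambda>m. shift (\<theta>' n) (shift (\<tau> m) u)) (shift (\<theta>' n) w2)"
      by (rule lconv_shift[OF su lim(4) tendsto_const])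
    moreover have "lconv (\<lambda>m. shift (\<tau> (j n)) u) (shift (\<tau> (j n)) u)" by (simp add: lconv_def uniform_limit_const)
    ultimately have "\<forall>\<^sub>F m in sequentially. apart (shift (\<tau> (j n)) u) (shift (\<theta>' n) (shift (\<tau> m) u)) s \<and>
        W (shift (\<tau> (j n)) u) (shift (\<theta>' n) (shift (\<tau> m) u)) s = \<kappa>"
      unfolding W1[symmetric] by (intro W_lconv su shift_sol[OF su] sw a)
    moreover have "\<forall>\<^sub>F m in sequentially. m \<ge> N" by (rule eventually_ge_at_top)
    ultimately have "\<forall>\<^sub>F m in sequentially. apart (shift (\<tau> (j n)) u) (shift (\<theta>' n) (shift (\<tau> m) u)) s \<and>
        W (shift (\<tau> (j n)) u) (shift (\<theta>' n) (shift (\<tau> m) u)) s = \<kappa> \<and> m \<ge> N"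
      by eventually_elim blast
    then obtain m where m: "apart (shift (\<tau> (j n)) u) (shift (\<theta>' n) (shift (\<tau> m) u)) s"
        "W (shift (\<tau> (j n)) u) (shift (\<theta>' n) (shift (\<tau> m) u)) s = \<kappa>" "m \<ge> N"
      by (auto simp: eventually_sequentially)
    \<comment> \<open>Thus the pair at hand is that of \<open>shift (\<sigma> (i n)) u\<close> and
      \<open>shift (\<tau> m) u\<close>, seen at s + \<open>\<theta>' n\<close>. At the later circle
      - \<epsilon> the same pair imitates (w1, w2), and monotonicity bounds \<kappa>.\<close>
    have e: "shift (\<tau> (j n)) u = shift (\<theta>' n) (shift (\<sigma> (i n)) u)" by (simp add: \<theta>'_def shift_shift)
    have in': "i n \<ge> N" using ij(1)[of n] elim by simp
    have "W (shift (\<sigma> (i n)) u) (shift (\<tau> m) u) (s + \<theta>' n) \<le> W (shift (\<sigma> (i n)) u) (shift (\<tau> m) u) (- \<epsilon>)"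
      by (rule W_mono[OF su su _ _ N(1)[OF in' m(3)]]) (use m(1) elim in \<open>auto simp: e apart_shift\<close>)
    then have "\<kappa> \<le> W w1 w2 (- \<epsilon>)"
      using m(2) N(2)[OF in' m(3)] unfolding e W_shift by simp
    then show False using ge \<epsilon>(4) by simp
  qed
  then show False by simp
qed

lemma shift_of_int_period:
  assumes "shift \<theta> w = w"
  shows "shift (of_int m * \<theta>) w = w"
proof -
  have nat: "shift (of_nat n * \<theta>) w = w" for n
  proof (induction n)
    case (Suc n)
    have "shift (of_nat (Suc n) * \<theta>) w = shift (of_nat n * \<theta>) (shift \<theta> w)" by (simp add: shift_shift algebra_simps)
    then show ?case using Suc assms by simp
  qed simp
  show ?thesis
  proof (cases "m \<ge> 0")
    case True then show ?thesis using nat[of "nat m"] by simp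
  next
    case False
    have "shift (of_int m * \<theta>) w = shift (of_int m * \<theta>) (shift (of_nat (nat (- m)) * \<theta>) w)" by (simp only: nat)
    also have "\<dots> = w" using False by (simp add: shift_shift)
    finally show ?thesis .
  qed
qed

text \<open>Along a subsequence the times converge modulo the period to some \<rho>. Hence the fixed
  translate \<open>shift (- \<rho>) w2\<close> returns to w2 exactly when u returns to w1, and the
  pair is recurrent.\<close>

lemma periodic_limit_apart:
  assumes u: "u \<in> sol" and w2: "w2 \<in> sol" and \<sigma>: "filterlim \<sigma> at_top sequentially" "lconv (\<lambda>n. shift (\<sigma> n) u) w1"
    and \<theta>: "\<theta> > 0" "shift \<theta> w2 = w2" and ne: "w1 \<noteq> w2"
  shows "apart w1 w2 s"
proof -
  define r where "r n = \<sigma> n - of_int \<lfloor>\<sigma> n / \<theta>\<rfloor> * \<theta>" for n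
  have "r n \<in> {0..\<theta>}" for n
    using floor_divide_lower[OF \<theta>(1), of "\<sigma> n"] floor_divide_upper[OF \<theta>(1), of "\<sigma> n"]
    by (auto simp: r_def algebra_simps)
  then obtain \<rho> k where k: "strict_mono k" "(r \<circ> k) \<longlonglongrightarrow> \<rho>"
    using compact_imp_seq_compact[OF compact_Icc, of 0 \<theta>] unfolding seq_compact_def by metis
  have \<sigma>k: "filterlim (\<lambda>n. \<sigma> (k n)) at_top sequentially"
    by (rule filterlim_compose[OF \<sigma>(1) filterlim_subseq[OF k(1)]])
  have e: "shift (\<sigma> n) (shift (- \<rho>) w2) = shift (r n - \<rho>) w2" for n
  proof -
    have "shift (\<sigma> n) (shift (- \<rho>) w2) = shift (r n - \<rho>) (shift (of_int \<lfloor>\<sigma> n / \<theta>\<rfloor> * \<theta>) w2)"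
      by (simp add: shift_shift r_def algebra_simps)
    then show ?thesis by (simp add: shift_of_int_period[OF \<theta>(2)])
  qed
  have "(\<lambda>n. r (k n) - \<rho>) \<longlonglongrightarrow> 0" using k(2) by (simp add: LIM_zero o_def)
  then have "lconv (\<lambda>n. shift (r (k n) - \<rho>) w2) (shift 0 w2)"
    by (intro lconv_shift w2) (auto simp: lconv_def uniform_limit_const)
  then have l: "lconv (\<lambda>n. shift (\<sigma> (k n)) (shift (- \<rho>) w2)) w2" by (simp add: e)
  show ?thesis
    by (rule recurrent_pair_apart[OF u shift_sol[OF w2] \<sigma>k lconv_subseq[OF \<sigma>(2) k(1)] l ne])
qed

lemma period_pos:
  assumes "\<theta> \<noteq> 0" "shift \<theta> w = w"
  obtains \<theta>' where "\<theta>' > 0" "shift \<theta>' w = w"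
proof (cases "\<theta> > 0")
  case False
  have "shift (- \<theta>) w = w" using shift_of_int_period[OF assms(2), of "- 1"] by simp
  then show ?thesis using that[of "- \<theta>"] False assms by simp
qed (use that assms in blast)

theorem omega_pair_apart:
  assumes u: "u \<in> sol" and w: "w1 \<in> omega u" "w2 \<in> omega u" and ne: "w1 \<noteq> w2"
  shows "apart w1 w2 0"
proof (rule ccontr)
  assume na: "\<not> apart w1 w2 0"
  obtain \<sigma> where \<sigma>: "w1 \<in> sol" "filterlim \<sigma> at_top sequentially" "lconv (\<lambda>n. shift (\<sigma> n) u) w1"
    by (rule omegaE[OF w(1)]) (rule that)
  obtain \<tau> where \<tau>: "w2 \<in> sol" "filterlim \<tau> at_top sequentially" "lconv (\<lambda>n. shift (\<tau> n) u) w2"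
    by (rule omegaE[OF w(2)]) (rule that)
  have aper: "shift \<delta> w2 \<noteq> w2" if \<delta>: "\<delta> \<noteq> 0" for \<delta>
  proof
    assume "shift \<delta> w2 = w2"
    then obtain \<theta> where "\<theta> > 0" "shift \<theta> w2 = w2" using period_pos[OF \<delta>] by blast
    then show False using periodic_limit_apart[OF u \<tau>(1) \<sigma>(2,3) _ _ ne] na by blast
  qed
  have ap: "apart w2 (shift \<delta> w2) s" if "\<delta> \<noteq> 0" for \<delta> s
    by (rule omega_shift_apart[OF u w(2) aper[OF that]])
  obtain \<kappa> where \<kappa>: "\<And>\<delta> s. \<delta> \<noteq> 0 \<Longrightarrow> W w2 (shift \<delta> w2) s = \<kappa>"
    by (rule W_shift_constant[OF \<tau>(1) ap]) (assumption, rule that)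
  obtain \<epsilon> where \<epsilon>: "\<epsilon> > 0" "apart w1 w2 (0 - \<epsilon>)" "apart w1 w2 (0 + \<epsilon>)"
    by (rule apart_dense[OF \<sigma>(1) \<tau>(1) ne, of 0]) (rule that)
  then have \<epsilon>': "apart w1 w2 (- \<epsilon>)" "apart w1 w2 \<epsilon>" by auto
  have less: "W w1 w2 (- \<epsilon>) < W w1 w2 \<epsilon>"
    by (rule W_strict[OF \<sigma>(1) \<tau>(1) _ _ \<epsilon>' na]) (use \<epsilon> in auto)
  \<comment> \<open>Each visit to w2 is paired with a visit to w1 that is later by at least n, so
    the time differences tend to minus infinity.\<close>
  have "\<exists>m\<ge>n. \<tau> n + real n \<le> \<sigma> m" for n
  proof -
    have "\<forall>\<^sub>F m in sequentially. \<tau> n + real n \<le> \<sigma> m" using \<sigma>(2) by (simp add: filterlim_at_top)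
    then show ?thesis unfolding eventually_sequentially by (meson nle_le)
  qed
  then obtain m where m: "\<And>n. n \<le> m n" "\<And>n. \<tau> n + real n \<le> \<sigma> (m n)" by metis
  obtain k p where k: "strict_mono (k :: nat \<Rightarrow> nat)" "p \<in> sol" "lconv (\<lambda>n. shift (\<tau> (k n) - \<sigma> (m (k n))) w2) p"
    by (rule sol_compact[of "\<lambda>n. shift (\<tau> n - \<sigma> (m n)) w2"]) (auto intro: shift_sol[OF \<tau>(1)])
  have ij: "n \<le> m (k n)" "n \<le> k n" for n
    using seq_suble[OF k(1), of n] m(1)[of "k n"] by auto
  \<comment> \<open>The parameter r serves both uses of \<open>recurrent_backward_limit\<close>: r =
    0 now and a small positive r below.\<close>
  have bot: "filterlim (\<lambda>n. \<tau> (k n) - (\<sigma> (m (k n)) + r)) at_bot sequentially" if "r \<ge> 0" for r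
  proof (rule filterlim_at_bot_mono)
    show "filterlim (\<lambda>n. - real n) at_bot sequentially"
      using filterlim_real_sequentially by (simp add: filterlim_uminus_at_bot)
    show "\<forall>\<^sub>F n in sequentially. \<tau> (k n) - (\<sigma> (m (k n)) + r) \<le> - real n"
      using m(2)[of "k n" for n] seq_suble[OF k(1)] that by (intro always_eventually allI) (smt (verit) of_nat_mono)
  qed
  have "p = w2"
    by (rule recurrent_backward_limit[OF u \<sigma>(1) \<tau>(1) \<sigma>(2) \<tau>(2) \<sigma>(3) \<tau>(3) \<kappa> ap \<epsilon>(1) \<epsilon>' less ij _ k(3)])
      (use bot[of 0] in auto)
  obtain \<eta>1 where \<eta>1: "\<eta>1 > 0" "\<And>a' b'. a' \<in> sol \<Longrightarrow> b' \<in> sol \<Longrightarrow>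
      near \<eta>1 (-\<epsilon>) a' w1 \<Longrightarrow> near \<eta>1 (-\<epsilon>) b' w2 \<Longrightarrow>
      apart a' b' (-\<epsilon>) \<and> W a' b' (-\<epsilon>) = W w1 w2 (-\<epsilon>)"
    by (rule W_stable[OF \<sigma>(1) \<tau>(1) \<epsilon>'(1)]) (rule that)
  obtain \<eta>2 where \<eta>2: "\<eta>2 > 0" "\<And>a' b'. a' \<in> sol \<Longrightarrow> b' \<in> sol \<Longrightarrow>
      near \<eta>2 \<epsilon> a' w1 \<Longrightarrow> near \<eta>2 \<epsilon> b' w2 \<Longrightarrow>
      apart a' b' \<epsilon> \<and> W a' b' \<epsilon> = W w1 w2 \<epsilon>"
    by (rule W_stable[OF \<sigma>(1) \<tau>(1) \<epsilon>'(2)]) (rule that)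
  obtain d where d: "d > 0" "\<And>a r z. a \<in> sol \<Longrightarrow> \<bar>r\<bar> < d \<Longrightarrow> cmod (a (z + of_real r) - a z) < min \<eta>1 \<eta>2"
    by (rule sol_uniform_shift[of "min \<eta>1 \<eta>2"]) (use \<eta>1(1) \<eta>2(1) in auto)
  \<comment> \<open>So small a translate of w1 leaves W unchanged on both circles at - \<epsilon>
    and \<epsilon>. The previous argument then repeats with visiting times
    \<open>\<sigma> n + r\<close> and limit \<open>shift (- r) p\<close>, and two limits equal to w2
    amount to a period of w2.\<close>
  define r where "r = d / 2"
  have r: "r > 0" "\<bar>r\<bar> < d" using d(1) by (auto simp: r_def)
  let ?w = "shift r w1"
  have cl: "cmod (?w z - w1 z) < \<eta>1" "cmod (?w z - w1 z) < \<eta>2" for z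
    using d(2)[OF \<sigma>(1) r(2), of z] by (auto simp: shift_def)
  have 1: "apart ?w w2 (-\<epsilon>) \<and> W ?w w2 (-\<epsilon>) = W w1 w2 (-\<epsilon>)"
    by (rule \<eta>1(2)[OF shift_sol[OF \<sigma>(1)] \<tau>(1)]) (use cl \<eta>1(1) in \<open>auto simp: near_def\<close>)
  have 2: "apart ?w w2 \<epsilon> \<and> W ?w w2 \<epsilon> = W w1 w2 \<epsilon>"
    by (rule \<eta>2(2)[OF shift_sol[OF \<sigma>(1)] \<tau>(1)]) (use cl \<eta>2(1) in \<open>auto simp: near_def\<close>)
  have l1: "lconv (\<lambda>n. shift (\<sigma> n + r) u) ?w"
    using lconv_shift[OF shift_sol[OF u] \<sigma>(3) tendsto_const, of r] by (simp add: shift_shift add.commute)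
  have s1: "filterlim (\<lambda>n. \<sigma> n + r) at_top sequentially"
    using filterlim_tendsto_add_at_top[OF tendsto_const \<sigma>(2), of r] by (simp add: add.commute)
  have l2: "lconv (\<lambda>n. shift (\<tau> (k n) - (\<sigma> (m (k n)) + r)) w2) (shift (- r) p)"
    using lconv_shift[OF shift_sol[OF \<tau>(1)] k(3) tendsto_const, of "- r"] by (simp add: shift_shift algebra_simps)
  have "shift (- r) p = w2"
    by (rule recurrent_backward_limit[OF u shift_sol[OF \<sigma>(1)] \<tau>(1) s1 \<tau>(2) l1 \<tau>(3) \<kappa> ap \<epsilon>(1) _ _ _ ij bot l2])
      (use 1 2 less r in auto)
  then have "shift (- r) w2 = w2" using \<open>p = w2\<close> by simp
  then show False using aper[of "- r"] r by simp
qed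

end

section \<open>Transfer to the plane\<close>

context cr_system
begin

text \<open>A diagonal choice of times: \<open>x n\<close> is at least n and brings u within 1 / (n
  + 1) of \<open>w n\<close> on \<open>sq n\<close>.\<close>

lemma omega_closed:
  assumes u: "u \<in> sol" and w: "\<And>n. w n \<in> omega u" and lim: "lconv w p"
  shows "p \<in> omega u"
proof -
  have ws: "w n \<in> sol" for n using w[of n] by (simp add: omega_def)
  have "\<exists>x. real n \<le> x \<and> (\<forall>z\<in>sq (real n). dist (shift x u z) (w n z) < 1 / Suc n)" for n
  proof -
    obtain \<sigma> where \<sigma>: "w n \<in> sol" "filterlim \<sigma> at_top sequentially" "lconv (\<lambda>m. shift (\<sigma> m) u) (w n)"
      by (rule omegaE[OF w]) (rule that)
    have "uniform_limit (sq (real n)) (\<lambda>m. shift (\<sigma> m) u) (w n) sequentially" using \<sigma>(3) by (simp add: lconv_def)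
    from uniform_limitD[OF this, of "1 / Suc n"]
    have "\<forall>\<^sub>F m in sequentially. \<forall>z\<in>sq (real n). dist (shift (\<sigma> m) u z) (w n z) < 1 / Suc n" by simp
    moreover have "\<forall>\<^sub>F m in sequentially. real n \<le> \<sigma> m" using \<sigma>(2) by (simp add: filterlim_at_top)
    ultimately have "\<forall>\<^sub>F m in sequentially. real n \<le> \<sigma> m \<and> (\<forall>z\<in>sq (real n). dist (shift (\<sigma> m) u z) (w n z) < 1 / Suc n)"
      by eventually_elim blast
    then show ?thesis unfolding eventually_sequentially by blast
  qed
  then obtain x where x: "\<And>n. real n \<le> x n" "\<And>n z. z \<in> sq (real n) \<Longrightarrow> dist (shift (x n) u z) (w n z) < 1 / Suc n"
    by metis
  have "filterlim x at_top sequentially"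
    by (rule filterlim_at_top_mono[OF filterlim_real_sequentially]) (simp add: x(1))
  moreover have "lconv (\<lambda>n. shift (x n) u) p"
    unfolding lconv_def
  proof (intro allI uniform_limitI)
    fix R e :: real assume e: "e > 0"
    have "uniform_limit (sq R) w p sequentially" using lim by (simp add: lconv_def)
    from uniform_limitD[OF this, of "e / 2"] e
    have "\<forall>\<^sub>F n in sequentially. \<forall>z\<in>sq R. dist (w n z) (p z) < e / 2" by simp
    moreover have "\<forall>\<^sub>F n in sequentially. 1 / real (Suc n) < e / 2"
      using order_tendstoD(2)[OF LIMSEQ_Suc[OF lim_inverse_n'], of "e / 2"] e by simp
    moreover have "\<forall>\<^sub>F n in sequentially. R \<le> real n"
      using filterlim_real_sequentially by (simp add: filterlim_at_top)
    ultimately show "\<forall>\<^sub>F n in sequentially. \<forall>z\<in>sq R. dist (shift (x n) u z) (p z) < e"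
    proof eventually_elim
      case (elim n)
      show ?case
      proof
        fix z assume z: "z \<in> sq R"
        then have "z \<in> sq (real n)" using elim(3) by (auto simp: sq_def)
        from x(2)[OF this] have "dist (shift (x n) u z) (w n z) < e / 2" using elim(2) by linarith
        moreover have "dist (w n z) (p z) < e / 2" using elim(1) z by blast
        ultimately show "dist (shift (x n) u z) (p z) < e"
          using dist_triangle[of "shift (x n) u z" "p z" "w n z"] by linarith
      qed
    qed
  qed
  ultimately show ?thesis using sol_closed[OF ws lim] by (auto simp: omega_def)
qed

end

text \<open>The conjugate is taken because it turns multiplication by \<open>J\<close> into \<open>-i\<close>.\<close>

definition cpx :: "real^2 \<Rightarrow> complex" where "cpx v = Complex (v $ 1) (- (v $ 2))"

definition plane_of :: "complex \<Rightarrow> real^2" where "plane_of z = vector [Re z, - Im z]"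

lemma plane_of_cpx [simp]: "plane_of (cpx v) = v"
  by (simp add: plane_of_def cpx_def vec_eq_iff forall_2)

lemma cpx_plane_of [simp]: "cpx (plane_of z) = z"
  by (simp add: plane_of_def cpx_def)

lemma norm_cpx [simp]: "cmod (cpx v) = norm v"
  by (simp add: cpx_def cmod_def norm_vec_def L2_set_def sum_2)

lemma norm_plane_of [simp]: "norm (plane_of z) = cmod z"
  using norm_cpx[of "plane_of z"] by simp

lemma bounded_linear_cpx: "bounded_linear cpx"
proof (rule bounded_linear_intro[of _ 1])
  show "cmod (cpx v) \<le> norm v * 1" for v by simp
qed (simp_all add: cpx_def complex_eq_iff)

lemma bounded_linear_plane_of: "bounded_linear plane_of"
proof (rule bounded_linear_intro[of _ 1])
  show "norm (plane_of z) \<le> cmod z * 1" for z by simp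
qed (simp_all add: plane_of_def vec_eq_iff forall_2)

lemmas cpx_simps = linear_add[OF bounded_linear.linear[OF bounded_linear_cpx]]
  linear_diff[OF bounded_linear.linear[OF bounded_linear_cpx]]
  linear_scale[OF bounded_linear.linear[OF bounded_linear_cpx]]
  linear_0[OF bounded_linear.linear[OF bounded_linear_cpx]]

lemmas plane_of_simps = linear_add[OF bounded_linear.linear[OF bounded_linear_plane_of]]
  linear_diff[OF bounded_linear.linear[OF bounded_linear_plane_of]]

lemma dist_cpx [simp]: "dist (cpx v) (cpx w) = dist v w"
  by (simp add: dist_norm flip: cpx_simps(2))

lemma cpx_J: "cpx (J *v v) = - \<i> * cpx v"
  by (simp add: J_def cpx_def complex_eq_iff matrix_vector_mult_def sum_2)

section \<open>Dictionary between maps into the plane and complex functions\<close>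

definition to_cpx :: "(real \<times> real \<Rightarrow> real^2) \<Rightarrow> complex \<Rightarrow> complex" where
  "to_cpx u z = cpx (u (Re z, Im z))"

definition of_cpx :: "(complex \<Rightarrow> complex) \<Rightarrow> real \<times> real \<Rightarrow> real^2" where
  "of_cpx U p = plane_of (U (Complex (fst p) (snd p)))"

lemma of_cpx_to_cpx [simp]: "of_cpx (to_cpx u) = u"
  by (simp add: fun_eq_iff of_cpx_def to_cpx_def)

lemma to_cpx_of_cpx [simp]: "to_cpx (of_cpx U) = U"
  by (simp add: fun_eq_iff of_cpx_def to_cpx_def)

text \<open>Under \<open>cpx\<close> the matrix J acts as - i, so u_s - J (u_t - F) = 0 becomes U_x
  + i U_y = i F.\<close>

definition cr_rhs :: "(real \<times> (real^2) \<Rightarrow> real^2) \<Rightarrow> complex \<Rightarrow> complex \<Rightarrow> complex" where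
  "cr_rhs F z w = \<i> * cpx (F (Im z, plane_of w))"

text \<open>Squares are compact, and every compact set lies in a square.\<close>

lemma uniform_limit_to_cpx:
  "(\<forall>K. compact K \<longrightarrow> uniform_limit K f w sequentially) \<longleftrightarrow> lconv (\<lambda>n. to_cpx (f n)) (to_cpx w)"
proof
  assume a: "\<forall>K. compact K \<longrightarrow> uniform_limit K f w sequentially"
  show "lconv (\<lambda>n. to_cpx (f n)) (to_cpx w)"
    unfolding lconv_def
  proof
    fix R
    have "compact ((\<lambda>z. (Re z, Im z)) ` sq R)"
      by (intro compact_continuous_image continuous_intros compact_sq)
    then have "uniform_limit ((\<lambda>z. (Re z, Im z)) ` sq R) f w sequentially" using a by blast
    then show "uniform_limit (sq R) (\<lambda>n. to_cpx (f n)) (to_cpx w) sequentially"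
      by (simp add: uniform_limit_iff to_cpx_def)
  qed
next
  assume l: "lconv (\<lambda>n. to_cpx (f n)) (to_cpx w)"
  show "\<forall>K. compact K \<longrightarrow> uniform_limit K f w sequentially"
  proof (intro allI impI)
    fix K :: "(real \<times> real) set" assume "compact K"
    from compact_imp_bounded[OF this] obtain B where B: "\<And>p. p \<in> K \<Longrightarrow> norm p \<le> B"
      unfolding bounded_iff by blast
    have K: "Complex (fst p) (snd p) \<in> sq B" if "p \<in> K" for p
      using B[OF that] norm_fst_le[of "fst p" "snd p"] norm_snd_le[of "snd p" "fst p"] by (auto simp: sq_def)
    have u: "uniform_limit (sq B) (\<lambda>n. to_cpx (f n)) (to_cpx w) sequentially"
      using l by (simp add: lconv_def)
    show "uniform_limit K f w sequentially"
    proof (rule uniform_limitI)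
      fix e :: real assume "e > 0"
      from uniform_limitD[OF u this] show "\<forall>\<^sub>F n in sequentially. \<forall>x\<in>K. dist (f n x) (w x) < e"
      proof eventually_elim
        case (elim n)
        show ?case
        proof
          fix p assume "p \<in> K"
          with elim K have "dist (to_cpx (f n) (Complex (fst p) (snd p))) (to_cpx w (Complex (fst p) (snd p))) < e" by blast
          then show "dist (f n p) (w p) < e" by (simp add: to_cpx_def)
        qed
      qed
    qed
  qed
qed

section \<open>The given right-hand side as an instance of the abstract system\<close>

lemma Ck_1_iff:
  "Ck 1 f \<longleftrightarrow> (\<forall>x. f differentiable (at x)) \<and> (\<forall>v. continuous_on UNIV (\<lambda>x. frechet_derivative f (at x) v))"
  by simp

text \<open>Compactness bounds the derivative along each basis vector, the sum of these bounds
  dominates the operator norm, and convexity admits the mean value inequality.\<close>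

lemma Ck_1_lipschitz:
  fixes f :: "'a::euclidean_space \<Rightarrow> 'b::real_normed_vector"
  assumes f: "Ck 1 f" and K: "compact K" "convex K"
  obtains B where "B \<ge> 0" "\<And>x y. x \<in> K \<Longrightarrow> y \<in> K \<Longrightarrow> norm (f x - f y) \<le> B * norm (x - y)"
proof -
  let ?D = "\<lambda>x. frechet_derivative f (at x)"
  have d: "(f has_derivative ?D x) (at x within K)" for x
    using f unfolding Ck_1_iff by (auto simp: frechet_derivative_works intro: has_derivative_at_withinI)
  have bl: "bounded_linear (?D x)" for x
    using f unfolding Ck_1_iff by (auto simp: frechet_derivative_works intro: has_derivative_bounded_linear)
  have "\<exists>B. \<forall>x\<in>K. norm (?D x b) \<le> B" for b
  proof -
    have "continuous_on K (\<lambda>x. ?D x b)" using f unfolding Ck_1_iff by (auto intro: continuous_on_subset)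
    then have "bounded ((\<lambda>x. ?D x b) ` K)" by (intro compact_imp_bounded compact_continuous_image K)
    then show ?thesis unfolding bounded_iff by auto
  qed
  then obtain B where B: "\<And>b x. x \<in> K \<Longrightarrow> norm (?D x b) \<le> B b" by metis
  define M where "M = (\<Sum>b\<in>Basis. \<bar>B b\<bar>)"
  have "onorm (?D x) \<le> M" if x: "x \<in> K" for x
  proof (rule onorm_le)
    fix h
    interpret bounded_linear "?D x" by (rule bl)
    have "?D x h = ?D x (\<Sum>b\<in>Basis. (h \<bullet> b) *\<^sub>R b)" by (simp add: euclidean_representation)
    also have "\<dots> = (\<Sum>b\<in>Basis. (h \<bullet> b) *\<^sub>R ?D x b)" by (simp add: sum scaleR)
    finally have "norm (?D x h) \<le> (\<Sum>b\<in>Basis. norm ((h \<bullet> b) *\<^sub>R ?D x b))" by (simp only: norm_sum)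
    also have "\<dots> \<le> (\<Sum>b\<in>Basis. norm h * \<bar>B b\<bar>)"
    proof (rule sum_mono)
      fix b :: 'a assume b: "b \<in> Basis"
      have "norm (?D x b) \<le> \<bar>B b\<bar>" using B[OF x, of b] by linarith
      then show "norm ((h \<bullet> b) *\<^sub>R ?D x b) \<le> norm h * \<bar>B b\<bar>"
        using Basis_le_norm[OF b, of h] by (auto intro!: mult_mono)
    qed
    finally show "norm (?D x h) \<le> M * norm h" by (simp add: M_def sum_distrib_left mult.commute)
  qed
  then have "norm (f x - f y) \<le> M * norm (x - y)" if "x \<in> K" "y \<in> K" for x y
    using differentiable_bound[OF K(2) d] that by blast
  moreover have "M \<ge> 0" by (simp add: M_def sum_nonneg)
  ultimately show ?thesis using that by blast
qed

lemma periodic_fst_int: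
  fixes F :: "real \<times> 'a \<Rightarrow> 'b"
  assumes "\<And>t x. F (t + 1, x) = F (t, x)"
  shows "F (t + of_int m, x) = F (t, x)"
proof -
  have nat: "F (t + of_nat n, x) = F (t, x)" for n t
  proof (induction n)
    case (Suc n)
    then show ?case using assms[of "t + of_nat n" x] by (simp add: algebra_simps)
  qed simp
  show ?thesis
  proof (cases "m \<ge> 0")
    case True then show ?thesis using nat[of t "nat m"] by simp
  next
    case False then show ?thesis using nat[of "t + of_int m" "nat (- m)"] by simp
  qed
qed

text \<open>Periodicity reduces the first variable of F to a compact interval. In the Lipschitz
  condition both points must be reduced by the same integer; being at most 1 apart, they then lie in
  [-1, 2], whence that interval.\<close>

lemma cr_system_cr_rhs:
  assumes F: "smooth F" and per: "\<And>t x. F (t + 1, x) = F (t, x)" and C: "C > 0"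
  obtains M L where "cr_system (cr_rhs F) C M L"
proof -
  let ?K = "{-1..2} \<times> cball 0 C :: (real \<times> (real^2)) set"
  have F1: "Ck 1 F" using F by (simp only: smooth_def)
  have K: "compact ?K" "convex ?K" by (auto intro: compact_Times convex_Times)
  obtain B where B: "B \<ge> 0" "\<And>x y. x \<in> ?K \<Longrightarrow> y \<in> ?K \<Longrightarrow> norm (F x - F y) \<le> B * norm (x - y)"
    by (rule Ck_1_lipschitz[OF F1 K]) (rule that)
  \<comment> \<open>The first two summands bound F through its distance from F (0, 0); the last
    secures C \<le> M.\<close>
  define M where "M = norm (F (0, 0)) + B * (2 + C) + C"
  have red: "F (t, x) = F (t - \<lfloor>r\<rfloor>, x)" for t r :: real and x
    using periodic_fst_int[of F t "- \<lfloor>r\<rfloor>" x, OF per] by simp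
  show ?thesis
  proof (rule that[of M B], unfold_locales)
    show "0 \<le> C" "0 \<le> B" using C B by auto
    show "C \<le> M" using B C by (simp add: M_def)
    show "cr_rhs F (z + of_real s) w = cr_rhs F z w" for z w s by (simp add: cr_rhs_def)
    fix z w assume w: "cmod w \<le> C"
    have "norm (F (Im z - \<lfloor>Im z\<rfloor>, plane_of w) - F (0, 0)) \<le> B * norm ((Im z - \<lfloor>Im z\<rfloor>, plane_of w) - (0, 0))"
    proof (rule B(2))
      have "-1 \<le> Im z - \<lfloor>Im z\<rfloor>" "Im z - \<lfloor>Im z\<rfloor> \<le> 2" by linarith+
      then show "(Im z - \<lfloor>Im z\<rfloor>, plane_of w) \<in> ?K" using w by simp
      show "(0, 0) \<in> ?K" using C by (simp add: zero_prod_def)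
    qed
    also have "\<dots> \<le> B * (2 + C)"
    proof (rule mult_left_mono[OF _ B(1)])
      have "\<bar>Im z - \<lfloor>Im z\<rfloor>\<bar> \<le> 2" by linarith
      then show "norm ((Im z - \<lfloor>Im z\<rfloor>, plane_of w) - (0, 0)) \<le> 2 + C"
        using norm_Pair_le[of "Im z - \<lfloor>Im z\<rfloor>" "plane_of w"] w by simp
    qed
    finally have "norm (F (Im z, plane_of w)) \<le> M"
      using red[of "Im z" "plane_of w" "Im z"] norm_triangle_sub[of "F (Im z, plane_of w)" "F (0, 0)"] C by (simp add: M_def)
    then show "cmod (cr_rhs F z w) \<le> M" by (simp add: cr_rhs_def norm_mult)
  next
    fix z z' w w' assume z: "cmod (z - z') \<le> 1" and w: "cmod w \<le> C" "cmod w' \<le> C"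
    let ?m = "\<lfloor>Im z\<rfloor>"
    have im: "\<bar>Im z - Im z'\<bar> \<le> cmod (z - z')" using abs_Im_le_cmod[of "z - z'"] by simp
    have "norm (F (Im z - ?m, plane_of w) - F (Im z' - ?m, plane_of w')) \<le> B * norm ((Im z - ?m, plane_of w) - (Im z' - ?m, plane_of w'))"
    proof (rule B(2))
      have "-1 \<le> Im z - ?m" "Im z - ?m \<le> 2" by linarith+
      then show "(Im z - ?m, plane_of w) \<in> ?K" using w by simp
      have "-1 \<le> Im z' - ?m" "Im z' - ?m \<le> 2" using im z by linarith+
      then show "(Im z' - ?m, plane_of w') \<in> ?K" using w by simp
    qed
    also have "\<dots> \<le> B * (cmod (z - z') + cmod (w - w'))"
    proof (rule mult_left_mono[OF _ B(1)])
      have "norm (plane_of w - plane_of w') = cmod (w - w')" by (simp flip: plane_of_simps(2))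
      then show "norm ((Im z - ?m, plane_of w) - (Im z' - ?m, plane_of w')) \<le> cmod (z - z') + cmod (w - w')"
        using norm_Pair_le[of "Im z - Im z'" "plane_of w - plane_of w'"] im by simp
    qed
    finally have "norm (F (Im z, plane_of w) - F (Im z', plane_of w')) \<le> B * (cmod (z - z') + cmod (w - w'))"
      using red[of "Im z" "plane_of w" "Im z"] red[of "Im z'" "plane_of w'" "Im z"] by simp
    then show "cmod (cr_rhs F z w - cr_rhs F z' w') \<le> B * (cmod (z - z') + cmod (w - w'))"
      by (simp add: cr_rhs_def norm_mult flip: right_diff_distrib cpx_simps(2))
  qed
qed

section \<open>Equivalence of the two notions of solution and of omega-limit set\<close>

lemma vector_derivative_pair:
  fixes u :: "real \<times> real \<Rightarrow> real^2"
  assumes "(u has_derivative D) (at (s, t))"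
  shows "vector_derivative (\<lambda>x. u (x, t)) (at s) = D (1, 0)"
    and "vector_derivative (\<lambda>y. u (s, y)) (at t) = D (0, 1)"
proof -
  interpret bounded_linear D using assms by (rule has_derivative_bounded_linear)
  have "((\<lambda>x. (x, t)) has_derivative (\<lambda>h. (h, 0))) (at s)" "((\<lambda>y. (s, y)) has_derivative (\<lambda>h. (0, h))) (at t)"
    by (auto intro!: derivative_eq_intros)
  from has_derivative_compose[OF this(1), of u D] has_derivative_compose[OF this(2), of u D] assms
  have "((\<lambda>x. u (x, t)) has_derivative (\<lambda>h. D (h, 0))) (at s)" "((\<lambda>y. u (s, y)) has_derivative (\<lambda>h. D (0, h))) (at t)"
    by auto
  moreover have "(\<lambda>h. D (h, 0)) = (\<lambda>h. h *\<^sub>R D (1, 0))" "(\<lambda>h. D (0, h)) = (\<lambda>h. h *\<^sub>R D (0, 1))"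
    unfolding fun_eq_iff scaleR[symmetric] by simp_all
  ultimately show "vector_derivative (\<lambda>x. u (x, t)) (at s) = D (1, 0)"
    "vector_derivative (\<lambda>y. u (s, y)) (at t) = D (0, 1)"
    by (simp_all only: vector_derivative_at has_vector_derivative_def)
qed

lemma cr_equation_cpx:
  "a - J *v (b - f) = 0 \<longleftrightarrow> cpx a + \<i> * cpx b = \<i> * cpx f"
proof -
  have "a - J *v (b - f) = 0 \<longleftrightarrow> cpx (a - J *v (b - f)) = 0"
    by (metis cpx_simps(4) plane_of_cpx)
  also have "\<dots> \<longleftrightarrow> cpx a + \<i> * cpx b = \<i> * cpx f"
    by (auto simp: cpx_simps cpx_J algebra_simps)
  finally show ?thesis .
qed

lemma solutions_iff_sol:
  assumes "cr_system (cr_rhs F) C M L"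
  shows "u \<in> solutions F C \<longleftrightarrow> to_cpx u \<in> cr_system.sol (cr_rhs F) C"
proof -
  interpret cr_system "cr_rhs F" C M L by (rule assms)
  show ?thesis
  proof
    assume u: "u \<in> solutions F C"
    then have u1: "Ck 1 u" unfolding solutions_def by blast
    let ?D = "\<lambda>z. frechet_derivative u (at (Re z, Im z))"
    have der: "(u has_derivative ?D z) (at (Re z, Im z))" for z
      using u1 unfolding Ck_1_iff by (simp add: frechet_derivative_works)
    have "has_partials (to_cpx u) (\<lambda>z. cpx (?D z (1, 0))) (\<lambda>z. cpx (?D z (0, 1)))"
    proof (rule has_partialsI)
      have c: "continuous_on UNIV (\<lambda>z. cpx (?D z v))" for v
      proof (rule bounded_linear.continuous_on[OF bounded_linear_cpx])
        have "continuous_on UNIV (\<lambda>p. frechet_derivative u (at p) v)" using u1 unfolding Ck_1_iff by blast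
        then show "continuous_on UNIV (\<lambda>z. ?D z v)"
          by (rule continuous_on_compose2) (auto intro!: continuous_intros)
      qed
      show "continuous_on UNIV (\<lambda>z. cpx (?D z (1, 0)))" "continuous_on UNIV (\<lambda>z. cpx (?D z (0, 1)))" by (rule c)+
      fix z
      interpret D: bounded_linear "?D z" using der by (rule has_derivative_bounded_linear)
      have "((\<lambda>z. (Re z, Im z)) has_derivative (\<lambda>h. (Re h, Im h))) (at z)"
        by (auto intro!: derivative_eq_intros)
      from bounded_linear.has_derivative[OF bounded_linear_cpx has_derivative_compose[OF this der]]
      have "(to_cpx u has_derivative (\<lambda>h. cpx (?D z (Re h, Im h)))) (at z)"
        by (simp add: to_cpx_def[abs_def])
      moreover have "cpx (?D z (Re h, Im h)) = of_real (Re h) * cpx (?D z (1, 0)) + of_real (Im h) * cpx (?D z (0, 1))" for h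
      proof -
        have "(Re h, Im h) = Re h *\<^sub>R (1, 0) + Im h *\<^sub>R (0, 1)" by simp
        then have "?D z (Re h, Im h) = Re h *\<^sub>R ?D z (1, 0) + Im h *\<^sub>R ?D z (0, 1)"
          by (simp only: D.add D.scaleR)
        then show ?thesis by (simp only: cpx_simps scaleR_conv_of_real[where 'a = complex])
      qed
      ultimately show "(to_cpx u has_derivative (\<lambda>h. of_real (Re h) * cpx (?D z (1, 0)) + of_real (Im h) * cpx (?D z (0, 1)))) (at z)"
        by simp
    qed
    moreover have "cpx (?D z (1, 0)) + \<i> * cpx (?D z (0, 1)) = cr_rhs F z (to_cpx u z)" for z
    proof -
      have "?D z (1, 0) - J *v (?D z (0, 1) - F (Im z, u (Re z, Im z))) = 0"
        using u vector_derivative_pair[OF der[of z]] unfolding solutions_def by auto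
      then show ?thesis unfolding cr_equation_cpx by (simp add: cr_rhs_def to_cpx_def)
    qed
    moreover have "to_cpx u (z + \<i>) = to_cpx u z" "cmod (to_cpx u z) \<le> C" for z
      using u by (auto simp: solutions_def to_cpx_def)
    ultimately show "to_cpx u \<in> sol" unfolding sol_def by blast
  next
    define U where "U = to_cpx u"
    assume "to_cpx u \<in> sol"
    then have "U \<in> sol" by (simp add: U_def)
    then obtain Ux Uy where U: "has_partials U Ux Uy" "\<And>z. Ux z + \<i> * Uy z = cr_rhs F z (U z)"
      "\<And>z. U (z + \<i>) = U z" "\<And>z. cmod (U z) \<le> C" by (rule solE) (rule that)
    have u: "u p = plane_of (U (Complex (fst p) (snd p)))" for p
      using of_cpx_to_cpx[of u] by (metis U_def of_cpx_def)
    let ?D = "\<lambda>p h. plane_of (of_real (fst h) * Ux (Complex (fst p) (snd p)) + of_real (snd h) * Uy (Complex (fst p) (snd p)))"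
    have der: "(u has_derivative ?D p) (at p)" for p
    proof -
      have "((\<lambda>p. Complex (fst p) (snd p)) has_derivative (\<lambda>h. Complex (fst h) (snd h))) (at p)"
        by (auto intro!: derivative_eq_intros)
      from bounded_linear.has_derivative[OF bounded_linear_plane_of has_derivative_compose[OF this has_partials_derivative[OF U(1)]]]
      show ?thesis by (simp add: u[abs_def])
    qed
    have "Ck 1 u"
      unfolding Ck_1_iff
    proof (intro conjI allI)
      show "u differentiable at p" for p by (rule differentiableI[OF der])
      fix v
      have cc: "continuous_on UNIV (\<lambda>p. V (Complex (fst p) (snd p)))" if "continuous_on UNIV V" for V :: "complex \<Rightarrow> complex"
        by (rule continuous_on_compose2[OF that]) (auto simp: Complex_eq intro!: continuous_intros)
      have "continuous_on UNIV (\<lambda>p. ?D p v)"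
        by (intro bounded_linear.continuous_on[OF bounded_linear_plane_of] continuous_intros cc
            has_partials_continuous_x[OF U(1)] has_partials_continuous_y[OF U(1)])
      then show "continuous_on UNIV (\<lambda>p. frechet_derivative u (at p) v)"
        unfolding frechet_derivative_at[OF der, symmetric] .
    qed
    moreover have "u (s, t + 1) = u (s, t)" for s t
    proof -
      have "Complex s (t + 1) = Complex s t + \<i>" by (simp add: complex_eq_iff)
      then show ?thesis by (simp add: u U(3))
    qed
    moreover have "vector_derivative (\<lambda>x. u (x, t)) (at s) - J *v (vector_derivative (\<lambda>y. u (s, y)) (at t) - F (t, u (s, t))) = 0" for s t
      unfolding vector_derivative_pair[OF der[of "(s, t)"]] cr_equation_cpx
      using U(2)[of "Complex s t"] by (simp add: cr_rhs_def u)
    moreover have "norm (u (s, t)) \<le> C" for s t by (simp add: u U(4))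
    ultimately show "u \<in> solutions F C" unfolding solutions_def by blast
  qed
qed

lemma limitin_solution_space:
  "limitin (solution_space F C) f w sequentially \<longleftrightarrow>
     w \<in> solutions F C \<and> (\<forall>\<^sub>F n in sequentially. f n \<in> solutions F C) \<and> lconv (\<lambda>n. to_cpx (f n)) (to_cpx w)"
  unfolding solution_space_def limitin_subtopology limitin_compact_conv uniform_limit_to_cpx ..

lemma omega_limit_iff:
  assumes sys: "cr_system (cr_rhs F) C M L" and u: "u \<in> solutions F C"
  shows "w \<in> omega_limit F C u \<longleftrightarrow> to_cpx w \<in> cr_system.omega (cr_rhs F) C (to_cpx u)"
proof -
  interpret cr_system "cr_rhs F" C M L by (rule sys)
  have fl: "to_cpx (flow \<sigma> u) = shift \<sigma> (to_cpx u)" for \<sigma>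
    by (simp add: fun_eq_iff to_cpx_def flow_def shift_def)
  have "flow \<sigma> u \<in> solutions F C" for \<sigma>
    using u shift_sol unfolding solutions_iff_sol[OF sys] fl by blast
  then show ?thesis
    unfolding omega_limit_def omega_def limitin_solution_space fl
    by (auto simp: solutions_iff_sol[OF sys])
qed

text \<open>Agreement at the single point (0, t0) already denies apartness on the circle s = 0, so
  injectivity follows from \<open>omega_pair_apart\<close> for every t0. The inverse is continuous
  because the projection is a closed map, which is a matter of sequential compactness.\<close>

theorem theorem1p2:
  fixes F :: "real \<times> (real^2) \<Rightarrow> real^2" and C t\<^sub>0 :: real
  assumes "smooth F"
    and "\<And>t x. F (t + 1, x) = F (t, x)"
    and "C > 0"
    and "u \<in> solutions F C"
  shows "homeomorphic_map
           (subtopology (solution_space F C) (omega_limit F C u))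
           (top_of_set (proj t\<^sub>0 ` omega_limit F C u))
           (proj t\<^sub>0)"
proof -
  obtain M L where sys: "cr_system (cr_rhs F) C M L"
    by (rule cr_system_cr_rhs[OF assms(1-3)]) (rule that)
  interpret cr_system "cr_rhs F" C M L by (rule sys)
  let ?\<Omega> = "omega_limit F C u" and ?u = "to_cpx u"
  let ?X = "subtopology (solution_space F C) ?\<Omega>"
  note iff = omega_limit_iff[OF sys assms(4)]
  have us: "?u \<in> sol" using assms(4) solutions_iff_sol[OF sys] by blast
  have sub: "?\<Omega> \<subseteq> solutions F C" by (auto simp: omega_limit_def)
  have X: "?X = subtopology compact_conv_topology ?\<Omega>"
    unfolding solution_space_def subtopology_subtopology using sub by (simp add: Int_absorb1)
  have top: "topspace ?X = ?\<Omega>" unfolding X by simp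
  have cpx_proj: "cpx (proj t\<^sub>0 w) = to_cpx w (Complex 0 t\<^sub>0)" for w by (simp add: proj_def to_cpx_def)
  have inj: "inj_on (proj t\<^sub>0) ?\<Omega>"
  proof (rule inj_onI)
    fix w1 w2 assume w: "w1 \<in> ?\<Omega>" "w2 \<in> ?\<Omega>" and e: "proj t\<^sub>0 w1 = proj t\<^sub>0 w2"
    have "\<not> apart (to_cpx w1) (to_cpx w2) 0"
      unfolding apart_def using e by (metis cpx_proj)
    then have "to_cpx w1 = to_cpx w2" using omega_pair_apart[OF us] w iff by blast
    then show "w1 = w2" by (metis of_cpx_to_cpx)
  qed
  have cont: "continuous_map ?X (top_of_set (proj t\<^sub>0 ` ?\<Omega>)) (proj t\<^sub>0)"
    unfolding continuous_map_in_subtopology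
  proof
    have "continuous_map compact_conv_topology euclidean (proj t\<^sub>0)"
      unfolding continuous_map_def
    proof (intro conjI allI impI)
      fix V :: "(real^2) set" assume "openin euclidean V"
      then have V: "open V" by simp
      show "openin compact_conv_topology {w \<in> topspace compact_conv_topology. proj t\<^sub>0 w \<in> V}"
        unfolding openin_compact_conv
      proof
        fix f assume "f \<in> {w \<in> topspace compact_conv_topology. proj t\<^sub>0 w \<in> V}"
        then obtain e where e: "e > 0" "ball (proj t\<^sub>0 f) e \<subseteq> V" using V by (auto simp: open_contains_ball)
        \<comment> \<open>Evaluation at a point is continuous because a singleton is
          compact.\<close>
        show "\<exists>K e. compact K \<and> 0 < e \<and> {g. \<forall>x\<in>K. dist (g x) (f x) < e} \<subseteq> {w \<in> topspace compact_conv_topology. proj t\<^sub>0 w \<in> V}"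
          by (intro exI[of _ "{(0, t\<^sub>0)}"] exI[of _ e]) (use e in \<open>auto simp: proj_def dist_commute subset_iff\<close>)
      qed
    qed auto
    then show "continuous_map ?X euclidean (proj t\<^sub>0)"
      unfolding X by (rule continuous_map_from_subtopology)
    show "proj t\<^sub>0 \<in> topspace ?X \<rightarrow> proj t\<^sub>0 ` ?\<Omega>" unfolding top by auto
  qed
  have closed: "closed_map ?X (top_of_set (proj t\<^sub>0 ` ?\<Omega>)) (proj t\<^sub>0)"
    unfolding closed_map_def
  proof (intro allI impI)
    fix A assume A: "closedin ?X A"
    then have A\<Omega>: "A \<subseteq> ?\<Omega>" using closedin_subset top by blast
    show "closedin (top_of_set (proj t\<^sub>0 ` ?\<Omega>)) (proj t\<^sub>0 ` A)"
      unfolding closedin_closed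
    proof (intro exI[of _ "closure (proj t\<^sub>0 ` A)"] conjI closed_closure equalityI subsetI)
      show "x \<in> proj t\<^sub>0 ` ?\<Omega> \<inter> closure (proj t\<^sub>0 ` A)" if "x \<in> proj t\<^sub>0 ` A" for x
        by (rule IntI[OF subsetD[OF image_mono[OF A\<Omega>] that] subsetD[OF closure_subset that]])
      \<comment> \<open>That l is attained on A has to be shown. Preimages in A of a sequence
        tending to l have a subsequence converging in \<omega>(u); its limit lies in A since A is
        closed there, and it projects to l.\<close>
      fix l assume "l \<in> proj t\<^sub>0 ` ?\<Omega> \<inter> closure (proj t\<^sub>0 ` A)"
      then obtain y where y: "\<And>n. y n \<in> proj t\<^sub>0 ` A" and l: "y \<longlonglongrightarrow> l"
        by (auto simp: closure_sequential)
      then have "\<forall>n. \<exists>a. a \<in> A \<and> y n = proj t\<^sub>0 a" by blast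
      then obtain a where a: "\<And>n. a n \<in> A" "\<And>n. y n = proj t\<^sub>0 (a n)" by metis
      have om: "to_cpx (a n) \<in> omega ?u" for n using a(1) A\<Omega> iff by blast
      then have so: "to_cpx (a n) \<in> sol" for n by (simp add: omega_def)
      obtain k V where k: "strict_mono (k :: nat \<Rightarrow> nat)" "V \<in> sol" "lconv (\<lambda>n. to_cpx (a (k n))) V"
        by (rule sol_compact[of "\<lambda>n. to_cpx (a n)", OF so]) (rule that)
      have V: "V \<in> omega ?u" by (rule omega_closed[OF us om k(3)])
      define v where "v = of_cpx V"
      have v: "v \<in> ?\<Omega>" using V iff by (simp add: v_def)
      have ak: "a (k n) \<in> solutions F C" "a (k n) \<in> ?\<Omega>" for n using a(1) A\<Omega> sub by blast+
      have "limitin (solution_space F C) (\<lambda>n. a (k n)) v sequentially"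
        unfolding limitin_solution_space using ak v sub k(3) by (auto simp: v_def)
      then have "limitin ?X (\<lambda>n. a (k n)) v sequentially"
        unfolding limitin_subtopology using v ak by simp
      then have "v \<in> A" by (rule limitin_closedin[OF _ A]) (use a in auto)
      have "(\<lambda>n. cpx (y (k n))) \<longlonglongrightarrow> V (Complex 0 t\<^sub>0)"
        using lconv_pointwise[OF k(3), of "Complex 0 t\<^sub>0"] by (simp add: a(2) cpx_proj)
      moreover have "(\<lambda>n. cpx (y (k n))) \<longlonglongrightarrow> cpx l"
        using bounded_linear.tendsto[OF bounded_linear_cpx LIMSEQ_subseq_LIMSEQ[OF l k(1)]] by (simp add: o_def)
      ultimately have "cpx l = V (Complex 0 t\<^sub>0)" using LIMSEQ_unique by blast
      then have "cpx l = cpx (proj t\<^sub>0 v)" by (simp add: cpx_proj v_def)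
      then have "l = proj t\<^sub>0 v" by (metis plane_of_cpx)
      then show "l \<in> proj t\<^sub>0 ` A" using \<open>v \<in> A\<close> by blast
    qed
  qed
  show ?thesis
    by (rule bijective_closed_imp_homeomorphic_map[OF cont closed])
      (simp_all only: top topspace_euclidean_subtopology inj)
qed

end
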